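(* There exist $C>0$ and $N\in\mathbb{N}$ such that, for all $m\ge N$ and all $u$ in the $H^1(\nu)$-closure of $\mathrm{Span}\{q_j\}_{j>m}$, $$\|u\|_{L^2(\nu)}\le\frac{C}{m^{3/4}}\,\|u\|_{H^1(\nu)}.$$ In particular, if $\kappa=4$ this holds with $C=1.2233$ and $N=2187$.
   Context: Let $\kappa\in\mathbb{R}$, $V(x)=\frac{x^4}{4}-\kappa\frac{x^2}{2}$, $Z=\int_{\mathbb{R}}e^{-V(x)}dx$, and $\nu(dx)=e^{-V(x)}dx/Z$. Let $\{p_n\}_{n\ge0}$ be the orthonormal polynomials of $L^2(\nu)$, with $\deg p_n=n$, positive leading coefficient, and $p_0=1$. Let $H^1(\nu)=\{u\in L^2(\nu):u'\in L^2(\nu)\}$ (weak derivative), with inner product $(u,v)=\int u'v'\,d\nu+\int u\,d\nu\int v\,d\nu$ and norm $\|u\|_{H^1(\nu)}=(u,u)^{1/2}$. Let $\|u\|_{L^2(\nu)}=(\int u^2d\nu)^{1/2}$. Let $q_0=1$ and, for $n\ge1$, let $q_n$ be the unique polynomial with $q_n'=p_{n-1}$ and $\int q_n\,d\nu=0$. *)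

theory Defs
  imports "HOL-Analysis.Analysis" "HOL-Computational_Algebra.Polynomial"
begin

definition V :: "real \<Rightarrow> real \<Rightarrow> real" where
  "V \<kappa> x = x ^ 4 / 4 - \<kappa> * x ^ 2 / 2"

definition Z :: "real \<Rightarrow> real" where
  "Z \<kappa> = (LINT x|lborel. exp (- V \<kappa> x))"

definition nu :: "real \<Rightarrow> real measure" where
  "nu \<kappa> = density lborel (\<lambda>x. ennreal (exp (- V \<kappa> x) / Z \<kappa>))"

definition p :: "real \<Rightarrow> nat \<Rightarrow> real poly" where
  "p \<kappa> = (THE P. \<forall>n. degree (P n) = n \<and> lead_coeff (P n) > 0 \<and>
      (\<forall>k. (LINT x|nu \<kappa>. poly (P n) x * poly (P k) x) = (if n = k then 1 else 0)))"

fun q :: "real \<Rightarrow> nat \<Rightarrow> real poly" where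
  "q \<kappa> 0 = 1"
| "q \<kappa> (Suc n) = (THE Q. pderiv Q = p \<kappa> n \<and> (LINT x|nu \<kappa>. poly Q x) = 0)"

definition test_fun :: "(real \<Rightarrow> real) \<Rightarrow> bool" where
  "test_fun \<phi> \<longleftrightarrow> (\<forall>k x. ((deriv ^^ k) \<phi>) differentiable (at x)) \<and>
                     (\<exists>R. \<forall>x. \<bar>x\<bar> > R \<longrightarrow> \<phi> x = 0)"

definition L2 :: "real \<Rightarrow> (real \<Rightarrow> real) set" where
  "L2 \<kappa> = {u. u \<in> borel_measurable lborel \<and> integrable (nu \<kappa>) (\<lambda>x. (u x)^2)}"

definition weak_deriv :: "(real \<Rightarrow> real) \<Rightarrow> (real \<Rightarrow> real) \<Rightarrow> bool" where
  "weak_deriv u g \<longleftrightarrow> (\<forall>\<phi>. test_fun \<phi> \<longrightarrow>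
      (LINT x|lborel. u x * deriv \<phi> x) = - (LINT x|lborel. g x * \<phi> x))"

definition H1 :: "real \<Rightarrow> (real \<Rightarrow> real) set" where
  "H1 \<kappa> = {u. u \<in> L2 \<kappa> \<and> (\<exists>g. g \<in> L2 \<kappa> \<and> weak_deriv u g)}"

definition wderiv :: "real \<Rightarrow> (real \<Rightarrow> real) \<Rightarrow> real \<Rightarrow> real" where
  "wderiv \<kappa> u = (SOME g. g \<in> L2 \<kappa> \<and> weak_deriv u g)"

definition L2norm :: "real \<Rightarrow> (real \<Rightarrow> real) \<Rightarrow> real" where
  "L2norm \<kappa> u = sqrt (LINT x|nu \<kappa>. (u x)^2)"

definition H1norm :: "real \<Rightarrow> (real \<Rightarrow> real) \<Rightarrow> real" where
  "H1norm \<kappa> u = sqrt ((LINT x|nu \<kappa>. (wderiv \<kappa> u x)^2) + (LINT x|nu \<kappa>. u x)^2)"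

definition qspan :: "real \<Rightarrow> nat \<Rightarrow> (real \<Rightarrow> real) set" where
  "qspan \<kappa> m = {v. \<exists>c M. v = (\<lambda>x. \<Sum>j\<in>{m<..M}. c j * poly (q \<kappa> j) x)}"

definition qclosure :: "real \<Rightarrow> nat \<Rightarrow> (real \<Rightarrow> real) set" where
  "qclosure \<kappa> m = {u \<in> H1 \<kappa>. \<exists>v. (\<forall>k. v k \<in> qspan \<kappa> m) \<and>
       (\<lambda>k. H1norm \<kappa> (\<lambda>x. u x - v k x)) \<longlonglongrightarrow> 0}"

end

theory Submission
  imports Defs "HOL-Probability.Sinc_Integral"
begin

text \<open>Let \<open>\<pi>\<^sub>n\<close> be the monic orthogonal polynomials and \<open>c\<^sub>n = h\<^sub>n / h\<^sub>n\<^sub>-\<^sub>1\<close> the quotients of their squared norms.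
  Integration by parts gives the string equation \<open>c\<^sub>n (c\<^sub>n\<^sub>+\<^sub>1 + c\<^sub>n + c\<^sub>n\<^sub>-\<^sub>1 - \<kappa>) = n\<close> and the fact that the
  orthonormal coefficients \<open>e\<close> of a polynomial \<open>v\<close> and \<open>d\<close> of \<open>v'\<close> satisfy
  \<open>d\<^sub>k = k / sqrt c\<^sub>k * e\<^sub>k + sqrt (c\<^sub>k c\<^sub>k\<^sub>+\<^sub>1 c\<^sub>k\<^sub>+\<^sub>2) * e\<^sub>k\<^sub>+\<^sub>2\<close>, where \<open>d\<^sub>k\<close> is the coefficient of degree \<open>k - 1\<close>.
  The string equation forces \<open>c\<^sub>n\<close> to be close to \<open>sqrt (n / 3)\<close>, so the first term
  dominates the second one by a factor of about 3. If \<open>d\<^sub>k = 0\<close> for \<open>k \<le> m\<close>, the modes \<open>e\<^sub>k\<close> with \<open>k \<le> m\<close> decay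
  geometrically below \<open>m\<close> and the others are controlled by \<open>d\<close>; a weighted Young inequality shows
  that \<open>c\<^sub>n \<le> 0.6 sqrt n\<close> for \<open>n > m\<close> suffices for the constant \<open>sqrt 0.6 / 0.64 < 1.2233\<close>.

  The estimate passes to the closure by a Poincare inequality for \<open>H\<^sup>1\<close>. A function with a weak derivative \<open>g\<close>
  is, up to a constant, a primitive of \<open>g\<close>, and the Poincare inequality follows from Cauchy--Schwarz, because
  \<open>exp (- V x)\<close> times the integral of \<open>exp V\<close> from 0 to \<open>x\<close> is \<open>O(1 / (1 + x\<^sup>2))\<close>.\<close>

section \<open>Orthogonal polynomials of a quartic weight\<close>

text \<open>By \<open>q_j' = p_(j-1)\<close>, an element v of the span has mean 0 and v' has no
  modes of degree below m. But v itself does have low modes, which can only be bounded through the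
  vanishing of d. The rate comes from \<open>k / sqrt c_k\<close>, which is of order
  \<open>k^(3/4)\<close>. Iterating the string equation forward in n is unstable, so bounds cannot
  be propagated from initial values. Positivity of all \<open>c_n\<close> singles out the solution
  instead: a bound valid for all large n is improved in turn, lower from upper and upper from lower.
  Heuristically \<open>c_n\<close> is \<open>sqrt (n / 3) + \<kappa> / 6\<close> up to smaller
  terms, so \<kappa> influences only how large m must be; the gap between 1 / sqrt 3 = 0.577 and 0.6
  absorbs it. With 0.6 the natural Young weight is \<open>0.6^2 = 0.36\<close>. It leaves the factor
  0.64 on the two modes just above m and \<open>0.64^2\<close> further up, so the mass of the low
  modes may raise the former by 1 / 0.64 = 1.5625. The limiting ratio is 9/8, far below
  that.\<close>

lemma exists_antiderivative_poly: "\<exists>Q. pderiv Q = (P :: real poly)"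
proof -
  define Q where "Q = (\<Sum>i\<le>degree P. monom (coeff P i / real (Suc i)) (Suc i))"
  have "pderiv Q = (\<Sum>i\<le>degree P. monom (coeff P i) i)"
    unfolding Q_def higher_pderiv_sum[of 1, simplified]
    by (intro sum.cong refl) (simp add: pderiv_monom del: of_nat_Suc)
  also have "\<dots> = P" by (rule poly_as_sum_of_monoms)
  finally show ?thesis by blast
qed

definition X :: "real poly" where "X = [:0, 1:]"

definition dV :: "real \<Rightarrow> real poly" where "dV \<kappa> = [:0, -\<kappa>, 0, 1:]"

lemma dV_mult: "dV \<kappa> * P = X * (X * (X * P)) - smult \<kappa> (X * P)"
  by (simp add: dV_def X_def algebra_simps)

lemma degree_X_mult [simp]: "P \<noteq> 0 \<Longrightarrow> degree (X * P) = Suc (degree P)"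
  by (simp add: X_def degree_mult_eq)

lemma coeff_X_mult [simp]: "coeff (X * P) (Suc n) = coeff P n"
  by (simp add: X_def)

text \<open>The algebra sees the measure only through these properties of \<open>E P\<close>, the
  integral of P against \<open>nu\<close>. Evenness removes the diagonal term of the three-term
  recurrence, and \<open>E_pderiv\<close> is integration by parts against \<open>exp (- V)\<close>,
  with \<open>dV\<close> the derivative of V.\<close>

locale freud_functional =
  fixes E :: "real poly \<Rightarrow> real" and \<kappa> :: real
  assumes E_add: "E (P + Q) = E P + E Q"
    and E_smult: "E (smult a P) = a * E P"
    and E_one: "E 1 = 1"
    and E_square_pos: "P \<noteq> 0 \<Longrightarrow> E (P * P) > 0"
    and E_even: "E (pcompose P [:0, -1:]) = E P"
    and E_pderiv: "E (pderiv P) = E (dV \<kappa> * P)"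
begin

lemma E_0 [simp]: "E 0 = 0"
  using E_smult[of 0 0] by simp

lemma E_uminus: "E (- P) = - E P"
  using E_smult[of "-1" P] by simp

lemma E_diff: "E (P - Q) = E P - E Q"
  using E_add[of P "- Q"] by (simp add: E_uminus)

lemma E_sum: "E (\<Sum>i\<in>A. f i) = (\<Sum>i\<in>A. E (f i))"
  by (induction A rule: infinite_finite_induct) (auto simp: E_add)

text \<open>The three-term recurrence of monic orthogonal polynomials, taken as the definition in
  place of Gram-Schmidt. It has no multiple of \<open>mon (Suc n)\<close> on the right because
  \<open>E\<close> is even; orthogonality is proved afterwards.\<close>

fun mon :: "nat \<Rightarrow> real poly" where
  "mon 0 = 1"
| "mon (Suc 0) = X"
| "mon (Suc (Suc n)) = X * mon (Suc n)
     - smult (E (mon (Suc n) * mon (Suc n)) / E (mon n * mon n)) (mon n)"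

definition h :: "nat \<Rightarrow> real" where "h n = E (mon n * mon n)"

definition c :: "nat \<Rightarrow> real" where "c n = (if n = 0 then 0 else h n / h (n - 1))"

lemma mon_rec: "X * mon n = mon (Suc n) + smult (c n) (mon (n - 1))"
  by (cases n) (auto simp: c_def h_def)

lemma mon_Suc: "mon (Suc n) = X * mon n - smult (c n) (mon (n - 1))"
  using mon_rec[of n] by simp

declare mon.simps(2,3) [simp del]

lemma degree_lead_mon: "degree (mon n) = n \<and> coeff (mon n) n = 1"
proof (induction n rule: less_induct)
  case (less n)
  show ?case
  proof (cases n)
    case (Suc k)
    have IH: "degree (mon k) = k" "coeff (mon k) k = 1" using less Suc by auto
    have "degree (mon (k - 1)) = k - 1" using less[of "k - 1"] Suc by auto
    hence d: "degree (smult (c k) (mon (k - 1))) < Suc k"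
      using degree_smult_le[of "c k" "mon (k - 1)"] by linarith
    have "mon k \<noteq> 0" using IH(2) by auto
    hence d2: "degree (X * mon k) = Suc k" using IH(1) by (simp add: degree_mult_eq)
    have "degree (mon n) = n"
      using d d2 unfolding Suc mon_Suc by (metis diff_conv_add_uminus degree_add_eq_left degree_minus)
    moreover have "coeff (mon n) n = 1"
      using IH coeff_eq_0[OF d] unfolding Suc mon_Suc by simp
    ultimately show ?thesis by simp
  qed simp
qed

lemma degree_mon [simp]: "degree (mon n) = n" and lead_coeff_mon [simp]: "coeff (mon n) n = 1"
  using degree_lead_mon by auto

lemma mon_neq_0 [simp]: "mon n \<noteq> 0"
  using lead_coeff_mon[of n] by (metis coeff_0 zero_neq_one)

lemma h_pos: "h n > 0"
  by (simp add: h_def E_square_pos)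

lemma c_0 [simp]: "c 0 = 0"
  by (simp add: c_def)

lemma c_pos: "n > 0 \<Longrightarrow> c n > 0"
  by (simp add: c_def h_pos)

lemma h_Suc: "h (Suc n) = c (Suc n) * h n"
  using h_pos[of n] by (simp add: c_def)

lemma mon_reflect: "pcompose (mon n) [:0, -1:] = smult ((-1) ^ n) (mon n)"
proof (induction n rule: less_induct)
  case (less n)
  show ?case
  proof (cases n)
    case (Suc k)
    have 1: "pcompose (mon k) [:0, -1:] = smult ((-1) ^ k) (mon k)" using less Suc by simp
    have 2: "smult (c k) (pcompose (mon (k - 1)) [:0, -1:]) = smult (c k) (smult (-((-1) ^ k)) (mon (k - 1)))"
      using less[of "k - 1"] Suc by (cases k) auto
    have 3: "pcompose X [:0, -1:] = - X" by (simp add: X_def pcompose_pCons)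
    show ?thesis unfolding Suc mon_Suc pcompose_diff pcompose_mult pcompose_smult 1 2 3
      by (simp add: smult_diff_right mult.commute)
  qed (simp add: pcompose_1)
qed

lemma E_odd_zero: assumes "odd (m + n)" shows "E (mon m * mon n) = 0"
proof -
  have "E (mon m * mon n) = E (pcompose (mon m * mon n) [:0, -1:])" by (simp add: E_even)
  also have "pcompose (mon m * mon n) [:0, -1:] = smult ((-1) ^ (m + n)) (mon m * mon n)"
    by (simp add: pcompose_mult mon_reflect power_add mult.commute)
  also have "E \<dots> = - E (mon m * mon n)" using assms by (simp only: E_smult uminus_power_if) simp
  finally show ?thesis by simp
qed

text \<open>Unfolding the recurrence of \<open>mon n\<close> and moving X to the other factor leaves
  three cases: for neighbouring degrees parity decides, at distance two the coefficient
  \<open>c j\<close> is exactly the one that cancels, and further down all pairings vanish by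
  induction.\<close>

lemma E_mon_orth_less: "k < n \<Longrightarrow> E (mon n * mon k) = 0"
proof (induction n arbitrary: k rule: less_induct)
  case (less n)
  then obtain j where n: "n = Suc j" by (cases n) auto
  have exp1: "E (mon n * mon k) = E (mon j * (X * mon k)) - c j * E (mon (j - 1) * mon k)"
    by (simp add: n mon_Suc left_diff_distrib right_diff_distrib E_diff E_smult mult_ac)
  have exp2: "E (mon j * (X * mon k)) = E (mon j * mon (Suc k)) + c k * E (mon j * mon (k - 1))"
    by (simp only: mon_rec ring_distribs E_add mult_smult_right E_smult)
  consider "k = j" | "Suc k = j" | "Suc k < j" using less.prems n by linarith
  then show ?case
  proof cases
    case 1
    then show ?thesis using E_odd_zero[of n k] n by simp
  next
    case 2
    have "c k * E (mon j * mon (k - 1)) = 0" using less.IH[of j "k - 1"] n 2 by (cases k) auto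
    then have "E (mon n * mon k) = h j - c j * h k" using exp1 exp2 2 by (auto simp: h_def)
    then show ?thesis using 2 h_Suc[of k] by simp
  next
    case 3
    have "E (mon j * mon (Suc k)) = 0" "E (mon j * mon (k - 1)) = 0" "E (mon (j - 1) * mon k) = 0"
      using less.IH[of j "Suc k"] less.IH[of j "k - 1"] less.IH[of "j - 1" k] n 3 by auto
    then show ?thesis using exp1 exp2 by simp
  qed
qed

lemma E_mon_mon: "E (mon n * mon k) = (if n = k then h n else 0)"
  using E_mon_orth_less[of k n] E_mon_orth_less[of n k]
  by (cases n k rule: linorder_cases) (auto simp: h_def mult.commute)

lemma degree_cancel_lead: assumes "degree P \<le> Suc D" shows "degree (P - smult (coeff P (Suc D)) (mon (Suc D))) \<le> D"
proof (rule degree_le, safe)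
  fix i assume "D < i"
  show "coeff (P - smult (coeff P (Suc D)) (mon (Suc D))) i = 0"
  proof (cases "i = Suc D")
    case False
    then have "coeff P i = 0" "coeff (mon (Suc D)) i = 0"
      using \<open>D < i\<close> assms by (auto intro!: coeff_eq_0)
    then show ?thesis by simp
  qed simp
qed

lemma mon_span: "degree P \<le> D \<Longrightarrow> \<exists>f. P = (\<Sum>n\<le>D. smult (f n) (mon n))"
proof (induction D arbitrary: P)
  case 0
  then obtain a where "P = [:a:]" by (auto elim: degree_eq_zeroE)
  then show ?case by (intro exI[of _ "\<lambda>_. a"]) simp
next
  case (Suc D)
  define P' where "P' = P - smult (coeff P (Suc D)) (mon (Suc D))"
  have "degree P' \<le> D" unfolding P'_def by (rule degree_cancel_lead[OF Suc.prems])
  then obtain f where f: "P' = (\<Sum>n\<le>D. smult (f n) (mon n))" using Suc.IH by blast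
  have "P = (\<Sum>n\<le>Suc D. smult ((f(Suc D := coeff P (Suc D))) n) (mon n))"
    using f by (simp add: P'_def algebra_simps)
  then show ?case by blast
qed

lemma mon_expansion:
  assumes "degree P \<le> D"
  shows "P = (\<Sum>n\<le>D. smult (E (P * mon n) / h n) (mon n))"
proof -
  obtain f where f: "P = (\<Sum>n\<le>D. smult (f n) (mon n))" using mon_span[OF assms] by blast
  have "E (P * mon k) = f k * h k" if "k \<le> D" for k
    unfolding f sum_distrib_right E_sum mult_smult_left E_smult E_mon_mon
    using that by (simp add: if_distrib[of "\<lambda>x. _ * x"] cong: if_cong)
  then have "(\<Sum>n\<le>D. smult (E (P * mon n) / h n) (mon n)) = (\<Sum>n\<le>D. smult (f n) (mon n))"
    using h_pos by (intro sum.cong refl) (simp add: less_imp_neq[symmetric])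
  then show ?thesis using f by simp
qed

lemma parseval:
  assumes "degree P \<le> D"
  shows "E (P * P) = (\<Sum>n\<le>D. (E (P * mon n))\<^sup>2 / h n)"
proof -
  have "E (P * P) = E (P * (\<Sum>n\<le>D. smult (E (P * mon n) / h n) (mon n)))"
    using mon_expansion[OF assms] by simp
  also have "\<dots> = (\<Sum>n\<le>D. (E (P * mon n))\<^sup>2 / h n)"
    by (simp add: sum_distrib_left E_sum E_smult power2_eq_square)
  finally show ?thesis .
qed

lemma E_mon_lower: assumes "degree Q < n" shows "E (mon n * Q) = 0"
proof -
  have "mon n * Q = (\<Sum>k\<le>degree Q. smult (E (Q * mon k) / h k) (mon n * mon k))"
    using mon_expansion[of Q "degree Q"] by (metis (no_types, lifting) mult_smult_right order_refl sum.cong sum_distrib_left)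
  then show ?thesis using assms by (auto simp: E_sum E_smult E_mon_mon intro!: sum.neutral)
qed

lemma E_mon_lead: assumes "degree Q \<le> n" shows "E (mon n * Q) = coeff Q n * h n"
proof (cases n)
  case 0
  with assms obtain a where "Q = [:a:]" by (auto elim: degree_eq_zeroE)
  then show ?thesis using 0 E_smult[of a 1] by (simp add: h_def E_one)
next
  case (Suc D)
  have "E (mon n * Q) = E (mon n * (Q - smult (coeff Q n) (mon n))) + coeff Q n * E (mon n * mon n)"
    by (simp add: right_diff_distrib E_diff E_smult)
  moreover have "E (mon n * (Q - smult (coeff Q n) (mon n))) = 0"
    using degree_cancel_lead[of Q D] assms Suc by (intro E_mon_lower) simp
  ultimately show ?thesis by (simp add: h_def)
qed

lemma E_eq_0_imp_eq_0:
  assumes "degree P \<le> D" and "\<And>n. n \<le> D \<Longrightarrow> E (P * mon n) = 0" shows "P = 0"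
  using mon_expansion[OF assms(1)] assms(2) by simp

section \<open>Differentiation in the orthogonal basis\<close>

lemma degree_pderiv_mon_le: "degree (pderiv (mon n)) \<le> n - 1"
  using degree_pderiv[of "mon n"] by simp

text \<open>Integration by parts applied to \<open>v * P\<close>: multiplication by
  \<open>dV\<close> minus differentiation is the formal adjoint of differentiation. Modes of v'
  thereby become pairings with v.\<close>

lemma adjoint_pderiv:
  "E (pderiv v * P) = E (v * (dV \<kappa> * P - pderiv P))"
proof -
  have "pderiv v * P = pderiv (v * P) - v * pderiv P" by (simp add: pderiv_mult algebra_simps)
  then have "E (pderiv v * P) = E (dV \<kappa> * (v * P)) - E (v * pderiv P)" by (simp add: E_diff E_pderiv)
  then show ?thesis by (simp add: E_diff right_diff_distrib mult_ac)
qed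

lemma E_mon_pderiv_mon: "E (mon k * pderiv (mon (Suc k))) = real (Suc k) * h k"
  using E_mon_lead[of "pderiv (mon (Suc k))" k] degree_pderiv_mon_le[of "Suc k"]
  by (simp add: coeff_pderiv)

text \<open>Both sides pair equally with every \<open>mon j\<close>: the pairing with the left side is
  \<open>E (mon k * pderiv (mon j))\<close>, which vanishes by degree for \<open>j \<le> k\<close>, by parity for \<open>j = k + 2\<close>.\<close>
lemma adjoint_mon:
  "dV \<kappa> * mon k - pderiv (mon k) = mon (k + 3) + smult (real (Suc k) / c (Suc k)) (mon (Suc k))"
proof -
  define W where "W = dV \<kappa> * mon k - pderiv (mon k)"
  have EW: "E (W * mon j) = E (mon k * pderiv (mon j))" for j
    unfolding W_def using adjoint_pderiv[of "mon j" "mon k"] by (simp add: mult.commute)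
  have dW: "degree W \<le> k + 3"
    unfolding W_def using degree_mult_le[of "dV \<kappa>" "mon k"] degree_pderiv_mon_le[of k]
    by (intro degree_diff_le) (auto simp: dV_def)
  have cW: "coeff W (k + 3) = 1"
  proof -
    have "coeff (mon k) (k + 1) = 0" "coeff (mon k) (k + 2) = 0" "coeff (mon k) (k + 3) = 0" "coeff (mon k) (k + 4) = 0"
      by (auto intro!: coeff_eq_0)
    then show ?thesis unfolding W_def dV_mult by (simp add: coeff_pderiv eval_nat_numeral)
  qed
  have "W - (mon (k + 3) + smult (real (Suc k) / c (Suc k)) (mon (Suc k))) = 0"
  proof (rule E_eq_0_imp_eq_0[where D = "k + 3"])
    show "degree (W - (mon (k + 3) + smult (real (Suc k) / c (Suc k)) (mon (Suc k)))) \<le> k + 3"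
      using dW by (intro degree_diff_le degree_add_le) (auto intro: order_trans[OF degree_smult_le])
  next
    fix j assume "j \<le> k + 3"
    have "E (W * mon j) = (if k + 3 = j then h j else 0) + real (Suc k) / c (Suc k) * (if Suc k = j then h j else 0)"
    proof -
      consider "j = k + 3" | "j = k + 2" | "j = Suc k" | "j \<le> k" using \<open>j \<le> k + 3\<close> by linarith
      then show ?thesis
      proof cases
        case 1
        then show ?thesis using E_mon_lead[OF dW] cW by (simp add: mult.commute)
      next
        case 2
        have "E (W * mon j) = E ((X * (X * (X * mon k)) - smult \<kappa> (X * mon k)) * mon j) - E (mon j * pderiv (mon k))"
          unfolding W_def dV_mult by (subst left_diff_distrib[of _ "pderiv (mon k)"]) (simp only: E_diff mult.commute[of "pderiv (mon k)"])
        also have "E (mon j * pderiv (mon k)) = 0"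
          using degree_pderiv_mon_le[of k] 2 by (intro E_mon_lower) simp
        also have "E ((X * (X * (X * mon k)) - smult \<kappa> (X * mon k)) * mon j) = 0"
          unfolding mon_rec ring_distribs mult_smult_right E_diff E_add E_smult mult_smult_left
          using 2 by (cases k) (auto simp: E_odd_zero E_mon_mon)
        finally show ?thesis using 2 by simp
      next
        case 3
        then show ?thesis using E_mon_pderiv_mon[of k] h_Suc[of k] c_pos[of "Suc k"] by (simp add: EW)
      next
        case 4
        have "E (mon k * pderiv (mon j)) = 0"
        proof (cases "j = 0")
          case False
          then show ?thesis using degree_pderiv_mon_le[of j] 4 by (intro E_mon_lower) simp
        qed (simp add: pderiv_1)
        then show ?thesis using 4 by (simp add: EW)
      qed
    qed
    then show "E ((W - (mon (k + 3) + smult (real (Suc k) / c (Suc k)) (mon (Suc k)))) * mon j) = 0"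
      by (simp add: left_diff_distrib ring_distribs E_diff E_add E_smult E_mon_mon)
  qed
  then show ?thesis by (simp add: W_def)
qed

text \<open>The pairing of \<open>dV * mon k - pderiv (mon k)\<close> with
  \<open>mon (Suc k)\<close> is computed twice: from \<open>adjoint_mon\<close>, and from the
  three-term recurrence after writing \<open>dV\<close> as \<open>X^3 - \<kappa> X\<close>. Dividing
  by \<open>h (Suc k)\<close> compares the two.\<close>

lemma string_equation: "c (Suc k) * (c (Suc (Suc k)) + c (Suc k) + c k - \<kappa>) = real (Suc k)"
proof -
  have "E ((dV \<kappa> * mon k - pderiv (mon k)) * mon (Suc k)) = real (Suc k) / c (Suc k) * h (Suc k)"
    unfolding adjoint_mon ring_distribs E_add mult_smult_left E_smult E_mon_mon by simp
  moreover have "E ((dV \<kappa> * mon k - pderiv (mon k)) * mon (Suc k)) =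
     E ((X * (X * mon k)) * (X * mon (Suc k))) - \<kappa> * E ((X * mon k) * mon (Suc k)) - E (mon (Suc k) * pderiv (mon k))"
    unfolding dV_mult by (simp add: E_diff E_smult left_diff_distrib right_diff_distrib mult_ac)
  moreover have "E (mon (Suc k) * pderiv (mon k)) = 0"
    using degree_pderiv_mon_le[of k] by (intro E_mon_lower) simp
  moreover have "E ((X * mon k) * mon (Suc k)) = h (Suc k)"
    unfolding mon_rec ring_distribs E_add mult_smult_left E_smult E_mon_mon by simp
  moreover have "E ((X * (X * mon k)) * (X * mon (Suc k))) = h (Suc (Suc k)) + c (Suc k) * (c (Suc k) + c k) * h k"
  proof (cases k)
    case 0
    show ?thesis unfolding mon_rec ring_distribs mult_smult_right mult_smult_left E_add E_smult E_mon_mon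
      using 0 by (simp add: algebra_simps)
  next
    case (Suc n)
    show ?thesis unfolding mon_rec ring_distribs mult_smult_right mult_smult_left E_add E_smult E_mon_mon
      using Suc by (auto simp: algebra_simps)
  qed
  ultimately have "real (Suc k) / c (Suc k) * h (Suc k) = h (Suc (Suc k)) + c (Suc k) * (c (Suc k) + c k) * h k - \<kappa> * h (Suc k)"
    by simp
  then have "real (Suc k) / c (Suc k) * h (Suc k) = (c (Suc (Suc k)) + c (Suc k) + c k - \<kappa>) * h (Suc k)"
    by (simp only: h_Suc) (simp add: algebra_simps)
  then have "real (Suc k) / c (Suc k) = c (Suc (Suc k)) + c (Suc k) + c k - \<kappa>"
    using h_pos[of "Suc k"] by (metis mult_right_cancel less_irrefl)
  then show ?thesis using c_pos[of "Suc k"] by (simp add: field_simps)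
qed

definition e_coef :: "real poly \<Rightarrow> nat \<Rightarrow> real" where
  "e_coef v n = E (v * mon n) / sqrt (h n)"

lemma parseval_e: "degree P \<le> D \<Longrightarrow> E (P * P) = (\<Sum>n\<le>D. (e_coef P n)\<^sup>2)"
  using h_pos by (simp add: parseval e_coef_def power_divide less_imp_le)

text \<open>\<open>adjoint_mon\<close> has only the two components \<open>mon (k + 1)\<close> and
  \<open>mon (k + 3)\<close>; the square roots arise from normalising by \<open>h\<close>. Here k is
  the degree of the mode of v', so this is \<open>d\<close> at index \<open>Suc k\<close>.\<close>

lemma e_coef_pderiv:
  "e_coef (pderiv v) k = real (Suc k) / sqrt (c (Suc k)) * e_coef v (Suc k)
     + sqrt (c (Suc k) * c (k + 2) * c (k + 3)) * e_coef v (k + 3)"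
proof -
  have "E (pderiv v * mon k) = E (v * mon (k + 3)) + real (Suc k) / c (Suc k) * E (v * mon (Suc k))"
    unfolding adjoint_pderiv adjoint_mon by (simp add: distrib_left E_add E_smult)
  moreover have "sqrt (h (Suc k)) = sqrt (c (Suc k)) * sqrt (h k)" by (simp add: h_Suc real_sqrt_mult)
  moreover have "sqrt (h (k + 3)) = sqrt (c (Suc k) * c (k + 2) * c (k + 3)) * sqrt (h k)"
    by (simp add: h_Suc real_sqrt_mult eval_nat_numeral)
  moreover have "E (v * mon (Suc k)) = e_coef v (Suc k) * sqrt (h (Suc k))"
    "E (v * mon (k + 3)) = e_coef v (k + 3) * sqrt (h (k + 3))"
    "E (pderiv v * mon k) = e_coef (pderiv v) k * sqrt (h k)"
    unfolding e_coef_def using h_pos[of "Suc k"] h_pos[of "k + 3"] h_pos[of k] by auto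
  ultimately have "e_coef (pderiv v) k * sqrt (h k) = (real (Suc k) * (sqrt (c (Suc k)) / c (Suc k)) * e_coef v (Suc k)
     + sqrt (c (Suc k) * c (k + 2) * c (k + 3)) * e_coef v (k + 3)) * sqrt (h k)"
    by (simp add: algebra_simps del: of_nat_Suc)
  moreover have "sqrt (c (Suc k)) / c (Suc k) = 1 / sqrt (c (Suc k))"
    using c_pos[of "Suc k"] by (metis real_div_sqrt divide_divide_eq_right mult_1 less_imp_le zero_less_Suc
        divide_self_if inverse_eq_divide order_less_irrefl real_sqrt_eq_zero_cancel_iff times_divide_eq_left)
  ultimately show ?thesis using h_pos[of k] by simp
qed

lemma e_coef_0: "E v = 0 \<Longrightarrow> e_coef v 0 = 0"
  by (simp add: e_coef_def)

section \<open>Uniqueness behind the descriptions of \<open>p\<close> and \<open>q\<close>\<close>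

definition orthonormal :: "(nat \<Rightarrow> real poly) \<Rightarrow> bool" where
  "orthonormal P \<longleftrightarrow> (\<forall>n. degree (P n) = n \<and> lead_coeff (P n) > 0 \<and>
     (\<forall>k. E (P n * P k) = (if n = k then 1 else 0)))"

definition onp :: "nat \<Rightarrow> real poly" where "onp n = smult (1 / sqrt (h n)) (mon n)"

lemma orthonormal_onp: "orthonormal onp"
  unfolding orthonormal_def onp_def
  using h_pos by (auto simp: E_smult E_mon_mon less_imp_le less_imp_neq[symmetric])

text \<open>Cancelling leading terms with \<open>P d\<close> shows that \<open>P n\<close> is
  orthogonal to every lower degree, hence a multiple of \<open>mon n\<close>. Unit norm fixes the
  factor up to sign, and the positive leading coefficient fixes the sign.\<close>

lemma orthonormal_unique:
  assumes "orthonormal P" shows "P = onp"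
proof
  fix n
  have deg: "degree (P k) = k" and lc: "coeff (P k) k > 0"
    and orth: "E (P k * P j) = (if k = j then 1 else 0)" for k j
    using assms by (metis orthonormal_def)+
  have span: "E (P n * Q) = 0" if "degree Q < n" for Q
    using that
  proof (induction "degree Q" arbitrary: Q rule: less_induct)
    case less
    define d where "d = degree Q"
    define R where "R = Q - smult (coeff Q d / coeff (P d) d) (P d)"
    have Rle: "degree R \<le> d"
      unfolding R_def using deg[of d] by (intro degree_diff_le) (auto simp: d_def intro: order_trans[OF degree_smult_le])
    have R0: "coeff R d = 0" using lc[of d] by (simp add: R_def)
    have ER: "E (P n * R) = 0"
    proof (cases "R = 0")
      case False
      then have "degree R \<noteq> d" using R0 by (metis leading_coeff_0_iff)
      then show ?thesis using less Rle by (auto simp: d_def)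
    qed simp
    have "Q = R + smult (coeff Q d / coeff (P d) d) (P d)" by (simp add: R_def)
    then have "E (P n * Q) = E (P n * R) + coeff Q d / coeff (P d) d * E (P n * P d)"
      by (metis E_add E_smult distrib_left mult_smult_right)
    then show ?case using ER orth[of n d] less.prems by (simp add: d_def)
  qed
  have "P n = smult (coeff (P n) n) (mon n)"
  proof -
    have "E (P n * mon k) / h k = (if k = n then coeff (P n) n else 0)" if "k \<le> n" for k
      using that E_mon_lead[of "P n" n] span[of "mon k"] deg[of n] h_pos[of n] by (auto simp: mult.commute)
    then have "(\<Sum>k\<le>n. smult (E (P n * mon k) / h k) (mon k)) = (\<Sum>k\<le>n. if k = n then smult (coeff (P n) n) (mon k) else 0)"
      by (intro sum.cong refl) auto
    then show ?thesis using mon_expansion[of "P n" n] deg[of n] by simp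
  qed
  then have "E (P n * P n) = (coeff (P n) n)\<^sup>2 * h n"
    by (metis E_smult h_def mult.assoc mult_smult_left mult_smult_right power2_eq_square)
  then have "(coeff (P n) n)\<^sup>2 * h n = 1" using orth[of n n] by simp
  then have "(coeff (P n) n)\<^sup>2 = 1 / h n" using h_pos[of n] by (simp add: field_simps)
  then have "coeff (P n) n = 1 / sqrt (h n)"
    using lc[of n] by (metis abs_of_pos real_sqrt_abs real_sqrt_divide real_sqrt_one)
  with \<open>P n = smult (coeff (P n) n) (mon n)\<close> show "P n = onp n" by (simp add: onp_def)
qed

lemma antiderivative_unique: "\<exists>!Q. pderiv Q = P \<and> E Q = 0"
proof -
  obtain Q where Q: "pderiv Q = P" using exists_antiderivative_poly by blast
  have E_const: "E [:a:] = a" for a using E_smult[of a 1] by (simp add: E_one)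
  show ?thesis
  proof (rule ex1I[of _ "Q - [:E Q:]"])
    show "pderiv (Q - [:E Q:]) = P \<and> E (Q - [:E Q:]) = 0"
      by (simp add: pderiv_diff Q pderiv_pCons E_diff E_const)
  next
    fix R assume R: "pderiv R = P \<and> E R = 0"
    then have "pderiv (Q - R) = 0" by (simp add: pderiv_diff Q)
    then obtain a where "Q - R = [:a:]" by (auto simp: pderiv_eq_0_iff elim: degree_eq_zeroE)
    moreover from this have "E Q - E R = a" by (metis E_const E_diff)
    ultimately show "R = Q - [:E Q:]" using R by (simp add: algebra_simps)
  qed
qed

end

section \<open>The measure\<close>

definition wt :: "real \<Rightarrow> real \<Rightarrow> real" where "wt \<kappa> x = exp (- V \<kappa> x)"

lemma wt_pos: "wt \<kappa> x > 0"
  by (simp add: wt_def)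

lemma wt_neq_0 [simp]: "wt \<kappa> x \<noteq> 0" and wt_nonneg [simp]: "wt \<kappa> x \<ge> 0"
  using wt_pos[of \<kappa> x] by auto

lemma continuous_on_wt [continuous_intros]: "continuous_on A (wt \<kappa>)"
  unfolding wt_def V_def by (intro continuous_intros) auto

lemma measurable_wt [measurable]: "wt \<kappa> \<in> borel_measurable borel"
  by (intro borel_measurable_continuous_onI continuous_on_wt)

text \<open>Completing the square in \<open>x^2 / 2\<close>. The resulting Gaussian domination of
  the weight reduces integrability of all polynomials to Gaussian moments.\<close>

lemma V_lower: "V \<kappa> x \<ge> x\<^sup>2 / 2 - (\<kappa> + 1)\<^sup>2 / 4"
proof -
  have "V \<kappa> x = x\<^sup>2 / 2 - (\<kappa> + 1)\<^sup>2 / 4 + (x\<^sup>2 / 2 - (\<kappa> + 1) / 2)\<^sup>2"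
    by (simp add: V_def power2_eq_square power4_eq_xxxx field_simps)
  then show ?thesis by simp
qed

lemma wt_le_gauss: "wt \<kappa> x \<le> exp ((\<kappa> + 1)\<^sup>2 / 4) * exp (- x\<^sup>2 / 2)"
  unfolding wt_def exp_add[symmetric] using V_lower[of x \<kappa>] by simp

lemma wt_le_exp_abs: "wt \<kappa> x \<le> exp ((\<kappa> + 1)\<^sup>2 / 4 + 1) * exp (- \<bar>x\<bar>)"
proof -
  have "0 \<le> (\<bar>x\<bar> - 1)\<^sup>2" by simp
  then have "x\<^sup>2 / 2 \<ge> \<bar>x\<bar> - 1/2" by (simp add: power2_diff)
  then show ?thesis unfolding wt_def exp_add[symmetric] using V_lower[of x \<kappa>] by simp
qed

lemma integrable_pow_wt: "integrable lborel (\<lambda>x. x ^ k * wt \<kappa> x)"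
proof (rule Bochner_Integration.integrable_bound)
  show "integrable lborel (\<lambda>x. (sqrt (2 * pi) * exp ((\<kappa> + 1)\<^sup>2 / 4)) * (std_normal_density x * \<bar>x\<bar> ^ k))"
    by (intro integrable_mult_right integrable_std_normal_moment_abs)
  have "\<bar>x\<bar> ^ k * wt \<kappa> x \<le> \<bar>x\<bar> ^ k * (exp ((\<kappa> + 1)\<^sup>2 / 4) * exp (- x\<^sup>2 / 2))" for x
    by (intro mult_left_mono wt_le_gauss) auto
  then show "AE x in lborel. norm (x ^ k * wt \<kappa> x)
      \<le> norm ((sqrt (2 * pi) * exp ((\<kappa> + 1)\<^sup>2 / 4)) * (std_normal_density x * \<bar>x\<bar> ^ k))"
    by (auto simp: std_normal_density_def abs_mult power_abs mult_ac)
qed measurable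

lemma integrable_poly_wt: "integrable lborel (\<lambda>x. poly P x * wt \<kappa> x)"
proof -
  have "integrable lborel (\<lambda>x. \<Sum>i\<le>degree P. coeff P i * (x ^ i * wt \<kappa> x))"
    by (intro Bochner_Integration.integrable_sum integrable_mult_right integrable_pow_wt)
  then show ?thesis by (simp add: poly_altdef sum_distrib_right mult.assoc)
qed

lemma integrable_wt: "integrable lborel (wt \<kappa>)"
  using integrable_pow_wt[of 0] by simp

lemma Z_eq: "Z \<kappa> = (LINT x|lborel. wt \<kappa> x)"
  by (simp add: Z_def wt_def)

lemma lborel_not_AE_False: "\<not> (AE x::real in lborel. False)"
proof
  assume "AE x::real in lborel. False"
  then have "emeasure lborel (UNIV :: real set) = 0"
    by (simp add: eventually_False ae_filter_eq_bot_iff)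
  then show False by simp
qed

lemma Z_pos: "Z \<kappa> > 0"
proof -
  have "Z \<kappa> \<ge> 0" unfolding Z_eq by (intro integral_nonneg_AE) (simp add: wt_pos less_imp_le)
  moreover have "Z \<kappa> \<noteq> 0"
  proof
    assume "Z \<kappa> = 0"
    then have "AE x in lborel. wt \<kappa> x = 0"
      unfolding Z_eq using integrable_wt
      by (subst (asm) integral_nonneg_eq_0_iff_AE) auto
    then show False using lborel_not_AE_False by simp
  qed
  ultimately show ?thesis by simp
qed

lemma nu_eq: "nu \<kappa> = density lborel (\<lambda>x. ennreal (wt \<kappa> x / Z \<kappa>))"
  by (simp add: nu_def wt_def)

lemma sets_nu [simp, measurable_cong]: "sets (nu \<kappa>) = sets borel"
  by (simp add: nu_eq)

lemma space_nu [simp]: "space (nu \<kappa>) = UNIV"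
  by (simp add: nu_eq)

lemma integral_nu:
  fixes f :: "real \<Rightarrow> real"
  assumes "f \<in> borel_measurable borel"
  shows "(LINT x|nu \<kappa>. f x) = (LINT x|lborel. f x * wt \<kappa> x) / Z \<kappa>"
  unfolding nu_eq using assms Z_pos[of \<kappa>]
  by (subst integral_density) (auto simp: mult.commute)

lemma integrable_nu_iff:
  fixes f :: "real \<Rightarrow> real"
  assumes "f \<in> borel_measurable borel"
  shows "integrable (nu \<kappa>) f \<longleftrightarrow> integrable lborel (\<lambda>x. f x * wt \<kappa> x)"
proof -
  have "integrable (nu \<kappa>) f \<longleftrightarrow> integrable lborel (\<lambda>x. f x * wt \<kappa> x / Z \<kappa>)"
    unfolding nu_eq using assms Z_pos[of \<kappa>]
    by (subst integrable_density) (auto simp: mult.commute)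
  also have "\<dots> \<longleftrightarrow> integrable lborel (\<lambda>x. f x * wt \<kappa> x)"
  proof
    assume "integrable lborel (\<lambda>x. f x * wt \<kappa> x / Z \<kappa>)"
    from integrable_mult_right[OF this, of "Z \<kappa>"] show "integrable lborel (\<lambda>x. f x * wt \<kappa> x)"
      using Z_pos[of \<kappa>] by simp
  qed (rule integrable_divide)
  finally show ?thesis .
qed

lemma measurable_poly [measurable]: "poly P \<in> borel_measurable borel" for P :: "real poly"
  by (intro borel_measurable_continuous_onI continuous_intros)

lemma integrable_poly_nu: "integrable (nu \<kappa>) (poly P)"
  using integrable_nu_iff[of "poly P"] integrable_poly_wt by simp

lemma prob_space_nu: "prob_space (nu \<kappa>)"
proof
  have "emeasure (nu \<kappa>) (space (nu \<kappa>)) = (\<integral>\<^sup>+x. ennreal (wt \<kappa> x / Z \<kappa>) \<partial>lborel)"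
    by (simp add: nu_eq emeasure_density)
  also have "\<dots> = ennreal (LINT x|lborel. wt \<kappa> x / Z \<kappa>)"
    using integrable_wt Z_pos[of \<kappa>] by (intro nn_integral_eq_integral) auto
  also have "(LINT x|lborel. wt \<kappa> x / Z \<kappa>) = 1" using Z_pos[of \<kappa>] by (simp add: Z_eq)
  finally show "emeasure (nu \<kappa>) (space (nu \<kappa>)) = 1" by simp
qed

lemma poly_wt_tendsto_top: "((\<lambda>x. poly P x * wt \<kappa> x) \<longlongrightarrow> 0) at_top"
proof (rule Lim_null_comparison)
  let ?C = "exp ((\<kappa> + 1)\<^sup>2 / 4 + 1)"
  let ?g = "\<lambda>x. ?C * (\<Sum>i\<le>degree P. \<bar>coeff P i\<bar> * (x ^ i / exp x))"
  show "(?g \<longlongrightarrow> 0) at_top"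
    by (intro tendsto_mult_right_zero tendsto_null_sum tendsto_power_div_exp_0)
  have "norm (poly P x * wt \<kappa> x) \<le> ?g x" if x: "x \<ge> 0" for x
  proof -
    have "\<bar>poly P x\<bar> \<le> (\<Sum>i\<le>degree P. \<bar>coeff P i\<bar> * x ^ i)"
      unfolding poly_altdef by (rule order_trans[OF sum_abs]) (simp add: abs_mult x)
    moreover have "wt \<kappa> x \<le> ?C / exp x"
    proof -
      have "exp (- \<bar>x\<bar>) = inverse (exp x)" using x by (simp add: exp_minus)
      then show ?thesis using wt_le_exp_abs[of \<kappa> x] by (metis divide_inverse)
    qed
    ultimately have "\<bar>poly P x\<bar> * wt \<kappa> x \<le> (\<Sum>i\<le>degree P. \<bar>coeff P i\<bar> * x ^ i) * (?C / exp x)"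
      using x by (intro mult_mono sum_nonneg) auto
    also have "\<dots> = (\<Sum>i\<le>degree P. ?C * (\<bar>coeff P i\<bar> * (x ^ i / exp x)))"
      unfolding sum_distrib_right by (intro sum.cong refl) simp
    also have "\<dots> = ?g x" by (rule sum_distrib_left[symmetric])
    finally show ?thesis by (simp add: abs_mult)
  qed
  then show "\<forall>\<^sub>F x in at_top. norm (poly P x * wt \<kappa> x) \<le> ?g x"
    by (rule eventually_mono[OF eventually_ge_at_top[of 0]])
qed

lemma wt_even: "wt \<kappa> (- x) = wt \<kappa> x"
  by (simp add: wt_def V_def)

lemma poly_wt_tendsto_bot: "((\<lambda>x. poly P x * wt \<kappa> x) \<longlongrightarrow> 0) at_bot"
  unfolding filterlim_at_bot_mirror
  using poly_wt_tendsto_top[of "pcompose P [:0, -1:]" \<kappa>] by (simp add: poly_pcompose wt_even)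

lemma has_derivative_wt: "(wt \<kappa> has_real_derivative - (poly (dV \<kappa>) x) * wt \<kappa> x) (at x)"
proof -
  have "((\<lambda>x. x ^ 4 / 4 - \<kappa> * x\<^sup>2 / 2) has_real_derivative (4 * x ^ 3 / 4 - \<kappa> * (2 * x) / 2)) (at x)"
    by (intro DERIV_diff DERIV_cdivide DERIV_cmult) (auto intro!: derivative_eq_intros)
  then have *: "(V \<kappa> has_real_derivative x ^ 3 - \<kappa> * x) (at x)" unfolding V_def[abs_def] by simp
  have "((\<lambda>x. exp (- V \<kappa> x)) has_real_derivative exp (- V \<kappa> x) * - (x ^ 3 - \<kappa> * x)) (at x)"
    by (rule DERIV_chain2[OF DERIV_exp DERIV_minus[OF *]])
  moreover have "poly (dV \<kappa>) x = x ^ 3 - \<kappa> * x" by (simp add: dV_def algebra_simps power3_eq_cube)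
  ultimately show ?thesis unfolding wt_def[abs_def] by (simp add: mult.commute)
qed

lemma has_derivative_poly_wt:
  "((\<lambda>x. poly P x * wt \<kappa> x) has_real_derivative poly (pderiv P - dV \<kappa> * P) x * wt \<kappa> x) (at x)"
  using DERIV_mult[OF poly_DERIV[of P x] has_derivative_wt[of \<kappa> x]] by (simp add: algebra_simps)

text \<open>The integrand is the derivative of \<open>P * wt\<close>, which vanishes at both ends of
  the line. This is the source of \<open>E_pderiv\<close>.\<close>

lemma integral_deriv_poly_wt: "(LINT x|lborel. poly (pderiv P - dV \<kappa> * P) x * wt \<kappa> x) = 0"
proof -
  let ?f = "\<lambda>x. poly (pderiv P - dV \<kappa> * P) x * wt \<kappa> x"
  have "(LBINT x=-\<infinity>..\<infinity>. ?f x) = 0 - (0 :: real)"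
  proof (rule interval_integral_FTC_integrable)
    show "((\<lambda>x. poly P x * wt \<kappa> x) has_vector_derivative ?f x) (at x)" for x
      using has_derivative_poly_wt by (simp add: has_real_derivative_iff_has_vector_derivative)
    have "continuous_on UNIV ?f" by (intro continuous_intros)
    then show "isCont ?f x" for x by (simp add: continuous_on_eq_continuous_at)
    show "set_integrable lborel (einterval (- \<infinity>) \<infinity>) ?f"
      using integrable_poly_wt[of "pderiv P - dV \<kappa> * P" \<kappa>] by (simp add: set_integrable_def)
    show "(((\<lambda>x. poly P x * wt \<kappa> x) \<circ> real_of_ereal) \<longlongrightarrow> 0) (at_right (- \<infinity>))"
      using poly_wt_tendsto_bot unfolding ereal_tendsto_simps .
    show "(((\<lambda>x. poly P x * wt \<kappa> x) \<circ> real_of_ereal) \<longlongrightarrow> 0) (at_left \<infinity>)"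
      using poly_wt_tendsto_top unfolding ereal_tendsto_simps .
  qed simp
  moreover have "(LBINT x=-\<infinity>..\<infinity>. g x) = (LINT x|lborel. g x)" for g :: "real \<Rightarrow> real"
    unfolding interval_lebesgue_integral_def set_lebesgue_integral_def by simp
  ultimately show ?thesis by (simp del: poly_diff poly_mult)
qed

section \<open>Integration against \<open>nu\<close> as a functional on polynomials\<close>

definition Enu :: "real \<Rightarrow> real poly \<Rightarrow> real" where
  "Enu \<kappa> P = (LINT x|nu \<kappa>. poly P x)"

lemma Enu_eq: "Enu \<kappa> P = (LINT x|lborel. poly P x * wt \<kappa> x) / Z \<kappa>"
  unfolding Enu_def by (rule integral_nu) simp

lemma AE_poly_eq_0: assumes "AE x in lborel. poly P x = (0::real)" shows "P = 0"
proof (rule ccontr)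
  assume "P \<noteq> 0"
  then have "finite {x. poly P x = 0}" by (rule poly_roots_finite)
  then have "{x. poly P x = 0} \<in> null_sets lborel" by (rule finite_imp_null_set_lborel)
  then have "AE x in lborel. poly P x \<noteq> 0" by (drule_tac AE_not_in) simp
  with assms have "AE x::real in lborel. False" by eventually_elim auto
  then show False using lborel_not_AE_False by simp
qed

interpretation freud: freud_functional "Enu \<kappa>" \<kappa> for \<kappa>
proof
  fix P Q :: "real poly" and a :: real
  show "Enu \<kappa> (P + Q) = Enu \<kappa> P + Enu \<kappa> Q"
    unfolding Enu_def poly_add by (intro Bochner_Integration.integral_add integrable_poly_nu)
  show "Enu \<kappa> (smult a P) = a * Enu \<kappa> P"
    unfolding Enu_def poly_smult by (rule integral_mult_right_zero)
  show "Enu \<kappa> 1 = 1"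
    unfolding Enu_eq using Z_pos[of \<kappa>] by (simp add: Z_eq[symmetric])
  show "Enu \<kappa> (pcompose P [:0, -1:]) = Enu \<kappa> P"
    using lborel_integral_real_affine[of "-1" "\<lambda>x. poly P x * wt \<kappa> x" 0]
    by (simp add: Enu_eq poly_pcompose wt_even)
  have "(LINT x|lborel. poly (pderiv P) x * wt \<kappa> x) - (LINT x|lborel. poly (dV \<kappa> * P) x * wt \<kappa> x) = 0"
    using integral_deriv_poly_wt[of P \<kappa>]
    by (subst Bochner_Integration.integral_diff[symmetric]) (auto intro: integrable_poly_wt simp: left_diff_distrib simp del: poly_mult)
  then show "Enu \<kappa> (pderiv P) = Enu \<kappa> (dV \<kappa> * P)" by (simp add: Enu_eq)
  show "Enu \<kappa> (P * P) > 0" if "P \<noteq> 0"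
  proof -
    have nn: "AE x in lborel. 0 \<le> poly (P * P) x * wt \<kappa> x" by simp
    have "(LINT x|lborel. poly (P * P) x * wt \<kappa> x) \<noteq> 0"
    proof
      assume "(LINT x|lborel. poly (P * P) x * wt \<kappa> x) = 0"
      then have "AE x in lborel. poly (P * P) x * wt \<kappa> x = 0"
        using integral_nonneg_eq_0_iff_AE[OF integrable_poly_wt nn] by simp
      then have "AE x in lborel. poly P x = 0" by simp
      then show False using AE_poly_eq_0 that by blast
    qed
    then show ?thesis unfolding Enu_eq using Z_pos[of \<kappa>] integral_nonneg_AE[OF nn]
      by (intro divide_pos_pos) linarith+
  qed
qed

lemma p_eq: "p \<kappa> = freud.onp \<kappa>"
proof -
  have *: "(\<forall>n. degree (P n) = n \<and> lead_coeff (P n) > 0 \<and>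
      (\<forall>k. (LINT x|nu \<kappa>. poly (P n) x * poly (P k) x) = (if n = k then 1 else 0))) \<longleftrightarrow> freud.orthonormal \<kappa> P" for P
    by (simp add: freud.orthonormal_def Enu_def)
  show ?thesis unfolding p_def *
    using freud.orthonormal_onp freud.orthonormal_unique by (intro the_equality) auto
qed

lemma pderiv_q_Suc: "pderiv (q \<kappa> (Suc n)) = p \<kappa> n" and Enu_q_Suc: "Enu \<kappa> (q \<kappa> (Suc n)) = 0"
proof -
  have "\<exists>!Q. pderiv Q = p \<kappa> n \<and> (LINT x|nu \<kappa>. poly Q x) = 0"
    using freud.antiderivative_unique[of "p \<kappa> n" \<kappa>] by (simp add: Enu_def)
  from theI'[OF this] show "pderiv (q \<kappa> (Suc n)) = p \<kappa> n" "Enu \<kappa> (q \<kappa> (Suc n)) = 0"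
    by (auto simp: Enu_def)
qed

section \<open>The string equation and the spectral gap\<close>

text \<open>The bounds on c and the inequality between the coefficients e and d rest on positivity
  and this recurrence alone, so they are developed for a bare sequence.\<close>

locale string_equation =
  fixes c :: "nat \<Rightarrow> real" and \<kappa> :: real
  assumes c_positive: "n > 0 \<Longrightarrow> c n > 0"
    and c_nonneg: "c n \<ge> 0"
    and string_eq: "c (Suc k) * (c (Suc (Suc k)) + c (Suc k) + c k - \<kappa>) = real (Suc k)"
begin

text \<open>The shift by \<open>\<kappa> / 6\<close> makes the \<open>\<kappa>\<close>-dependence of \<open>y n / sqrt n\<close> of second order.\<close>
definition y :: "nat \<Rightarrow> real" where "y n = c n - \<kappa> / 6"

lemma string_eq_y:
  assumes "n > 0"
  shows "(y n + \<kappa> / 6) * (y n + (y (n + 1) + y (n - 1)) - \<kappa> / 2) = real n"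
proof -
  obtain k where "n = Suc k" using assms by (cases n) auto
  then show ?thesis using string_eq[of k] by (simp add: y_def algebra_simps)
qed

lemma y_pos: "n > 0 \<Longrightarrow> y n + \<kappa> / 6 > 0"
  using c_positive by (simp add: y_def)

lemma y_factor_pos: "n > 0 \<Longrightarrow> y n + (y (n + 1) + y (n - 1)) - \<kappa> / 2 > 0"
  using string_eq_y[of n] y_pos[of n] by (metis of_nat_0_less_iff zero_less_mult_pos)

section \<open>Trapping the recurrence coefficients between multiples of
  \<open>sqrt n\<close>\<close>

lemma sqrt_sum_upper: "n > 0 \<Longrightarrow> sqrt (real (n + 1)) + sqrt (real (n - 1)) \<le> 2 * sqrt (real n)"
proof -
  assume "n > 0"
  have "(sqrt (real (n + 1)) + sqrt (real (n - 1)))\<^sup>2 \<le> 2 * ((sqrt (real (n + 1)))\<^sup>2 + (sqrt (real (n - 1)))\<^sup>2)"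
    using sum_squares_bound[of "sqrt (real (n + 1))" "sqrt (real (n - 1))"] by (simp add: power2_sum)
  also have "\<dots> = (2 * sqrt (real n))\<^sup>2" using \<open>n > 0\<close> by (simp add: of_nat_diff power_mult_distrib)
  finally show ?thesis by (rule power2_le_imp_le) simp
qed

lemma sqrt_sum_lower: "n > 0 \<Longrightarrow> sqrt (real (n + 1)) + sqrt (real (n - 1)) \<ge> 2 * sqrt (real n) - 1 / sqrt (real n)"
proof -
  assume n: "n > 0"
  have "sqrt (real n) - 1 / sqrt (real n) \<le> sqrt (real (n - 1))"
  proof (rule real_le_rsqrt)
    have "(sqrt (real n) - 1 / sqrt (real n))\<^sup>2 = real n - 2 + 1 / real n"
      using n by (simp add: power2_diff power_divide)
    also have "\<dots> \<le> real (n - 1)" using n by (simp add: of_nat_diff)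
    finally show "(sqrt (real n) - 1 / sqrt (real n))\<^sup>2 \<le> real (n - 1)" .
  qed
  moreover have "sqrt (real n) \<le> sqrt (real (n + 1))" by simp
  ultimately show ?thesis by linarith
qed

text \<open>The factor 0.23 is the size of \<kappa> relative to \<open>sqrt n\<close> that the
  iteration tolerates. In the next two lemmas it yields 0.23 / 3 < 0.077 and
  \<open>0.23^2 / 12 < 0.0045\<close>, the constants of all later error terms.\<close>

lemma kappa_sqrt_mono: "\<bar>\<kappa>\<bar> \<le> 23 / 100 * sqrt (real n0) \<Longrightarrow> n0 \<le> n \<Longrightarrow> \<bar>\<kappa>\<bar> \<le> 23 / 100 * sqrt (real n)"
  by (rule order_trans[of _ "23 / 100 * sqrt (real n0)"]) auto

lemma kappa_prod_le: fixes w a :: real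
  assumes "\<bar>\<kappa>\<bar> \<le> 23 / 100 * w" "a \<ge> 0" "w \<ge> 0"
  shows "\<bar>\<kappa> * w * a / 3\<bar> \<le> 77 / 1000 * a * w\<^sup>2"
proof -
  have "\<bar>\<kappa> * w * a / 3\<bar> = \<bar>\<kappa>\<bar> * (w * a / 3)" using assms by (simp add: abs_mult)
  also have "\<dots> \<le> 23 / 100 * w * (w * a / 3)" using assms by (intro mult_right_mono) auto
  also have "\<dots> \<le> 77 / 1000 * a * w\<^sup>2" using assms mult_nonneg_nonneg[of a "w\<^sup>2"] by (simp add: power2_eq_square)
  finally show ?thesis .
qed

lemma kappa_square_le: fixes w :: real
  assumes "\<bar>\<kappa>\<bar> \<le> 23 / 100 * w" shows "\<kappa>\<^sup>2 / 12 \<le> 45 / 10000 * w\<^sup>2"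
proof -
  have "\<kappa>\<^sup>2 \<le> (23 / 100 * w)\<^sup>2" using assms by (metis abs_ge_zero power2_abs power_mono)
  moreover have "(23 / 100 * w)\<^sup>2 = 529 / 10000 * w\<^sup>2" by (simp add: power_mult_distrib power2_eq_square)
  ultimately show ?thesis using zero_le_power2[of w] by linarith
qed

text \<open>The neighbours enter only through \<open>c \<ge> 0\<close>. If
  \<open>y n > 1.1 w\<close> with \<open>w = sqrt n\<close>, the product in the string equation is
  at least \<open>1.21 w^2\<close> minus \<kappa>-terms below \<open>0.18 w^2\<close>, which exceeds
  n.\<close>

lemma crude_bound:
  assumes "\<bar>\<kappa>\<bar> \<le> 23 / 100 * sqrt (real n0)" "n0 > 0" "n \<ge> n0"
  shows "y n \<le> 11 / 10 * sqrt (real n)"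
proof (rule ccontr)
  assume neg: "\<not> ?thesis"
  define w where "w = sqrt (real n)"
  have n: "n > 0" and w: "w > 0" "w\<^sup>2 = real n" using assms by (auto simp: w_def)
  have k: "\<bar>\<kappa>\<bar> \<le> 23 / 100 * w" using kappa_sqrt_mono assms by (simp add: w_def)
  have yn: "y n > 11 / 10 * w" using neg by (simp add: w_def)
  have "y (n + 1) + y (n - 1) \<ge> - \<kappa> / 3" using c_nonneg[of "n + 1"] c_nonneg[of "n - 1"] by (simp add: y_def)
  then have "y n + (y (n + 1) + y (n - 1)) - \<kappa> / 2 \<ge> 11 / 10 * w - 5 * \<kappa> / 6" using yn by linarith
  then have "(11 / 10 * w + \<kappa> / 6) * (11 / 10 * w - 5 * \<kappa> / 6) \<le> (y n + \<kappa> / 6) * (y n + (y (n + 1) + y (n - 1)) - \<kappa> / 2)"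
    using yn k w(1) y_pos[OF n] by (intro mult_mono) auto
  also have "\<dots> = w\<^sup>2" using string_eq_y[OF n] w by simp
  finally have "121 / 100 * w\<^sup>2 - \<kappa> * w * (22 / 10) / 3 - 5 / 3 * (\<kappa>\<^sup>2 / 12) \<le> w\<^sup>2"
    by (simp add: algebra_simps power2_eq_square)
  then show False using kappa_prod_le[OF k, of "22 / 10"] kappa_square_le[OF k] w zero_less_power[OF w(1), of 2]
    by linarith
qed

text \<open>Upper bounds on the two neighbours cap the second factor of the string equation; a value
  below \<open>B * sqrt n\<close> would then make the product smaller than n. The neighbour
  \<open>n - 1\<close> must satisfy the upper bound too, which costs one index.\<close>

lemma lower_step:
  assumes k0: "\<bar>\<kappa>\<bar> \<le> 23 / 100 * sqrt (real n0)" "n0 > 0"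
    and up: "\<And>n. n \<ge> n0 \<Longrightarrow> y n \<le> A * sqrt (real n)"
    and AB: "B \<le> A" "B \<ge> 4 / 100" "B\<^sup>2 + 2 * A * B + 77 / 1000 * (A - B) \<le> 1"
    and n: "n \<ge> n0 + 1"
  shows "y n \<ge> B * sqrt (real n)"
proof (rule ccontr)
  assume neg: "\<not> ?thesis"
  define w where "w = sqrt (real n)"
  have n': "n > 0" and w: "w > 0" "w\<^sup>2 = real n" using assms by (auto simp: w_def)
  have k: "\<bar>\<kappa>\<bar> \<le> 23 / 100 * w" using kappa_sqrt_mono assms by (simp add: w_def)
  have yn: "y n < B * w" using neg by (simp add: w_def)
  have "y (n + 1) + y (n - 1) \<le> A * (sqrt (real (n + 1)) + sqrt (real (n - 1)))"
    unfolding distrib_left using n by (intro add_mono up) auto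
  also have "\<dots> \<le> A * (2 * w)" unfolding w_def using sqrt_sum_upper[OF n'] AB by (intro mult_left_mono) auto
  finally have s: "y (n + 1) + y (n - 1) \<le> A * (2 * w)" .
  have "w\<^sup>2 = (y n + \<kappa> / 6) * (y n + (y (n + 1) + y (n - 1)) - \<kappa> / 2)" using string_eq_y[OF n'] w by simp
  also have "\<dots> < (B * w + \<kappa> / 6) * (y n + (y (n + 1) + y (n - 1)) - \<kappa> / 2)"
    using y_factor_pos[OF n'] yn by (intro mult_strict_right_mono) auto
  also have "\<dots> \<le> (B * w + \<kappa> / 6) * (B * w + A * (2 * w) - \<kappa> / 2)"
    using y_pos[OF n'] yn s by (intro mult_left_mono) auto
  \<comment> \<open>The term linear in \<kappa> has coefficient \<open>(A - B) / 3\<close>: by the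
    shift in \<open>y\<close> it fades as the two bounds approach each other. The square term has a
    favourable sign here.\<close>
  also have "\<dots> = (B\<^sup>2 + 2 * A * B) * w\<^sup>2 + \<kappa> * w * (A - B) / 3 - \<kappa>\<^sup>2 / 12"
    by (simp add: field_simps power2_eq_square)
  also have "\<dots> \<le> (B\<^sup>2 + 2 * A * B) * w\<^sup>2 + 77 / 1000 * (A - B) * w\<^sup>2"
    using kappa_prod_le[OF k, of "A - B"] AB w zero_le_power2[of \<kappa>] by linarith
  also have "\<dots> = (B\<^sup>2 + 2 * A * B + 77 / 1000 * (A - B)) * w\<^sup>2" by (simp add: algebra_simps)
  also have "\<dots> \<le> 1 * w\<^sup>2" using AB by (intro mult_right_mono) auto
  finally show False by simp
qed

text \<open>The mirror image of \<open>lower_step\<close> with two additional losses: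
  \<open>\<kappa>^2 / 12\<close> now has the wrong sign (45 / 10000), and concavity of the square
  root makes the neighbours fall short of \<open>2 * sqrt n\<close> by up to
  \<open>1 / sqrt n\<close>, a relative loss controlled by \<open>n \<ge> 300\<close>.\<close>

lemma upper_step:
  assumes k0: "\<bar>\<kappa>\<bar> \<le> 23 / 100 * sqrt (real n0)" "n0 \<ge> 300"
    and lo: "\<And>n. n \<ge> n0 \<Longrightarrow> y n \<ge> B * sqrt (real n)"
    and AB: "B \<le> A" "B \<ge> 4 / 100" "A\<^sup>2 + 2 * A * B - 77 / 1000 * (A - B) - 45 / 10000 - (A + 4 / 100) * B / 300 \<ge> 1"
    and n: "n \<ge> n0 + 1"
  shows "y n \<le> A * sqrt (real n)"
proof (rule ccontr)
  assume neg: "\<not> ?thesis"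
  define w where "w = sqrt (real n)"
  have n': "n > 0" and w: "w > 0" "w\<^sup>2 = real n" using assms by (auto simp: w_def)
  have k: "\<bar>\<kappa>\<bar> \<le> 23 / 100 * w" using kappa_sqrt_mono assms by (simp add: w_def)
  have yn: "y n > A * w" using neg by (simp add: w_def)
  have "B * (2 * w - 1 / w) \<le> B * (sqrt (real (n + 1)) + sqrt (real (n - 1)))"
    unfolding w_def using sqrt_sum_lower[OF n'] AB by (intro mult_left_mono) auto
  also have "\<dots> \<le> y (n + 1) + y (n - 1)"
    unfolding distrib_left using n by (intro add_mono lo) auto
  finally have s: "B * (2 * w - 1 / w) \<le> y (n + 1) + y (n - 1)" .
  have "4 / 100 * w \<le> A * w" using AB w by (intro mult_right_mono) auto
  then have t: "A * w + \<kappa> / 6 > 0" using k w by linarith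
  have w2: "w\<^sup>2 \<ge> 300" using w n k0 by simp
  have "(A * w + \<kappa> / 6) * (B / w) \<le> ((A + 4 / 100) * w) * (B / w)"
    using k w AB by (intro mult_right_mono) (auto simp: algebra_simps abs_le_iff)
  also have "\<dots> = (A + 4 / 100) * B / 300 * 300" using w by simp
  also have "\<dots> \<le> (A + 4 / 100) * B / 300 * w\<^sup>2" using w2 AB by (intro mult_left_mono) auto
  finally have loss: "(A * w + \<kappa> / 6) * (B / w) \<le> (A + 4 / 100) * B / 300 * w\<^sup>2" .
  have "1 * w\<^sup>2 \<le> (A\<^sup>2 + 2 * A * B - 77 / 1000 * (A - B) - 45 / 10000 - (A + 4 / 100) * B / 300) * w\<^sup>2"
    using AB by (intro mult_right_mono) auto
  also have "\<dots> = (A\<^sup>2 + 2 * A * B) * w\<^sup>2 - 77 / 1000 * (A - B) * w\<^sup>2 - 45 / 10000 * w\<^sup>2 - (A + 4 / 100) * B / 300 * w\<^sup>2"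
    by (simp add: algebra_simps)
  also have "\<dots> \<le> (A\<^sup>2 + 2 * A * B) * w\<^sup>2 + \<kappa> * w * (B - A) / 3 - \<kappa>\<^sup>2 / 12 - (A * w + \<kappa> / 6) * (B / w)"
  proof -
    have "\<kappa> * w * (B - A) / 3 = - (\<kappa> * w * (A - B) / 3)"
      by (simp add: algebra_simps diff_divide_distrib)
    then show ?thesis
      using kappa_prod_le[OF k, of "A - B"] AB w kappa_square_le[OF k] loss by linarith
  qed
  also have "\<dots> = (A * w + \<kappa> / 6) * (A * w + B * (2 * w - 1 / w) - \<kappa> / 2)"
    by (simp add: algebra_simps power2_eq_square diff_divide_distrib)
  finally have ge: "w\<^sup>2 \<le> (A * w + \<kappa> / 6) * (A * w + B * (2 * w - 1 / w) - \<kappa> / 2)" by simp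
  \<comment> \<open>The second factor must be known to be positive before the first one may be
    enlarged to \<open>y n + \<kappa> / 6\<close>; this follows from the product being at least
    \<open>w^2\<close>.\<close>
  then have "A * w + B * (2 * w - 1 / w) - \<kappa> / 2 > 0"
    using t w zero_less_power[OF w(1), of 2] by (metis less_le_trans zero_less_mult_pos)
  then have "(A * w + \<kappa> / 6) * (A * w + B * (2 * w - 1 / w) - \<kappa> / 2)
     < (y n + \<kappa> / 6) * (A * w + B * (2 * w - 1 / w) - \<kappa> / 2)"
    using yn by (intro mult_strict_right_mono) auto
  also have "\<dots> \<le> (y n + \<kappa> / 6) * (y n + (y (n + 1) + y (n - 1)) - \<kappa> / 2)"
    using y_pos[OF n'] yn s by (intro mult_left_mono) auto
  also have "\<dots> = w\<^sup>2" using string_eq_y[OF n'] w by simp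
  finally show False using ge by linarith
qed

text \<open>Each of the two steps halves the deviation from the limit \<open>1 / sqrt 3\<close> of \<open>y n / sqrt n\<close>.\<close>
lemma two_steps:
  assumes k0: "\<bar>\<kappa>\<bar> \<le> 23 / 100 * sqrt (real n0)" "n0 \<ge> 300"
    and up: "\<And>n. n \<ge> n0 \<Longrightarrow> y n \<le> A * sqrt (real n)"
    and AB: "B \<le> A" "B \<ge> 4 / 100" "B\<^sup>2 + 2 * A * B + 77 / 1000 * (A - B) \<le> 1"
    and AB': "B \<le> A'" "A'\<^sup>2 + 2 * A' * B - 77 / 1000 * (A' - B) - 45 / 10000 - (A' + 4 / 100) * B / 300 \<ge> 1"
    and n: "n \<ge> n0 + 2"
  shows "y n \<le> A' * sqrt (real n)"
proof -
  have k1: "\<bar>\<kappa>\<bar> \<le> 23 / 100 * sqrt (real (n0 + 1))" using kappa_sqrt_mono[OF k0(1), of "n0 + 1"] by simp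
  have lo: "B * sqrt (real n) \<le> y n" if "n \<ge> n0 + 1" for n
    by (rule lower_step[OF k0(1) _ up AB that]) (use k0 in auto)
  show ?thesis
    by (rule upper_step[OF k1 _ lo AB'(1) AB(2) AB'(2)]) (use k0 n in auto)
qed

text \<open>Five rounds lead from 1.1 to 0.583; the values of A and B are roots of the quadratic
  conditions, rounded to the safe side. A round costs two indices, hence \<open>n0 + 10\<close>. The
  error terms of \<open>upper_step\<close> keep the bound above 1 / sqrt 3.\<close>

lemma y_upper:
  assumes k0: "\<bar>\<kappa>\<bar> \<le> 23 / 100 * sqrt (real n0)" "n0 \<ge> 300" and n: "n \<ge> n0 + 10"
  shows "y n \<le> 583 / 1000 * sqrt (real n)"
proof -
  have k: "\<bar>\<kappa>\<bar> \<le> 23 / 100 * sqrt (real (n0 + i))" "n0 + i \<ge> 300" for i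
    using kappa_sqrt_mono[OF k0(1), of "n0 + i"] k0 by auto
  have 0: "y n \<le> 11 / 10 * sqrt (real n)" if "n \<ge> n0 + 0" for n
    using crude_bound[OF k0(1)] k0 that by simp
  have 1: "y n \<le> 714 / 1000 * sqrt (real n)" if "n \<ge> n0 + 2" for n
    by (rule two_steps[OF k[of 0] 0, where B = "367 / 1000"]) (use that in \<open>auto simp: power2_eq_square\<close>)
  have 2: "y n \<le> 62 / 100 * sqrt (real n)" if "n \<ge> n0 + 4" for n
    by (rule two_steps[OF k[of 2] 1, where B = "508 / 1000"]) (use that in \<open>auto simp: power2_eq_square\<close>)
  have 3: "y n \<le> 593 / 1000 * sqrt (real n)" if "n \<ge> n0 + 6" for n
    by (rule two_steps[OF k[of 4] 2, where B = "554 / 1000"]) (use that in \<open>auto simp: power2_eq_square\<close>)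
  have 4: "y n \<le> 586 / 1000 * sqrt (real n)" if "n \<ge> n0 + 8" for n
    by (rule two_steps[OF k[of 6] 3, where B = "568 / 1000"]) (use that in \<open>auto simp: power2_eq_square\<close>)
  show ?thesis
    by (rule two_steps[OF k[of 8] 4, where B = "572 / 1000"]) (use n in \<open>auto simp: power2_eq_square\<close>)
qed

text \<open>0.583 + 0.23 / 6 < 0.65. This weaker bound is available early and suffices to make
  \<open>T\<close> contract; the factor 0.6 of \<open>c_upper_strong\<close> is 0.583 + 0.017 and
  requires a larger n.\<close>

lemma c_upper_weak:
  assumes k0: "\<bar>\<kappa>\<bar> \<le> 23 / 100 * sqrt (real n0)" "n0 \<ge> 300" and n: "n \<ge> n0 + 10"
  shows "c n \<le> 65 / 100 * sqrt (real n)"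
  using y_upper[OF assms] kappa_sqrt_mono[OF k0(1), of n] n by (simp add: y_def abs_le_iff)

lemma c_upper_strong:
  assumes k0: "\<bar>\<kappa>\<bar> \<le> 23 / 100 * sqrt (real n0)" "n0 \<ge> 300" and n: "n \<ge> n0 + 10"
    and k: "\<kappa> / 6 \<le> 17 / 1000 * sqrt (real n)"
  shows "c n \<le> 6 / 10 * sqrt (real n)"
  using y_upper[OF k0 n] k by (simp add: y_def)

text \<open>\<open>T k\<close> bounds the mass of the modes \<open>k, k - 2, \<dots>\<close> (which is \<open>S e k\<close>) relative to \<open>(e k)\<^sup>2\<close>,
  when the coefficients \<open>d\<close> of the derivative vanish up to \<open>k - 2\<close>. At \<open>k = 0\<close> the ratio is \<open>0 / 0 = 0\<close>,
  as it should be, because \<open>e 0 = 0\<close>.\<close>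
fun T :: "nat \<Rightarrow> real" where
  "T 0 = 1"
| "T (Suc 0) = 1"
| "T (Suc (Suc k)) = 1 + (c k)\<^sup>2 * c (k + 1) * c (k + 2) / (real k)\<^sup>2 * T k"

fun S :: "(nat \<Rightarrow> real) \<Rightarrow> nat \<Rightarrow> real" where
  "S e 0 = (e 0)\<^sup>2"
| "S e (Suc 0) = (e 1)\<^sup>2"
| "S e (Suc (Suc k)) = (e (k + 2))\<^sup>2 + S e k"

declare T.simps(3) [simp del]

section \<open>Low modes, high modes and the spectral gap\<close>

lemma sum_S: "(\<Sum>k\<le>Suc n. (e k)\<^sup>2) = S e n + S e (Suc n)"
  by (induction n) auto

lemma T_pos: "T k \<ge> 1"
  by (induction k rule: T.induct) (auto simp: T.simps(3) c_nonneg)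

text \<open>A vanishing \<open>d k\<close> expresses \<open>e k\<close> through
  \<open>e (k + 2)\<close>, and the square of the quotient is the factor in \<open>T\<close>. With d
  zero up to m this reaches the modes m + 1 and m + 2, one for each parity.\<close>

lemma S_le_T:
  assumes "e 0 = 0"
    and "\<And>k. 0 < k \<Longrightarrow> k \<le> m \<Longrightarrow> real k / sqrt (c k) * e k + sqrt (c k * c (k + 1) * c (k + 2)) * e (k + 2) = 0"
  shows "k \<le> m + 2 \<Longrightarrow> S e k \<le> T k * (e k)\<^sup>2"
proof (induction k rule: T.induct)
  case (3 k)
  show ?case
  proof (cases "k = 0")
    case True
    then show ?thesis using assms(1) T_pos[of 2] by (simp add: T.simps(3))
  next
    case False
    then have k: "0 < k" "k \<le> m" using 3 by auto
    have "real k / sqrt (c k) * e k = - (sqrt (c k * c (k + 1) * c (k + 2)) * e (k + 2))"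
      using assms(2)[OF k] by linarith
    then have "(real k / sqrt (c k) * e k)\<^sup>2 = (sqrt (c k * c (k + 1) * c (k + 2)) * e (k + 2))\<^sup>2"
      by (metis power2_minus)
    then have "(real k)\<^sup>2 / c k * (e k)\<^sup>2 = c k * c (k + 1) * c (k + 2) * (e (k + 2))\<^sup>2"
      using c_nonneg by (simp add: power_mult_distrib power_divide)
    then have "(e k)\<^sup>2 = (c k)\<^sup>2 * c (k + 1) * c (k + 2) / (real k)\<^sup>2 * (e (k + 2))\<^sup>2"
      using k c_positive[of k] by (simp add: field_simps power2_eq_square)
    then have "T k * (e k)\<^sup>2 = (T (Suc (Suc k)) - 1) * (e (k + 2))\<^sup>2" by (simp add: T.simps(3))
    then show ?thesis using 3 k by (simp add: algebra_simps)
  qed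
qed (use assms T_pos in auto)

text \<open>With \<open>c n \<le> 0.65 sqrt n\<close> the factor in \<open>T\<close> is at most
  \<open>0.43^2 < 1/4\<close>, where 0.43 instead of \<open>0.65^2 = 0.4225\<close> pays for
  replacing \<open>k + 2\<close> by k. The map \<open>1 + t / 4\<close> has the fixed point
  4/3.\<close>

lemma T_contract:
  assumes "\<And>n. n \<ge> n0 \<Longrightarrow> c n \<le> 65 / 100 * sqrt (real n)" "n0 \<ge> 300"
  shows "T (n0 + 2 * j) \<le> 4/3 + T n0 / 4 ^ j"
proof (induction j)
  case (Suc j)
  define k where "k = n0 + 2 * j"
  have k: "k \<ge> 300" "k \<ge> n0" using assms by (auto simp: k_def)
  have "c (k + 1) * c (k + 2) \<le> (65 / 100 * sqrt (real (k + 1))) * (65 / 100 * sqrt (real (k + 2)))"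
    using assms(1)[of "k + 1"] assms(1)[of "k + 2"] k c_nonneg by (intro mult_mono) auto
  also have "\<dots> \<le> (65 / 100 * sqrt (real (k + 2))) * (65 / 100 * sqrt (real (k + 2)))"
    by (intro mult_right_mono) auto
  also have "\<dots> = 4225 / 10000 * real (k + 2)" by simp
  also have "\<dots> \<le> 43 / 100 * real k" using k by simp
  finally have 1: "c (k + 1) * c (k + 2) \<le> 43 / 100 * real k" .
  have "(c k)\<^sup>2 \<le> (65 / 100 * sqrt (real k))\<^sup>2" using assms(1)[of k] k c_nonneg by (intro power_mono) auto
  also have "\<dots> \<le> 43 / 100 * real k" by (simp add: power_mult_distrib power2_eq_square)
  finally have "(c k)\<^sup>2 * (c (k + 1) * c (k + 2)) \<le> (43 / 100 * real k) * (43 / 100 * real k)"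
    by (rule mult_mono[OF _ 1]) (auto simp: c_nonneg)
  also have "\<dots> \<le> 1/4 * (real k)\<^sup>2" by (simp add: power2_eq_square)
  finally have "(c k)\<^sup>2 * c (k + 1) * c (k + 2) / (real k)\<^sup>2 \<le> 1/4"
    using k by (simp add: divide_le_eq mult.assoc)
  then have "(c k)\<^sup>2 * c (k + 1) * c (k + 2) / (real k)\<^sup>2 * T k \<le> 1/4 * T k"
    using T_pos[of k] by (intro mult_right_mono) auto
  then have "T (k + 2) \<le> 1 + 1/4 * T k" by (simp add: T.simps(3))
  also have "\<dots> \<le> 1 + 1/4 * (4/3 + T n0 / 4 ^ j)" using Suc by (simp add: k_def)
  finally show ?case by (simp add: k_def add_divide_distrib)
qed simp

text \<open>In the sum over k > m every term borrows 0.64 * 0.36 from the mode two places higher. So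
  \<open>A (m + 1)\<close> and \<open>A (m + 2)\<close> keep the weight 0.64, and all later ones
  keep 0.64 - 0.64 * 0.36 = 0.4096. The factor 1.5625 in \<open>low\<close> is the quotient of these
  weights, so the low modes are absorbed without a larger constant.\<close>

lemma high_modes:
  fixes e :: "nat \<Rightarrow> real"
  defines "d \<equiv> \<lambda>k. real k / sqrt (c k) * e k + sqrt (c k * c (k + 1) * c (k + 2)) * e (k + 2)"
  assumes m: "m > 0" and cu: "\<And>n. n > m \<Longrightarrow> c n \<le> 6 / 10 * sqrt (real n)"
    and e: "\<And>n. n > D \<Longrightarrow> e n = 0" and D: "D \<ge> m + 2"
    and low: "(\<Sum>k\<le>m+2. (e k)\<^sup>2) \<le> 15625 / 10000 * ((e (m + 1))\<^sup>2 + (e (m + 2))\<^sup>2)"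
  shows "(\<Sum>k\<le>D. (e k)\<^sup>2) \<le> ((12233 / 10000) / real m powr (3/4))\<^sup>2 * (\<Sum>k\<in>{m<..D}. (d k)\<^sup>2)"
proof -
  define A where "A k = (real k)\<^sup>2 / c k * (e k)\<^sup>2" for k
  define a where "a = real m powr (3/2) / (6 / 10)"
  have A0: "A k \<ge> 0" for k using c_nonneg by (simp add: A_def)
  have pointwise: "(d k)\<^sup>2 \<ge> 64 / 100 * A k - 64 / 100 * (36 / 100) * A (k + 2)" if "k > m" for k
  proof -
    define p q where "p = real k / sqrt (c k) * e k" and "q = sqrt (c k * c (k + 1) * c (k + 2)) * e (k + 2)"
    have ck: "c k > 0" "c (k + 1) > 0" "c (k + 2) > 0" using that c_positive by auto
    have p2: "p\<^sup>2 = A k" using ck by (simp add: p_def A_def power_mult_distrib power_divide)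
    have q2: "q\<^sup>2 = c k * c (k + 1) * c (k + 2) * (e (k + 2))\<^sup>2" using ck by (simp add: q_def power_mult_distrib)
    have "(c k * c (k + 1)) * (c (k + 2))\<^sup>2 \<le> (6 / 10 * sqrt (real k + 2) * (6 / 10 * sqrt (real k + 2))) * (6 / 10 * sqrt (real k + 2))\<^sup>2"
    proof -
      have "c (k + i) \<le> 6 / 10 * sqrt (real k + 2)" if "i \<le> 2" for i
      proof -
        have "c (k + i) \<le> 6 / 10 * sqrt (real (k + i))" using cu[of "k + i"] \<open>k > m\<close> by simp
        also have "\<dots> \<le> 6 / 10 * sqrt (real k + 2)" using that by simp
        finally show ?thesis .
      qed
      from this[of 0] this[of 1] this[of 2] show ?thesis
        using ck by (intro mult_mono power_mono) auto
    qed
    also have "\<dots> = (36 / 100)\<^sup>2 * (real (k + 2))\<^sup>2" by (simp add: power_mult_distrib power2_eq_square field_simps)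
    finally have "c k * c (k + 1) * c (k + 2) \<le> (36 / 100)\<^sup>2 * (real (k + 2))\<^sup>2 / c (k + 2)"
      using ck by (simp add: pos_le_divide_eq power2_eq_square mult_ac)
    then have "q\<^sup>2 \<le> (36 / 100)\<^sup>2 * (real (k + 2))\<^sup>2 / c (k + 2) * (e (k + 2))\<^sup>2"
      unfolding q2 by (intro mult_right_mono) auto
    also have "\<dots> = (36 / 100)\<^sup>2 * A (k + 2)" by (simp add: A_def)
    finally have q3: "q\<^sup>2 \<le> (36 / 100)\<^sup>2 * A (k + 2)" .
    \<comment> \<open>\<open>(p + q)\<^sup>2 \<ge> (1 - r) p\<^sup>2 + (1 - 1/r) q\<^sup>2\<close> with \<open>r = 0.36\<close>\<close>
    have "(p + q)\<^sup>2 = 64 / 100 * p\<^sup>2 - (64 / 100) / (36 / 100) * q\<^sup>2 + (6 / 10 * p + q / (6 / 10))\<^sup>2"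
      by (simp add: power2_eq_square algebra_simps)
    then have "(p + q)\<^sup>2 \<ge> 64 / 100 * p\<^sup>2 - (64 / 100) / (36 / 100) * q\<^sup>2" by simp
    moreover have "d k = p + q" by (simp add: d_def p_def q_def)
    ultimately show ?thesis using p2 q3 by (simp add: power2_eq_square)
  qed
  define Y where "Y = (\<Sum>k\<in>{m+2<..D}. A k)"
  define Xe where "Xe = A (m + 1) + A (m + 2)"
  have split: "sum f {m<..D} = f (m + 1) + f (m + 2) + sum f {m+2<..D}" for f :: "nat \<Rightarrow> real"
  proof -
    have "{m<..D} = insert (m + 1) (insert (m + 2) {m+2<..D})" using D by auto
    then show ?thesis by simp
  qed
  have "(\<Sum>k\<in>{m<..D}. A (k + 2)) = (\<Sum>k\<in>{m+2<..D+2}. A k)"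
    by (rule sum.reindex_bij_witness[of _ "\<lambda>k. k - 2" "\<lambda>k. k + 2"]) auto
  also have "\<dots> = Y" unfolding Y_def using e
    by (intro sum.mono_neutral_right) (auto simp: A_def)
  finally have shift: "(\<Sum>k\<in>{m<..D}. A (k + 2)) = Y" .
  have "(\<Sum>k\<in>{m<..D}. (d k)\<^sup>2) \<ge> (\<Sum>k\<in>{m<..D}. 64 / 100 * A k - 64 / 100 * (36 / 100) * A (k + 2))"
    using pointwise by (intro sum_mono) auto
  moreover have "(\<Sum>k\<in>{m<..D}. 64 / 100 * A k - 64 / 100 * (36 / 100) * A (k + 2)) = 64 / 100 * Xe + 64 / 100 * (64 / 100) * Y"
    unfolding sum_subtractf sum_distrib_left[symmetric] shift split[of A] by (simp add: Xe_def Y_def field_simps)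
  ultimately have d2: "64 / 100 * Xe + 4096 / 10000 * Y \<le> (\<Sum>k\<in>{m<..D}. (d k)\<^sup>2)" by simp
  \<comment> \<open>Here the power of m arises: \<open>k^2 / c k\<close> is at least
    \<open>k^(3/2) / 0.6\<close>, which is increasing in k.\<close>
  have Ak: "a * (e k)\<^sup>2 \<le> A k" if "k > m" for k
  proof -
    have k: "real k > 0" "c k > 0" using that c_positive by auto
    have "a \<le> real k powr (3/2) / (6 / 10)" unfolding a_def using that by (intro divide_right_mono powr_mono2) auto
    also have "\<dots> = (real k)\<^sup>2 / (6 / 10 * sqrt (real k))"
    proof -
      have "real k powr (3/2) * sqrt (real k) = (real k)\<^sup>2"
        using k by (simp add: powr_half_sqrt[symmetric] powr_add[symmetric])
      then show ?thesis using k by (simp add: field_simps)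
    qed
    also have "\<dots> \<le> (real k)\<^sup>2 / c k" using cu[OF that] k by (intro divide_left_mono) auto
    finally show ?thesis unfolding A_def by (intro mult_right_mono) auto
  qed
  have "(\<Sum>k\<le>D. (e k)\<^sup>2) = (\<Sum>k\<le>m+2. (e k)\<^sup>2) + (\<Sum>k\<in>{m+2<..D}. (e k)\<^sup>2)"
    using D by (subst sum.union_disjoint[symmetric]) (auto intro: sum.cong)
  then have "a * (\<Sum>k\<le>D. (e k)\<^sup>2) \<le> a * (15625 / 10000 * ((e (m + 1))\<^sup>2 + (e (m + 2))\<^sup>2) + (\<Sum>k\<in>{m+2<..D}. (e k)\<^sup>2))"
    using low by (intro mult_left_mono) (auto simp: a_def)
  also have "\<dots> = 15625 / 10000 * (a * (e (m + 1))\<^sup>2 + a * (e (m + 2))\<^sup>2) + (\<Sum>k\<in>{m+2<..D}. a * (e k)\<^sup>2)"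
    by (simp add: algebra_simps sum_distrib_left)
  also have "\<dots> \<le> 15625 / 10000 * (A (m + 1) + A (m + 2)) + Y"
    unfolding Y_def using Ak by (intro add_mono mult_left_mono sum_mono) auto
  also have "\<dots> = (64 / 100 * Xe + 4096 / 10000 * Y) / (4096 / 10000)" by (simp add: Xe_def)
  also have "\<dots> \<le> (\<Sum>k\<in>{m<..D}. (d k)\<^sup>2) / (4096 / 10000)" using d2 by (intro divide_right_mono) auto
  finally have fin: "a * (\<Sum>k\<le>D. (e k)\<^sup>2) \<le> (\<Sum>k\<in>{m<..D}. (d k)\<^sup>2) / (4096 / 10000)" .
  define M where "M = real m powr (3/2)"
  have M: "M > 0" using m by (simp add: M_def)
  have "(real m powr (3/4))\<^sup>2 = M" using m by (simp add: M_def powr_add[symmetric] power2_eq_square)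
  then have "((12233 / 10000) / real m powr (3/4))\<^sup>2 = (149646289 / 100000000) / M" by (simp add: power_divide power2_eq_square)
  moreover have "(\<Sum>k\<le>D. (e k)\<^sup>2) \<le> ((6 / 10) / (4096 / 10000)) / M * (\<Sum>k\<in>{m<..D}. (d k)\<^sup>2)"
    using fin M by (simp add: a_def M_def[symmetric] field_simps)
  \<comment> \<open>0.6 / 0.4096 = 1.4648... is below \<open>1.2233^2\<close> = 1.49646289.\<close>
  moreover have "((6 / 10) / (4096 / 10000)) / M * (\<Sum>k\<in>{m<..D}. (d k)\<^sup>2) \<le> (149646289 / 100000000) / M * (\<Sum>k\<in>{m<..D}. (d k)\<^sup>2)"
    using M by (intro mult_right_mono divide_right_mono sum_nonneg) auto
  ultimately show ?thesis by simp
qed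

definition good :: "nat \<Rightarrow> bool" where
  "good m \<longleftrightarrow> m > 0 \<and> (\<forall>n>m. c n \<le> 6 / 10 * sqrt (real n)) \<and> T (m + 1) \<le> 15625 / 10000 \<and> T (m + 2) \<le> 15625 / 10000"

lemma spectral_gap:
  fixes e :: "nat \<Rightarrow> real"
  defines "d \<equiv> \<lambda>k. real k / sqrt (c k) * e k + sqrt (c k * c (k + 1) * c (k + 2)) * e (k + 2)"
  assumes m: "good m" and e: "\<And>n. n > D \<Longrightarrow> e n = 0" and D: "D \<ge> m + 2"
    and e0: "e 0 = 0" and d0: "\<And>k. 0 < k \<Longrightarrow> k \<le> m \<Longrightarrow> d k = 0"
  shows "(\<Sum>k\<le>D. (e k)\<^sup>2) \<le> ((12233 / 10000) / real m powr (3/4))\<^sup>2 * (\<Sum>k\<in>{m<..D}. (d k)\<^sup>2)"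
  unfolding d_def
proof (rule high_modes)
  have "S e (m + 1) \<le> T (m + 1) * (e (m + 1))\<^sup>2" "S e (m + 2) \<le> T (m + 2) * (e (m + 2))\<^sup>2"
    using d0 unfolding d_def by (intro S_le_T[of e m]; use e0 in simp)+
  moreover have "T (m + 1) * (e (m + 1))\<^sup>2 \<le> 15625 / 10000 * (e (m + 1))\<^sup>2" "T (m + 2) * (e (m + 2))\<^sup>2 \<le> 15625 / 10000 * (e (m + 2))\<^sup>2"
    using m unfolding good_def by (intro mult_right_mono; simp)+
  ultimately show "(\<Sum>k\<le>m+2. (e k)\<^sup>2) \<le> 15625 / 10000 * ((e (m + 1))\<^sup>2 + (e (m + 2))\<^sup>2)"
    using sum_S[of e "m + 1"] by (simp add: distrib_left)
qed (use m e D in \<open>auto simp: good_def\<close>)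

text \<open>\<open>T\<close> relates only indices of equal parity, so a starting value is needed in
  each class. After j contractions the start contributes at most 0.2, and 4/3 + 0.2 <
  1.5625.\<close>

lemma T_even_odd_bound:
  assumes "\<And>n. n \<ge> n0 \<Longrightarrow> c n \<le> 65 / 100 * sqrt (real n)" "n0 \<ge> 300"
    and "T n0 \<le> 2 / 10 * 4 ^ j" "T (n0 + 1) \<le> 2 / 10 * 4 ^ j" "k \<ge> n0 + 2 * j + 1"
  shows "T k \<le> 15625 / 10000"
proof -
  have *: "4/3 + T a / 4 ^ i \<le> 15625 / 10000" if "T a \<le> 2 / 10 * 4 ^ j" "i \<ge> j" for a i
  proof -
    have "(4::real) ^ j \<le> 4 ^ i" using that by (intro power_increasing) auto
    then have "T a \<le> 2 / 10 * 4 ^ i" using that by linarith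
    then have "T a / 4 ^ i \<le> 2 / 10" by (simp add: field_simps)
    then show ?thesis by linarith
  qed
  show ?thesis
  proof (cases "even (k - n0)")
    case True
    then obtain i where "k - n0 = 2 * i" by (elim evenE)
    then have "k = n0 + 2 * i" "i \<ge> j" using assms by auto
    then show ?thesis using T_contract[OF assms(1,2), of i] *[OF assms(3), of i] by simp
  next
    case False
    then obtain i where "k - n0 = 2 * i + 1" by (elim oddE)
    then have "k = (n0 + 1) + 2 * i" "i \<ge> j" using assms by auto
    then show ?thesis using T_contract[of "n0 + 1" i] *[OF assms(4), of i] assms(1,2) by simp
  qed
qed

lemma eventually_good: "\<exists>N. \<forall>m\<ge>N. good m"
proof -
  \<comment> \<open>The ratio 1/10 serves both bounds on c: it is below 0.23, and 0.1 / 6 <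
    0.017.\<close>
  obtain n1 where n1: "real n1 \<ge> (\<bar>\<kappa>\<bar> / (1 / 10))\<^sup>2" using real_arch_simple by blast
  define n0 where "n0 = max 300 n1"
  have k: "\<bar>\<kappa>\<bar> \<le> 1 / 10 * sqrt (real n)" if "n \<ge> n0" for n
  proof -
    have "\<bar>\<kappa>\<bar> / (1 / 10) \<le> sqrt (real n)" using n1 that by (intro real_le_rsqrt) (auto simp: n0_def)
    then show ?thesis by simp
  qed
  have k': "\<bar>\<kappa>\<bar> \<le> 23 / 100 * sqrt (real n0)" 
    by (rule order_trans[OF k[of n0]]) (auto intro: mult_right_mono)
  have n0: "n0 \<ge> 300" by (simp add: n0_def)
  have cs: "c n \<le> 6 / 10 * sqrt (real n)" if "n \<ge> n0 + 10" for n
    using c_upper_strong[OF k' n0 that] k[of n] that by (simp add: abs_le_iff)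
  obtain j where j: "max (T (n0 + 10)) (T (n0 + 11)) / (2 / 10) < 4 ^ j"
    using real_arch_pow[of 4] by auto
  then have j': "T (n0 + 10) \<le> 2 / 10 * 4 ^ j" "T (n0 + 10 + 1) \<le> 2 / 10 * 4 ^ j"
    by (simp_all add: field_simps)
  have "T k \<le> 15625 / 10000" if "k \<ge> n0 + 10 + 2 * j + 1" for k
    by (rule T_even_odd_bound[OF c_upper_weak[OF k' n0] _ j' that]) (use n0 in auto)
  then have "good m" if "m \<ge> n0 + 11 + 2 * j" for m
    using that cs by (auto simp: good_def)
  then show ?thesis by blast
qed

text \<open>Crude, but the contraction by \<open>1/4\<close> per step in \<open>T_contract\<close> absorbs it long before \<open>m = 2187\<close>.\<close>
lemma T_crude:
  assumes "\<kappa> = 4" shows "T k \<le> 500 ^ (k div 2)"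
proof (induction k rule: T.induct)
  case (3 k)
  \<comment> \<open>Dropping both neighbours from the string equation leaves
    \<open>c (c - 4) \<le> n + 1\<close>, that is \<open>(c - 2)^2 \<le> n + 5\<close>.\<close>
  have c_le: "c (Suc n) \<le> 2 + sqrt (real n + 5)" for n
  proof -
    have "c (Suc n) * (c (Suc n) - 4) \<le> c (Suc n) * (c (Suc (Suc n)) + c (Suc n) + c n - \<kappa>)"
    proof (rule mult_left_mono)
      show "c (Suc n) - 4 \<le> c (Suc (Suc n)) + c (Suc n) + c n - \<kappa>"
        using c_nonneg[of "Suc (Suc n)"] c_nonneg[of n] assms by linarith
    qed (rule c_nonneg)
    then have "(c (Suc n) - 2)\<^sup>2 \<le> real n + 5" using string_eq[of n] by (simp add: power2_eq_square algebra_simps)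
    then have "c (Suc n) - 2 \<le> sqrt (real n + 5)" by (rule real_le_rsqrt)
    then show ?thesis by simp
  qed
  show ?case
  proof (cases "k = 0")
    case False
    define w where "w = sqrt (real k)"
    have w: "w \<ge> 1" "w\<^sup>2 = real k" using False by (auto simp: w_def)
    have cb: "c (k + i) \<le> 465 / 100 * w" if "i \<le> 2" for i
    proof -
      obtain n where n: "k + i = Suc n" using False by (cases "k + i") auto
      \<comment> \<open>Here \<open>n = k + i - 1\<close> is at most \<open>k + 1\<close>, so
        \<open>n + 5 \<le> k + 6 \<le> 7 k\<close>. Then 2 + 2.65 w is at most 4.65 w, and
        \<open>4.65^4 < 499\<close> leaves 1 for the summand in \<open>T\<close>.\<close>
      have "real n + 5 \<le> 7 * real k" using n that False by linarith
      then have "sqrt (real n + 5) \<le> sqrt (7 * real k)" by simp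
      also have "\<dots> = sqrt 7 * w" by (simp add: w_def real_sqrt_mult)
      also have "\<dots> \<le> 265 / 100 * w" using w by (intro mult_right_mono real_le_lsqrt) (auto simp: power2_eq_square)
      finally show ?thesis using c_le[of n] n w by simp
    qed
    have "(c k)\<^sup>2 * c (k + 1) * c (k + 2) \<le> (465 / 100 * w)\<^sup>2 * (465 / 100 * w) * (465 / 100 * w)"
      using cb[of 0] cb[of 1] cb[of 2] c_nonneg w by (intro mult_mono power_mono) auto
    also have "\<dots> = (465 / 100) ^ 4 * (w\<^sup>2)\<^sup>2" by (simp add: power2_eq_square power4_eq_xxxx)
    also have "\<dots> \<le> 499 * (real k)\<^sup>2" unfolding w(2) by (intro mult_right_mono) (auto simp: power4_eq_xxxx)
    finally have "(c k)\<^sup>2 * c (k + 1) * c (k + 2) / (real k)\<^sup>2 \<le> 499"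
      using False by (simp add: divide_le_eq)
    then have "(c k)\<^sup>2 * c (k + 1) * c (k + 2) / (real k)\<^sup>2 * T k \<le> 499 * 500 ^ (k div 2)"
      using T_pos[of k] by (intro mult_mono 3) auto
    moreover have "(1::real) \<le> 500 ^ (k div 2)" by simp
    ultimately have "T (Suc (Suc k)) \<le> 500 * 500 ^ (k div 2)" unfolding T.simps(3) by linarith
    then show ?thesis by simp
  qed (simp add: T.simps(3))
qed auto

text \<open>The iteration may start at 310, since \<open>(4 / 0.23)^2 < 303\<close>, so the weak
  bound on c holds from 320 on. The strong bound needs \<open>n \<ge> (4 / 6 / 0.017)^2\<close>,
  about 1538, and 802 contractions of \<open>T\<close> from 320 and 321 are completed by index 1925.
  All of this lies below 2188.\<close>

lemma good_4: assumes "\<kappa> = 4" "m \<ge> 2187" shows "good m"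
proof -
  have "\<bar>\<kappa>\<bar> / (23 / 100) \<le> sqrt (real 310)" using assms by (intro real_le_rsqrt) (simp add: power2_eq_square)
  then have k': "\<bar>\<kappa>\<bar> \<le> 23 / 100 * sqrt (real 310)" by simp
  have cs: "c n \<le> 6 / 10 * sqrt (real n)" if "n > m" for n
  proof (rule c_upper_strong[OF k'])
    have "\<kappa> / 6 / (17 / 1000) \<le> sqrt (real n)" using assms that by (intro real_le_rsqrt) (simp add: power2_eq_square)
    then show "\<kappa> / 6 \<le> 17 / 1000 * sqrt (real n)" by simp
  qed (use assms that in auto)
  have scale: "x \<le> 2 / 10 * (x * 4\<^sup>2)" if "x \<ge> 0" for x :: real using that by simp
  \<comment> \<open>Since \<open>500 < 4^5\<close>, five contractions undo one crude step; the two
    extra ones bring the factor 16, which more than pays for the 0.2.\<close>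
  have T0: "T k \<le> 2 / 10 * 4 ^ (5 * 160 + 2)" if "k div 2 = 160" for k
  proof -
    have "T k \<le> 500 ^ 160" using T_crude[OF assms(1), of k] unfolding that .
    also have "\<dots> \<le> (4 ^ 5) ^ 160" by (rule power_mono) simp_all
    also have "\<dots> = (4::real) ^ (5 * 160)" by (rule power_mult[symmetric])
    also have "\<dots> \<le> 2 / 10 * (4 ^ (5 * 160) * 4\<^sup>2)"
      by (rule scale) (rule zero_le_power, simp)
    also have "(4::real) ^ (5 * 160) * 4\<^sup>2 = 4 ^ (5 * 160 + 2)" by (rule power_add[symmetric])
    finally show ?thesis .
  qed
  have "T k \<le> 15625 / 10000" if "k \<ge> 2188" for k
  proof (rule T_even_odd_bound[OF c_upper_weak[OF k']])
    show "T 320 \<le> 2 / 10 * 4 ^ (5 * 160 + 2)" "T (320 + 1) \<le> 2 / 10 * 4 ^ (5 * 160 + 2)" by (rule T0, simp)+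
  qed (use that in simp_all)
  then show ?thesis using cs assms by (auto simp: good_def)
qed

end

section \<open>The gap for polynomials and for the span of the \<open>q j\<close>\<close>

sublocale freud_functional \<subseteq> seq: string_equation c \<kappa>
proof
  show "c n \<ge> 0" for n using c_pos[of n] by (cases "n = 0") auto
qed (rule c_pos, assumption, rule string_equation)

context freud_functional
begin

lemma e_coef_eq_0: "degree v < n \<Longrightarrow> e_coef v n = 0"
  using E_mon_lower[of v n] by (simp add: e_coef_def mult.commute)

text \<open>Parseval turns both sides into sums of squares. As \<open>d (Suc k)\<close> is the mode
  of v' of degree k, orthogonality below degree m gives \<open>d k = 0\<close> exactly for 0 < k
  \<le> m, and \<open>E v = 0\<close> gives \<open>e 0 = 0\<close>.\<close>

lemma poly_gap:
  assumes m: "seq.good m" and v: "E v = 0" and orth: "\<And>k. k < m \<Longrightarrow> E (pderiv v * mon k) = 0"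
  shows "E (v * v) \<le> (12233 / 10000 / real m powr (3/4))\<^sup>2 * E (pderiv v * pderiv v)"
proof -
  define D where "D = max (m + 2) (degree v)"
  define d where "d k = real k / sqrt (c k) * e_coef v k + sqrt (c k * c (k + 1) * c (k + 2)) * e_coef v (k + 2)" for k
  have d_Suc: "d (Suc k) = e_coef (pderiv v) k" for k
    unfolding d_def e_coef_pderiv by (simp add: eval_nat_numeral)
  have "E (v * v) = (\<Sum>k\<le>D. (e_coef v k)\<^sup>2)"
    by (rule parseval_e) (simp add: D_def)
  also have "\<dots> \<le> (12233 / 10000 / real m powr (3/4))\<^sup>2 * (\<Sum>k\<in>{m<..D}. (d k)\<^sup>2)"
    unfolding d_def
  proof (rule seq.spectral_gap[OF m])
    show "e_coef v n = 0" if "n > D" for n using that by (intro e_coef_eq_0) (simp add: D_def)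
    show "e_coef v 0 = 0" by (rule e_coef_0[OF v])
    fix k assume "0 < k" "k \<le> m"
    then obtain j where j: "k = Suc j" "j < m" by (cases k) auto
    have "d k = 0" unfolding j(1) d_Suc using orth[OF j(2)] by (simp add: e_coef_def)
    then show "real k / sqrt (c k) * e_coef v k + sqrt (c k * c (k + 1) * c (k + 2)) * e_coef v (k + 2) = 0"
      by (simp only: d_def)
  qed (simp add: D_def)
  also have "(\<Sum>k\<in>{m<..D}. (d k)\<^sup>2) \<le> (\<Sum>k\<in>{0<..D}. (d k)\<^sup>2)"
    by (intro sum_mono2) auto
  also have "\<dots> = (\<Sum>k<D. (e_coef (pderiv v) k)\<^sup>2)"
    by (rule sum.reindex_bij_witness[of _ Suc "\<lambda>k. k - 1"]) (auto simp flip: d_Suc)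
  also have "\<dots> \<le> (\<Sum>k\<le>D. (e_coef (pderiv v) k)\<^sup>2)"
    by (intro sum_mono2) auto
  also have "\<dots> = E (pderiv v * pderiv v)"
    by (rule parseval_e[symmetric]) (simp add: D_def degree_pderiv)
  finally show ?thesis by (simp add: mult_left_mono)
qed

end

text \<open>For j > m the derivative \<open>p (j - 1)\<close> of \<open>q j\<close> has degree at
  least m, hence is orthogonal to all \<open>mon k\<close> with k < m. This is the form in which
  \<open>poly_gap\<close> uses the span.\<close>

lemma qspan_poly:
  assumes "v \<in> qspan \<kappa> m"
  obtains Q where "v = poly Q" "Enu \<kappa> Q = 0" "\<And>k. k < m \<Longrightarrow> Enu \<kappa> (pderiv Q * freud.mon \<kappa> k) = 0"
proof -
  obtain a M where v: "v = (\<lambda>x. \<Sum>j\<in>{m<..M}. a j * poly (q \<kappa> j) x)"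
    using assms by (auto simp: qspan_def)
  define Q where "Q = (\<Sum>j\<in>{m<..M}. smult (a j) (q \<kappa> j))"
  have q_props: "Enu \<kappa> (q \<kappa> j) = 0" "pderiv (q \<kappa> j) = p \<kappa> (j - 1)" if "j > m" for j
    using that Enu_q_Suc[of \<kappa> "j - 1"] pderiv_q_Suc[of \<kappa> "j - 1"] by (cases j; simp)+
  have dQ: "pderiv Q = (\<Sum>j\<in>{m<..M}. smult (a j) (p \<kappa> (j - 1)))"
    unfolding Q_def higher_pderiv_sum[of 1, simplified] by (intro sum.cong) (auto simp: pderiv_smult q_props)
  show ?thesis
  proof
    show "v = poly Q" unfolding v Q_def by (auto simp: poly_sum)
    show "Enu \<kappa> Q = 0" unfolding Q_def by (auto simp: freud.E_sum freud.E_smult q_props intro!: sum.neutral)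
    show "Enu \<kappa> (pderiv Q * freud.mon \<kappa> k) = 0" if "k < m" for k
      unfolding dQ sum_distrib_right using that
      by (auto simp: freud.E_sum freud.E_smult p_eq freud.onp_def freud.E_mon_mon intro!: sum.neutral)
  qed
qed

section \<open>Smooth bump functions\<close>

text \<open>An explicit tower of successive derivatives is easier to exhibit and to combine than the
  iterates of \<open>deriv\<close>, which it determines.\<close>

definition smooth :: "(real \<Rightarrow> real) \<Rightarrow> bool" where
  "smooth f \<longleftrightarrow> (\<exists>g. g 0 = f \<and> (\<forall>k x. (g k has_real_derivative g (Suc k) x) (at x)))"

lemma smooth_higher_deriv:
  assumes "smooth f" shows "((deriv ^^ k) f) differentiable (at x)"
proof -
  obtain g where g: "g 0 = f" "\<And>k x. (g k has_real_derivative g (Suc k) x) (at x)"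
    using assms by (auto simp: smooth_def)
  have "(deriv ^^ k) f = g k" for k
  proof (induction k)
    case (Suc k)
    then have "(deriv ^^ Suc k) f = deriv (g k)" by simp
    also have "\<dots> = g (Suc k)" using g(2) by (intro ext DERIV_imp_deriv)
    finally show ?case .
  qed (simp add: g)
  then show ?thesis using g(2) real_differentiable_def by metis
qed

lemma smooth_lincomb:
  assumes "smooth f1" "smooth f2" shows "smooth (\<lambda>x. a * f1 x - b * f2 x)"
proof -
  obtain g1 g2 where g: "g1 0 = f1" "\<And>k x. (g1 k has_real_derivative g1 (Suc k) x) (at x)"
      "g2 0 = f2" "\<And>k x. (g2 k has_real_derivative g2 (Suc k) x) (at x)"
    using assms by (auto simp: smooth_def)
  have "((\<lambda>x. a * g1 k x - b * g2 k x) has_real_derivative a * g1 (Suc k) x - b * g2 (Suc k) x) (at x)" for k x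
    by (intro DERIV_diff DERIV_cmult g)
  then show ?thesis unfolding smooth_def by (intro exI[of _ "\<lambda>k x. a * g1 k x - b * g2 k x"]) (auto simp: g)
qed

lemma smooth_antiderivative:
  assumes "smooth f" and "\<And>x. (F has_real_derivative f x) (at x)" shows "smooth F"
proof -
  obtain g where g: "g 0 = f" "\<And>k x. (g k has_real_derivative g (Suc k) x) (at x)"
    using assms by (auto simp: smooth_def)
  show ?thesis unfolding smooth_def
  proof (intro exI[of _ "case_nat F g"] conjI allI)
    show "((case k of 0 \<Rightarrow> F | Suc k \<Rightarrow> g k) has_real_derivative (case Suc k of 0 \<Rightarrow> F | Suc k \<Rightarrow> g k) x) (at x)" for k x
      using assms(2) g by (cases k) auto
  qed simp
qed

text \<open>The functions \<open>P(1/x) exp(-1/x)\<close>, extended by zero to \<open>x \<le> 0\<close>, are closed under differentiation.\<close>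

definition flat :: "real poly \<Rightarrow> real \<Rightarrow> real" where
  "flat P x = (if x > 0 then poly P (1 / x) * exp (- (1 / x)) else 0)"

text \<open>The chain rule in the variable y = 1/x, where dy/dx is \<open>- y^2\<close>.\<close>

definition dflat :: "real poly \<Rightarrow> real poly" where
  "dflat P = [:0, 0, 1:] * (P - pderiv P)"

lemma flat_tendsto_0: "(flat P \<longlongrightarrow> 0) (at_right 0)"
proof -
  have "((\<lambda>y. \<Sum>i\<le>degree P. coeff P i * (y ^ i / exp y)) \<longlongrightarrow> 0) at_top"
    by (intro tendsto_null_sum tendsto_mult_right_zero tendsto_power_div_exp_0)
  moreover have "(\<Sum>i\<le>degree P. coeff P i * (y ^ i / exp y)) = poly P y * exp (- y)" for y
    unfolding poly_altdef sum_distrib_right by (intro sum.cong refl) (simp add: exp_minus field_simps)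
  ultimately have "((\<lambda>y. poly P y * exp (- y)) \<longlongrightarrow> 0) at_top" by simp
  then have "((\<lambda>x. poly P (inverse x) * exp (- inverse x)) \<longlongrightarrow> 0) (at_right 0)"
    by (rule filterlim_compose[OF _ filterlim_inverse_at_top_right])
  moreover have "\<forall>\<^sub>F x in at_right 0. poly P (inverse x) * exp (- inverse x) = flat P x"
    using eventually_at_right_less by eventually_elim (simp add: flat_def inverse_eq_divide)
  ultimately show ?thesis by (rule Lim_transform_eventually)
qed

lemma DERIV_flat: "(flat P has_real_derivative flat (dflat P) x) (at x)"
proof -
  consider "x > 0" | "x < 0" | "x = 0" by linarith
  then show ?thesis
  proof cases
    case 1
    have "((\<lambda>x. poly P (1 / x) * exp (- (1 / x))) has_real_derivative
        poly (pderiv P) (1 / x) * (- (1 / x\<^sup>2)) * exp (- (1 / x)) + exp (- (1 / x)) * (1 / x\<^sup>2) * poly P (1 / x)) (at x)"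
    proof (rule DERIV_mult)
      have inv: "((\<lambda>x. 1 / x) has_real_derivative - (1 / x\<^sup>2)) (at x)"
        using 1 by (auto intro!: derivative_eq_intros simp: power2_eq_square)
      show "((\<lambda>x. poly P (1 / x)) has_real_derivative poly (pderiv P) (1 / x) * (- (1 / x\<^sup>2))) (at x)"
        by (rule DERIV_chain2[OF poly_DERIV inv])
      show "((\<lambda>x. exp (- (1 / x))) has_real_derivative exp (- (1 / x)) * (1 / x\<^sup>2)) (at x)"
        using DERIV_chain2[OF DERIV_exp DERIV_minus[OF inv]] by simp
    qed
    moreover have "poly (pderiv P) (1 / x) * (- (1 / x\<^sup>2)) * exp (- (1 / x)) + exp (- (1 / x)) * (1 / x\<^sup>2) * poly P (1 / x) = flat (dflat P) x"
      using 1 by (simp add: flat_def dflat_def algebra_simps power2_eq_square)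
    ultimately have "((\<lambda>x. poly P (1 / x) * exp (- (1 / x))) has_real_derivative flat (dflat P) x) (at x)" by simp
    then show ?thesis
      by (rule has_field_derivative_transform_within_open[of _ _ _ "{0<..}"]) (use 1 in \<open>auto simp: flat_def\<close>)
  next
    case 2
    have "((\<lambda>x. 0) has_real_derivative flat (dflat P) x) (at x)" using 2 by (simp add: flat_def)
    then show ?thesis
      by (rule has_field_derivative_transform_within_open[of _ _ _ "{..<0}"]) (use 2 in \<open>auto simp: flat_def\<close>)
  next
    case 3
    have "((\<lambda>h. (flat P (0 + h) - flat P 0) / h) \<longlongrightarrow> 0) (at 0)"
      unfolding filterlim_at_split
    proof
      show "((\<lambda>h. (flat P (0 + h) - flat P 0) / h) \<longlongrightarrow> 0) (at_left 0)"
        by (rule Lim_transform_eventually[OF tendsto_const])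
           (auto simp: flat_def eventually_at_left_field intro: exI[of _ "-1"])
      \<comment> \<open>Division by h multiplies the polynomial in 1/h by its variable, so the
        difference quotient is again a flat function.\<close>
      have "\<forall>\<^sub>F h in at_right 0. flat ([:0, 1:] * P) h = (flat P (0 + h) - flat P 0) / h"
        using eventually_at_right_less by eventually_elim (simp add: flat_def)
      with flat_tendsto_0 show "((\<lambda>h. (flat P (0 + h) - flat P 0) / h) \<longlongrightarrow> 0) (at_right 0)"
        by (rule Lim_transform_eventually)
    qed
    then show ?thesis using 3 by (simp add: DERIV_def flat_def)
  qed
qed

text \<open>Lists of polynomial pairs encode finite sums of products of flat functions. The product
  rule replaces each pair by two, so every derivative of a bump has this shape.\<close>

definition bump_sum :: "real \<Rightarrow> real \<Rightarrow> real \<Rightarrow> (real poly \<times> real poly) list \<Rightarrow> real \<Rightarrow> real" where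
  "bump_sum s a b l x = (\<Sum>(P, Q)\<leftarrow>l. flat P (s * (x - a)) * flat Q (s * (b - x)))"

definition bump_sum_deriv :: "real \<Rightarrow> (real poly \<times> real poly) list \<Rightarrow> (real poly \<times> real poly) list" where
  "bump_sum_deriv s l = concat (map (\<lambda>(P, Q). [(smult s (dflat P), Q), (smult (- s) P, dflat Q)]) l)"

lemma flat_smult: "flat (smult c P) x = c * flat P x" and flat_uminus: "flat (- P) x = - flat P x"
  by (simp_all add: flat_def)

lemma DERIV_bump_sum: "(bump_sum s a b l has_real_derivative bump_sum s a b (bump_sum_deriv s l) x) (at x)"
proof (induction l)
  case Nil
  then show ?case by (simp add: bump_sum_def[abs_def] bump_sum_deriv_def)
next
  case (Cons PQ l)
  obtain P Q where PQ: "PQ = (P, Q)" by force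
  have d1: "((\<lambda>x. flat P (s * (x - a))) has_real_derivative flat (dflat P) (s * (x - a)) * s) (at x)"
    by (rule DERIV_chain2[OF DERIV_flat]) (auto intro!: derivative_eq_intros)
  have d2: "((\<lambda>x. flat Q (s * (b - x))) has_real_derivative flat (dflat Q) (s * (b - x)) * (- s)) (at x)"
    by (rule DERIV_chain2[OF DERIV_flat]) (auto intro!: derivative_eq_intros)
  have "((\<lambda>x. flat P (s * (x - a)) * flat Q (s * (b - x)) + bump_sum s a b l x) has_real_derivative
      flat (dflat P) (s * (x - a)) * s * flat Q (s * (b - x)) + flat (dflat Q) (s * (b - x)) * (- s) * flat P (s * (x - a))
      + bump_sum s a b (bump_sum_deriv s l) x) (at x)"
    by (intro DERIV_add DERIV_mult d1 d2 Cons.IH)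
  then show ?case
    unfolding PQ by (simp add: bump_sum_def[abs_def] bump_sum_deriv_def flat_smult flat_uminus algebra_simps)
qed

definition bump :: "real \<Rightarrow> real \<Rightarrow> nat \<Rightarrow> real \<Rightarrow> real" where
  "bump a b n x = flat 1 (real (Suc n) * (x - a)) * flat 1 (real (Suc n) * (b - x))"

lemma smooth_bump: "smooth (bump a b n)"
proof -
  let ?s = "real (Suc n)"
  have "bump a b n = bump_sum ?s a b [(1, 1)]" by (simp add: fun_eq_iff bump_def bump_sum_def)
  then show ?thesis unfolding smooth_def
    by (intro exI[of _ "\<lambda>k. bump_sum ?s a b ((bump_sum_deriv ?s ^^ k) [(1, 1)])"])
       (auto intro: DERIV_bump_sum)
qed

lemma flat_1_bounds: "0 \<le> flat 1 x" "flat 1 x \<le> 1"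
  by (auto simp: flat_def)

lemma bump_bounds: "0 \<le> bump a b n x" "bump a b n x \<le> 1"
  unfolding bump_def by (auto intro!: mult_le_one flat_1_bounds mult_nonneg_nonneg)

lemma bump_eq_0: "x \<notin> {a<..<b} \<Longrightarrow> bump a b n x = 0"
  by (auto simp: bump_def flat_def zero_less_mult_iff not_less)

lemma bump_tendsto: "(\<lambda>n. bump a b n x) \<longlonglongrightarrow> indicator {a<..<b} x"
proof (cases "x \<in> {a<..<b}")
  case True
  have *: "(\<lambda>n. flat 1 (real (Suc n) * y)) \<longlonglongrightarrow> 1" if "y > 0" for y :: real
  proof -
    have "(\<lambda>n. 1 / y * inverse (real (Suc n))) \<longlonglongrightarrow> 1 / y * 0"
      by (intro tendsto_mult tendsto_const LIMSEQ_inverse_real_of_nat)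
    then have "(\<lambda>n. exp (- (1 / y * inverse (real (Suc n))))) \<longlonglongrightarrow> exp (- (1 / y * 0))"
      by (intro tendsto_exp tendsto_minus)
    moreover have "flat 1 (real (Suc n) * y) = exp (- (1 / y * inverse (real (Suc n))))" for n
    proof -
      have "real (Suc n) * y > 0" using that by (intro mult_pos_pos) auto
      then show ?thesis using that by (simp add: flat_def field_simps)
    qed
    ultimately show ?thesis by simp
  qed
  have "(\<lambda>n. bump a b n x) \<longlonglongrightarrow> 1 * 1"
    unfolding bump_def using True by (intro tendsto_mult *) auto
  then show ?thesis using True by simp
qed (simp add: bump_eq_0)

lemma DERIV_smooth_continuous: "smooth f \<Longrightarrow> continuous_on A f"
  unfolding smooth_def
  by (metis DERIV_isCont continuous_at_imp_continuous_on)

lemma test_funI: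
  assumes "smooth \<phi>" "\<And>x. \<bar>x\<bar> > R \<Longrightarrow> \<phi> x = 0" shows "test_fun \<phi>"
  unfolding test_fun_def using smooth_higher_deriv[OF assms(1)] assms(2) by blast

lemma test_fun_bump: "test_fun (bump a b n)"
  by (rule test_funI[OF smooth_bump, of "max \<bar>a\<bar> \<bar>b\<bar>"]) (auto intro!: bump_eq_0)

section \<open>The lemma of du Bois-Reymond\<close>

definition loc_int :: "(real \<Rightarrow> real) \<Rightarrow> bool" where
  "loc_int f \<longleftrightarrow> f \<in> borel_measurable borel \<and> (\<forall>R. integrable lborel (\<lambda>x. indicator {-R..R} x * f x))"

lemma loc_int_measurable: "loc_int f \<Longrightarrow> f \<in> borel_measurable borel"
  by (simp add: loc_int_def)

lemma loc_int_mult: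
  assumes f: "loc_int f" and g: "g \<in> borel_measurable borel" "\<And>x. \<bar>g x\<bar> \<le> B" "\<And>x. \<bar>x\<bar> > R \<Longrightarrow> g x = 0"
  shows "integrable lborel (\<lambda>x. f x * g x)"
proof (rule Bochner_Integration.integrable_bound)
  show "integrable lborel (\<lambda>x. B * (indicator {-R..R} x * f x))"
    using f by (simp add: loc_int_def)
  have B: "B \<ge> 0" using g(2)[of 0] by simp
  have "\<bar>f x * g x\<bar> \<le> \<bar>B * (indicator {-R..R} x * f x)\<bar>" for x
  proof (cases "x \<in> {-R..R}")
    case True
    then show ?thesis using mult_right_mono[OF g(2)[of x], of "\<bar>f x\<bar>"] B by (simp add: abs_mult mult.commute)
  next
    case False
    then have "g x = 0" by (intro g(3)) auto
    then show ?thesis by simp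
  qed
  then show "AE x in lborel. norm (f x * g x) \<le> norm (B * (indicator {-R..R} x * f x))" by simp
qed (use f g in \<open>auto simp: loc_int_def\<close>)

lemma loc_int_diff: "loc_int f \<Longrightarrow> loc_int g \<Longrightarrow> loc_int (\<lambda>x. f x - g x)"
  unfolding loc_int_def by (auto simp: right_diff_distrib)

lemma loc_int_continuous: assumes "continuous_on UNIV f" shows "loc_int f"
proof -
  have "set_integrable lborel {-R..R} f" for R
    by (rule borel_integrable_atLeastAtMost') (rule continuous_on_subset[OF assms], simp)
  then show ?thesis unfolding loc_int_def set_integrable_def
    using borel_measurable_continuous_onI[OF assms] by simp
qed

lemma comp_supp_bounded:
  fixes g :: "real \<Rightarrow> real"
  assumes "continuous_on UNIV g" "\<And>x. \<bar>x\<bar> > R \<Longrightarrow> g x = 0"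
  obtains B where "\<And>x. \<bar>g x\<bar> \<le> B"
proof -
  have "compact (g ` {-R..R})" by (intro compact_continuous_image continuous_on_subset[OF assms(1)]) auto
  then have "bounded (g ` {-R..R})" by (rule compact_imp_bounded)
  then obtain B where B: "\<And>x. x \<in> {-R..R} \<Longrightarrow> \<bar>g x\<bar> \<le> B"
    unfolding bounded_iff ball_simps real_norm_def by blast
  have "\<bar>g x\<bar> \<le> max B 0" for x using B[of x] assms(2)[of x] by (cases "\<bar>x\<bar> > R") (auto simp: le_max_iff_disj abs_le_iff not_less)
  then show ?thesis by (rule that)
qed

lemma loc_int_mult_cont:
  assumes f: "loc_int f" and g: "continuous_on UNIV g" "\<And>x. \<bar>x\<bar> > R \<Longrightarrow> g x = 0"
  shows "integrable lborel (\<lambda>x. f x * g x)"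
proof -
  obtain B where "\<And>x. \<bar>g x\<bar> \<le> B" using comp_supp_bounded[OF g] by blast
  then show ?thesis using loc_int_mult[OF f borel_measurable_continuous_onI[OF g(1)] _ g(2)] by blast
qed

lemma test_fun_props:
  assumes "test_fun \<phi>"
  obtains R where "\<And>x. \<bar>x\<bar> > R \<Longrightarrow> \<phi> x = 0" "\<And>x. \<bar>x\<bar> > R \<Longrightarrow> deriv \<phi> x = 0"
    "continuous_on UNIV \<phi>" "continuous_on UNIV (deriv \<phi>)" "\<And>x. (\<phi> has_real_derivative deriv \<phi> x) (at x)"
proof -
  have d: "((deriv ^^ k) \<phi>) differentiable (at x)" for k x using assms by (simp add: test_fun_def)
  obtain R where R: "\<And>x. \<bar>x\<bar> > R \<Longrightarrow> \<phi> x = 0" using assms by (auto simp: test_fun_def)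
  have D: "(\<phi> has_real_derivative deriv \<phi> x) (at x)" for x
    using d[of 0 x] by (simp add: DERIV_deriv_iff_real_differentiable)
  have "deriv \<phi> x = 0" if "\<bar>x\<bar> > R" for x
  proof -
    have "open {x :: real. \<bar>x\<bar> > R}" by (intro open_Collect_less continuous_intros)
    then have "((\<lambda>x. 0) has_real_derivative deriv \<phi> x) (at x)"
      using has_field_derivative_transform_within_open[OF D[of x], of "{x. \<bar>x\<bar> > R}" "\<lambda>x. 0"] that R by auto
    then show ?thesis by (metis DERIV_const DERIV_unique)
  qed
  moreover have "continuous_on UNIV (deriv \<phi>)"
    using d[of 1] by (auto intro!: continuous_at_imp_continuous_on differentiable_imp_continuous_within)
  moreover have "continuous_on UNIV \<phi>"
    using D by (auto intro!: continuous_at_imp_continuous_on DERIV_isCont)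
  ultimately show ?thesis using that R D by blast
qed

lemma bump_measurable [measurable]: "bump a b n \<in> borel_measurable borel"
  by (intro borel_measurable_continuous_onI DERIV_smooth_continuous smooth_bump)

lemma bump_integral_tendsto:
  assumes "loc_int f"
  shows "(\<lambda>n. LINT x|lborel. f x * bump a b n x) \<longlonglongrightarrow> (LINT x|lborel. f x * indicator {a<..<b} x)"
proof (rule integral_dominated_convergence)
  define R where "R = max \<bar>a\<bar> \<bar>b\<bar>"
  have [measurable]: "f \<in> borel_measurable borel" using assms by (rule loc_int_measurable)
  show "integrable lborel (\<lambda>x. \<bar>indicator {-R..R} x * f x\<bar>)" using assms by (simp add: loc_int_def)
  show "AE x in lborel. (\<lambda>n. f x * bump a b n x) \<longlonglongrightarrow> f x * indicator {a<..<b} x"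
    by (intro AE_I2 tendsto_mult tendsto_const bump_tendsto)
  show "AE x in lborel. norm (f x * bump a b n x) \<le> \<bar>indicator {-R..R} x * f x\<bar>" for n
  proof (intro AE_I2)
    fix x
    show "norm (f x * bump a b n x) \<le> \<bar>indicator {-R..R} x * f x\<bar>"
    proof (cases "x \<in> {a<..<b}")
      case True
      then have "x \<in> {-R..R}" by (auto simp: R_def)
      then show ?thesis using bump_bounds[of a b n x] mult_left_mono[of "bump a b n x" 1 "\<bar>f x\<bar>"] by (simp add: abs_mult)
    qed (simp add: bump_eq_0)
  qed
qed (use assms in \<open>auto dest: loc_int_measurable\<close>)

lemma loc_int_const: "loc_int (\<lambda>x. c)"
  by (intro loc_int_continuous continuous_intros)

lemma loc_int_interval: "loc_int f \<Longrightarrow> integrable lborel (\<lambda>x. f x * indicator {a<..<b} x)"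
  by (rule loc_int_mult[where B = 1 and R = "max \<bar>a\<bar> \<bar>b\<bar>"]) (auto simp: indicator_def)

lemma borel_eq_intervals: "borel = sigma UNIV (range (\<lambda>(a, b). {a<..<b::real}))"
  unfolding borel_eq_box box_real by (simp add: case_prod_beta' image_def)

text \<open>Intervals are stable under intersection and generate the Borel sets, so a Dynkin
  argument extends the hypothesis to all Borel sets. It runs in bounded windows because f is only
  locally integrable.\<close>

lemma AE_zero_if_interval_integrals_zero:
  assumes f: "loc_int f" and 0: "\<And>a b. a < b \<Longrightarrow> (LINT x|lborel. f x * indicator {a<..<b} x) = 0"
  shows "AE x in lborel. f x = 0"
proof -
  have R: "AE x in lborel. f x * indicator {-R<..<R} x = 0" if "R > 0" for R :: real
  proof (rule sigma_finite_measure.density_zero[OF sigma_finite_lborel])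
    let ?g = "\<lambda>x. f x * indicator {-R<..<R} x"
    show int: "integrable lborel ?g" by (rule loc_int_interval[OF f])
    have intA: "set_integrable lborel A ?g" if "A \<in> sets borel" for A
      unfolding set_integrable_def using that int by (intro integrable_mult_indicator) auto
    fix A :: "real set" assume "A \<in> sets lborel"
    then have A: "A \<in> sigma_sets UNIV (range (\<lambda>(a, b). {a<..<b::real}))"
      by (simp add: borel_eq_intervals)
    have stable: "Int_stable (range (\<lambda>(a, b). {a<..<b::real}))"
    proof (rule Int_stableI)
      fix A B assume "A \<in> range (\<lambda>(a, b). {a<..<b::real})" "B \<in> range (\<lambda>(a, b). {a<..<b::real})"
      then obtain a b c d where "A = {a<..<b}" "B = {c<..<d}" by auto
      then have "A \<inter> B = {max a c<..<min b d}" by auto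
      then show "A \<inter> B \<in> range (\<lambda>(a, b). {a<..<b::real})" by auto
    qed
    have Pow: "range (\<lambda>(a, b). {a<..<b::real}) \<subseteq> Pow UNIV" by simp
    show "set_lebesgue_integral lborel A ?g = 0"
      using stable Pow A
    proof (induction rule: sigma_sets_induct_disjoint)
      case (basic A)
      then obtain a b where A: "A = {a<..<b}" by auto
      have "indicator A x *\<^sub>R ?g x = f x * indicator {max a (-R)<..<min b R} x" for x
        by (auto simp: A indicator_def)
      then have "set_lebesgue_integral lborel A ?g = (LINT x|lborel. f x * indicator {max a (-R)<..<min b R} x)"
        unfolding set_lebesgue_integral_def by (simp only:)
      also have "\<dots> = 0"
      proof (cases "max a (-R) < min b R")
        case False
        then have "{max a (-R)<..<min b R} = {}" by auto
        then show ?thesis by simp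
      qed (rule 0)
      finally show ?case .
    next
      case (compl A)
      have A: "A \<in> sets borel" using compl.hyps by (simp add: borel_eq_intervals)
      have "set_lebesgue_integral lborel (A \<union> (UNIV - A)) ?g = set_lebesgue_integral lborel A ?g + set_lebesgue_integral lborel (UNIV - A) ?g"
        using A by (intro set_integral_Un intA) auto
      moreover have "set_lebesgue_integral lborel (A \<union> (UNIV - A)) ?g = 0"
        using 0[of "-R" R] that by (simp add: set_lebesgue_integral_def)
      ultimately show ?case using compl by simp
    next
      case (union A)
      have A: "A i \<in> sets borel" for i using union.hyps by (auto simp: borel_eq_intervals)
      have "set_lebesgue_integral lborel (\<Union>i. A i) ?g = (\<Sum>i. set_lebesgue_integral lborel (A i) ?g)"
        using A union.hyps by (intro lebesgue_integral_countable_add intA sets.countable_UN) (auto simp: disjoint_family_on_def)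
      then show ?case using union by simp
    qed (simp add: set_lebesgue_integral_def)
  qed
  have "AE x in lborel. \<forall>n. f x * indicator {-real (Suc n)<..<real (Suc n)} x = 0"
    unfolding AE_all_countable using R by (intro allI R) simp
  then show ?thesis
  proof eventually_elim
    fix x assume *: "\<forall>n. f x * indicator {-real (Suc n)<..<real (Suc n)} x = 0"
    obtain n where "\<bar>x\<bar> < real n" using reals_Archimedean2 by blast
    then have "x \<in> {-real (Suc n)<..<real (Suc n)}" by auto
    then show "f x = 0" using *[rule_format, of n] by simp
  qed
qed

lemma fundamental_lemma:
  assumes f: "loc_int f" and 0: "\<And>\<phi>. test_fun \<phi> \<Longrightarrow> (LINT x|lborel. f x * \<phi> x) = 0"
  shows "AE x in lborel. f x = 0"
proof (rule AE_zero_if_interval_integrals_zero[OF f])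
  fix a b :: real
  show "(LINT x|lborel. f x * indicator {a<..<b} x) = 0"
    using bump_integral_tendsto[OF f, of a b] 0[OF test_fun_bump] by (simp add: LIMSEQ_const_iff)
qed

text \<open>The primitive starting at 0 left of the support returns to 0 on the right because the
  integral vanishes.\<close>

lemma test_fun_antiderivative:
  assumes \<psi>: "smooth \<psi>" "\<And>x. \<bar>x\<bar> > R \<Longrightarrow> \<psi> x = 0" and 0: "(LINT x|lborel. \<psi> x) = 0"
  obtains \<phi> where "test_fun \<phi>" "\<And>x. deriv \<phi> x = \<psi> x"
proof -
  define R' where "R' = \<bar>R\<bar> + 1"
  have cont: "continuous_on A \<psi>" for A using \<psi>(1) by (rule DERIV_smooth_continuous)
  obtain F where F: "\<And>x. (F has_vector_derivative \<psi> x) (at x)"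
    using einterval_antiderivative[of "-\<infinity>" "\<infinity>" \<psi>] cont[of UNIV] by (auto simp: continuous_on_eq_continuous_at)
  define \<phi> where "\<phi> x = F x - F (- R')" for x
  have D: "(\<phi> has_real_derivative \<psi> x) (at x)" for x
    unfolding \<phi>_def[abs_def] using F[of x] by (auto intro!: derivative_eq_intros simp: has_real_derivative_iff_has_vector_derivative)
  have const: "\<phi> y = \<phi> x" if "x < y" "\<And>z. x < z \<Longrightarrow> z < y \<Longrightarrow> \<psi> z = 0" for x y
  proof -
    have "\<exists>z>x. z < y \<and> \<phi> y - \<phi> x = (y - x) * \<psi> z" by (rule MVT2[OF that(1)]) (rule D)
    then show ?thesis using that(2) by auto
  qed
  have "(LINT x|lborel. indicator {-R'..R'} x *\<^sub>R \<psi> x) = \<phi> R' - \<phi> (- R')"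
    using D by (intro integral_FTC_Icc cont) (auto simp: R'_def has_real_derivative_iff_has_vector_derivative intro: has_vector_derivative_at_within)
  moreover have "indicator {-R'..R'} x *\<^sub>R \<psi> x = \<psi> x" for x
    using \<psi>(2)[of x] by (cases "\<bar>x\<bar> > R") (auto simp: indicator_def R'_def)
  ultimately have "\<phi> R' - \<phi> (- R') = 0" using 0 by (simp only:)
  then have "\<phi> R' = 0" by (simp add: \<phi>_def)
  have "\<phi> x = 0" if "\<bar>x\<bar> > R'" for x
  proof (cases "x > 0")
    case True
    then have "\<phi> x = \<phi> R'" using that by (intro const \<psi>(2)) (auto simp: R'_def)
    then show ?thesis using \<open>\<phi> R' = 0\<close> by simp
  next
    case False
    then have "\<phi> (- R') = \<phi> x" using that by (intro const \<psi>(2)) (auto simp: R'_def)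
    then show ?thesis by (simp add: \<phi>_def)
  qed
  then have "test_fun \<phi>" using smooth_antiderivative[OF \<psi>(1) D] by (rule test_funI[rotated])
  then show ?thesis using that D DERIV_imp_deriv by blast
qed

text \<open>The mean c of f over (0, 1) is the candidate. A combination of two bumps, on (a, b) and
  on (0, 1), with integral zero is the derivative of a test function; sharpening the bumps shows
  that f has mean c over every interval.\<close>

lemma du_Bois_Reymond:
  assumes f: "loc_int f" and 0: "\<And>\<phi>. test_fun \<phi> \<Longrightarrow> (LINT x|lborel. f x * deriv \<phi> x) = 0"
  obtains c where "AE x in lborel. f x = c"
proof
  define c where "c = (LINT x|lborel. f x * indicator {0<..<1} x)"
  have bint: "integrable lborel (\<lambda>x. g x * bump a b n x)" if "loc_int g" for g a b n
    by (rule loc_int_mult_cont[OF that DERIV_smooth_continuous[OF smooth_bump], of "max \<bar>a\<bar> \<bar>b\<bar>"]) (auto intro!: bump_eq_0)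
  have eq: "(LINT x|lborel. f x * indicator {a<..<b} x) = c * (b - a)" if "a < b" for a b
  proof -
    let ?I = "\<lambda>g a b n. LINT x|lborel. g x * bump a b n x"
    have "?I (\<lambda>_. 1) 0 1 n * ?I f a b n - ?I (\<lambda>_. 1) a b n * ?I f 0 1 n = 0" for n
    proof -
      define \<psi> where "\<psi> x = ?I (\<lambda>_. 1) 0 1 n * bump a b n x - ?I (\<lambda>_. 1) a b n * bump 0 1 n x" for x
      have "smooth \<psi>" unfolding \<psi>_def[abs_def] by (intro smooth_lincomb smooth_bump)
      moreover have "\<psi> x = 0" if "\<bar>x\<bar> > max (max \<bar>a\<bar> \<bar>b\<bar>) 1" for x
        using that unfolding \<psi>_def by (subst (1 2) bump_eq_0) auto
      moreover have "(LINT x|lborel. \<psi> x) = 0"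
        unfolding \<psi>_def using bint[OF loc_int_const[of 1]] by (subst Bochner_Integration.integral_diff) auto
      ultimately obtain \<phi> where \<phi>: "test_fun \<phi>" "\<And>x. deriv \<phi> x = \<psi> x" using test_fun_antiderivative[of \<psi>] by blast
      have "(LINT x|lborel. f x * \<psi> x) = 0" using 0[OF \<phi>(1)] by (simp add: \<phi>(2))
      moreover have "(\<lambda>x. f x * \<psi> x) = (\<lambda>x. ?I (\<lambda>_. 1) 0 1 n * (f x * bump a b n x) - ?I (\<lambda>_. 1) a b n * (f x * bump 0 1 n x))"
        by (simp add: \<psi>_def fun_eq_iff algebra_simps)
      ultimately show ?thesis using bint[OF f] by (simp add: Bochner_Integration.integral_diff)
    qed
    moreover have "(\<lambda>n. ?I (\<lambda>_. 1) 0 1 n * ?I f a b n - ?I (\<lambda>_. 1) a b n * ?I f 0 1 n) \<longlonglongrightarrow>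
        (LINT x|lborel. 1 * indicator {0<..<1::real} x) * (LINT x|lborel. f x * indicator {a<..<b} x)
        - (LINT x|lborel. 1 * indicator {a<..<b} x) * c"
      unfolding c_def by (intro tendsto_diff tendsto_mult bump_integral_tendsto f loc_int_const)
    ultimately show ?thesis using that by (simp add: LIMSEQ_const_iff)
  qed
  have "AE x in lborel. f x - c = 0"
  proof (rule AE_zero_if_interval_integrals_zero[OF loc_int_diff[OF f loc_int_const]])
    fix a b :: real assume "a < b"
    have "(LINT x|lborel. (f x - c) * indicator {a<..<b} x) = (LINT x|lborel. f x * indicator {a<..<b} x) - (LINT x|lborel. c * indicator {a<..<b} x)"
      unfolding left_diff_distrib by (intro Bochner_Integration.integral_diff loc_int_interval f loc_int_const)
    then show "(LINT x|lborel. (f x - c) * indicator {a<..<b} x) = 0" using eq[OF \<open>a < b\<close>] \<open>a < b\<close> by simp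
  qed
  then show "AE x in lborel. f x = c" by simp
qed

section \<open>Weak derivatives\<close>

lemma wt_lower_bound: obtains d where "d > 0" "\<And>x. x \<in> {-R..R} \<Longrightarrow> wt \<kappa> x \<ge> d"
proof (cases "R \<ge> 0")
  case True
  obtain y where "y \<in> {-R..R}" "\<And>x. x \<in> {-R..R} \<Longrightarrow> wt \<kappa> y \<le> wt \<kappa> x"
    using continuous_attains_inf[of "{-R..R}" "wt \<kappa>"] True continuous_on_wt by auto
  then show ?thesis using that[of "wt \<kappa> y"] wt_pos by blast
qed (use that[of 1] in auto)

lemma L2_iff: "u \<in> L2 \<kappa> \<longleftrightarrow> u \<in> borel_measurable borel \<and> integrable lborel (\<lambda>x. (u x)\<^sup>2 * wt \<kappa> x)"
  unfolding L2_def using integrable_nu_iff[of "\<lambda>x. (u x)\<^sup>2" \<kappa>] by auto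

text \<open>On a bounded interval the weight is bounded away from 0, and
  \<open>|u| \<le> 1 + u^2\<close>.\<close>

lemma L2_loc_int: assumes "u \<in> L2 \<kappa>" shows "loc_int u"
  unfolding loc_int_def
proof (intro conjI allI)
  show m: "u \<in> borel_measurable borel" using assms by (simp add: L2_iff)
  fix R
  obtain d where d: "d > 0" "\<And>x. x \<in> {-R..R} \<Longrightarrow> wt \<kappa> x \<ge> d" using wt_lower_bound by blast
  show "integrable lborel (\<lambda>x. indicator {-R..R} x * u x)"
  proof (rule Bochner_Integration.integrable_bound)
    show "integrable lborel (\<lambda>x. (wt \<kappa> x + (u x)\<^sup>2 * wt \<kappa> x) / d)"
      using assms by (intro integrable_divide Bochner_Integration.integrable_add integrable_wt) (simp add: L2_iff)
    show "AE x in lborel. norm (indicator {-R..R} x * u x) \<le> norm ((wt \<kappa> x + (u x)\<^sup>2 * wt \<kappa> x) / d)"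
    proof (intro AE_I2)
      fix x
      show "norm (indicator {-R..R} x * u x) \<le> norm ((wt \<kappa> x + (u x)\<^sup>2 * wt \<kappa> x) / d)"
      proof (cases "x \<in> {-R..R}")
        case True
        have "0 \<le> (\<bar>u x\<bar> - 1/2)\<^sup>2" by simp
        then have "\<bar>u x\<bar> \<le> 1 + (u x)\<^sup>2" unfolding power2_diff by (simp add: power_divide)
        then have "\<bar>u x\<bar> * d \<le> (1 + (u x)\<^sup>2) * wt \<kappa> x" using d(1) d(2)[OF True] by (intro mult_mono) auto
        then have "\<bar>u x\<bar> \<le> (wt \<kappa> x + (u x)\<^sup>2 * wt \<kappa> x) / d" using d(1) by (simp add: field_simps)
        then show ?thesis using True d(1) by simp
      qed simp
    qed
  qed (use m in measurable)
qed

lemma L2_diff: assumes "u \<in> L2 \<kappa>" "v \<in> L2 \<kappa>" shows "(\<lambda>x. u x - v x) \<in> L2 \<kappa>"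
  unfolding L2_iff
proof
  show m: "(\<lambda>x. u x - v x) \<in> borel_measurable borel" using assms by (auto simp: L2_iff)
  show "integrable lborel (\<lambda>x. (u x - v x)\<^sup>2 * wt \<kappa> x)"
  proof (rule Bochner_Integration.integrable_bound)
    show "integrable lborel (\<lambda>x. 2 * ((u x)\<^sup>2 * wt \<kappa> x) + 2 * ((v x)\<^sup>2 * wt \<kappa> x))"
      using assms by (auto simp: L2_iff)
    have "(u x - v x)\<^sup>2 * wt \<kappa> x \<le> (2 * (u x)\<^sup>2 + 2 * (v x)\<^sup>2) * wt \<kappa> x" for x
    proof (intro mult_right_mono)
      have "0 \<le> (u x + v x)\<^sup>2" by simp
      then show "(u x - v x)\<^sup>2 \<le> 2 * (u x)\<^sup>2 + 2 * (v x)\<^sup>2" by (simp add: power2_sum power2_diff)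
    qed simp
    then show "AE x in lborel. norm ((u x - v x)\<^sup>2 * wt \<kappa> x) \<le> norm (2 * ((u x)\<^sup>2 * wt \<kappa> x) + 2 * ((v x)\<^sup>2 * wt \<kappa> x))"
      by (simp add: algebra_simps)
  qed (use m in measurable)
qed

lemma L2_poly: "poly P \<in> L2 \<kappa>"
  using integrable_poly_wt[of "P * P" \<kappa>] by (simp add: L2_iff power2_eq_square)

lemma weak_deriv_diff:
  assumes "loc_int u" "loc_int v" "loc_int g" "loc_int h" "weak_deriv u g" "weak_deriv v h"
  shows "weak_deriv (\<lambda>x. u x - v x) (\<lambda>x. g x - h x)"
  unfolding weak_deriv_def
proof (intro allI impI)
  fix \<phi> assume \<phi>: "test_fun \<phi>"
  then obtain R where R: "\<And>x. \<bar>x\<bar> > R \<Longrightarrow> \<phi> x = 0" "\<And>x. \<bar>x\<bar> > R \<Longrightarrow> deriv \<phi> x = 0"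
    "continuous_on UNIV \<phi>" "continuous_on UNIV (deriv \<phi>)" by (rule test_fun_props) blast
  have "(LINT x|lborel. (u x - v x) * deriv \<phi> x) = (LINT x|lborel. u x * deriv \<phi> x) - (LINT x|lborel. v x * deriv \<phi> x)"
    unfolding left_diff_distrib by (intro Bochner_Integration.integral_diff loc_int_mult_cont[OF _ R(4,2)] assms)
  moreover have "(LINT x|lborel. (g x - h x) * \<phi> x) = (LINT x|lborel. g x * \<phi> x) - (LINT x|lborel. h x * \<phi> x)"
    unfolding left_diff_distrib by (intro Bochner_Integration.integral_diff loc_int_mult_cont[OF _ R(3,1)] assms)
  ultimately show "(LINT x|lborel. (u x - v x) * deriv \<phi> x) = - (LINT x|lborel. (g x - h x) * \<phi> x)"
    using assms(5,6) \<phi> by (simp add: weak_deriv_def)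
qed

lemma weak_deriv_unique:
  assumes "loc_int g" "loc_int h" "weak_deriv u g" "weak_deriv u h"
  shows "AE x in lborel. g x = h x"
proof -
  have "AE x in lborel. g x - h x = 0"
  proof (rule fundamental_lemma[OF loc_int_diff[OF assms(1,2)]])
    fix \<phi> assume \<phi>: "test_fun \<phi>"
    then obtain R where R: "\<And>x. \<bar>x\<bar> > R \<Longrightarrow> \<phi> x = 0" "continuous_on UNIV \<phi>" by (rule test_fun_props) blast
    have "(LINT x|lborel. (g x - h x) * \<phi> x) = (LINT x|lborel. g x * \<phi> x) - (LINT x|lborel. h x * \<phi> x)"
      unfolding left_diff_distrib by (intro Bochner_Integration.integral_diff loc_int_mult_cont[OF _ R(2,1)] assms)
    moreover have "- (LINT x|lborel. g x * \<phi> x) = - (LINT x|lborel. h x * \<phi> x)"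
      using assms(3,4) \<phi> by (simp add: weak_deriv_def)
    ultimately show "(LINT x|lborel. (g x - h x) * \<phi> x) = 0" by simp
  qed
  then show ?thesis by simp
qed

lemma integral_deriv_comp_supp:
  fixes F :: "real \<Rightarrow> real"
  assumes "\<And>x. (F has_real_derivative f x) (at x)" "continuous_on UNIV f"
    and "\<And>x. \<bar>x\<bar> > R \<Longrightarrow> F x = 0" "\<And>x. \<bar>x\<bar> > R \<Longrightarrow> f x = 0"
  shows "(LINT x|lborel. indicator {t<..} x * f x) = - F t" and "(LINT x|lborel. indicator {..<t} x * f x) = F t"
    and "(LINT x|lborel. f x) = 0"
proof -
  define S where "S = max \<bar>R\<bar> \<bar>t\<bar> + 1"
  have [measurable]: "f \<in> borel_measurable borel" by (rule borel_measurable_continuous_onI[OF assms(2)])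
  have FTC: "(LINT x|lborel. indicator {a..b} x *\<^sub>R f x) = F b - F a" if "a \<le> b" for a b
  proof (rule integral_FTC_Icc[OF that])
    show "(F has_vector_derivative f x) (at x within {a..b})" for x
      using assms(1)[of x] by (simp add: has_real_derivative_iff_has_vector_derivative has_vector_derivative_at_within)
  qed (rule continuous_on_subset[OF assms(2)], simp)
  have "S > R" "S > t" "- S < t" unfolding S_def by linarith+
  then have S: "F S = 0" "F (- S) = 0" "t \<le> S" "- S \<le> t" "- S \<le> S" using assms(3)[of S] assms(3)[of "- S"] by auto
  have "AE x in lborel. indicator {t<..} x * f x = indicator {t..S} x *\<^sub>R f x"
    using AE_lborel_singleton[of t]
  proof eventually_elim
    fix x assume "x \<noteq> t"
    then show "indicator {t<..} x * f x = indicator {t..S} x *\<^sub>R f x"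
    proof (cases "\<bar>x\<bar> > R")
      case False
      then have "x \<le> S" by (simp add: S_def)
      with \<open>x \<noteq> t\<close> show ?thesis by (simp add: indicator_def)
    qed (simp add: assms(4))
  qed
  then have "(LINT x|lborel. indicator {t<..} x * f x) = (LINT x|lborel. indicator {t..S} x *\<^sub>R f x)"
    by (intro integral_cong_AE) measurable
  also have "\<dots> = - F t" using FTC[of t S] S by simp
  finally show "(LINT x|lborel. indicator {t<..} x * f x) = - F t" .
  have "AE x in lborel. indicator {..<t} x * f x = indicator {-S..t} x *\<^sub>R f x"
    using AE_lborel_singleton[of t]
  proof eventually_elim
    fix x assume "x \<noteq> t"
    then show "indicator {..<t} x * f x = indicator {-S..t} x *\<^sub>R f x"
    proof (cases "\<bar>x\<bar> > R")
      case False
      then have "x \<ge> - S" unfolding S_def by linarith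
      with \<open>x \<noteq> t\<close> show ?thesis by (simp add: indicator_def)
    qed (simp add: assms(4))
  qed
  then have "(LINT x|lborel. indicator {..<t} x * f x) = (LINT x|lborel. indicator {-S..t} x *\<^sub>R f x)"
    by (intro integral_cong_AE) measurable
  also have "\<dots> = F t" using FTC[of "-S" t] S by simp
  finally show "(LINT x|lborel. indicator {..<t} x * f x) = F t" .
  have "indicator {-S..S} x *\<^sub>R f x = f x" for x
  proof (cases "\<bar>x\<bar> > R")
    case False
    then have "x \<in> {-S..S}" by (auto simp: S_def)
    then show ?thesis by simp
  qed (simp add: assms(4))
  then have "(LINT x|lborel. f x) = (LINT x|lborel. indicator {-S..S} x *\<^sub>R f x)" by (simp only:)
  also have "\<dots> = 0" using FTC[of "-S" S] S by simp
  finally show "(LINT x|lborel. f x) = 0" .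
qed

lemma weak_deriv_poly: "weak_deriv (poly P) (poly (pderiv P))"
  unfolding weak_deriv_def
proof (intro allI impI)
  fix \<phi> assume "test_fun \<phi>"
  then obtain R where R: "\<And>x. \<bar>x\<bar> > R \<Longrightarrow> \<phi> x = 0" "\<And>x. \<bar>x\<bar> > R \<Longrightarrow> deriv \<phi> x = 0"
    "continuous_on UNIV \<phi>" "continuous_on UNIV (deriv \<phi>)" "\<And>x. (\<phi> has_real_derivative deriv \<phi> x) (at x)"
    by (rule test_fun_props) blast
  have li: "loc_int (poly Q)" for Q by (intro loc_int_continuous continuous_intros)
  have "(LINT x|lborel. poly (pderiv P) x * \<phi> x + deriv \<phi> x * poly P x) = 0"
  proof (rule integral_deriv_comp_supp(3))
    show "((\<lambda>x. poly P x * \<phi> x) has_real_derivative poly (pderiv P) x * \<phi> x + deriv \<phi> x * poly P x) (at x)" for x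
      by (rule DERIV_mult[OF poly_DERIV R(5)])
    show "continuous_on UNIV (\<lambda>x. poly (pderiv P) x * \<phi> x + deriv \<phi> x * poly P x)"
      by (intro continuous_intros R)
  qed (use R(1,2) in auto)
  moreover have "(LINT x|lborel. poly (pderiv P) x * \<phi> x + deriv \<phi> x * poly P x) =
      (LINT x|lborel. poly (pderiv P) x * \<phi> x) + (LINT x|lborel. poly P x * deriv \<phi> x)"
    unfolding mult.commute[of "deriv \<phi> _"]
    by (intro Bochner_Integration.integral_add loc_int_mult_cont[OF li R(3,1)] loc_int_mult_cont[OF li R(4,2)])
  ultimately show "(LINT x|lborel. poly P x * deriv \<phi> x) = - (LINT x|lborel. poly (pderiv P) x * \<phi> x)" by linarith
qed

text \<open>\<open>prim g x\<close> is the oriented integral of \<open>g\<close> from 0 to \<open>x\<close>.\<close>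
definition ker :: "real \<Rightarrow> real \<Rightarrow> real" where
  "ker x t = indicator {0<..<x} t - indicator {x<..<0} t"

definition prim :: "(real \<Rightarrow> real) \<Rightarrow> real \<Rightarrow> real" where
  "prim g x = (LINT t|lborel. ker x t * g t)"

lemma measurable_ker [measurable]: "(\<lambda>(x, t). ker x t) \<in> borel_measurable (borel \<Otimes>\<^sub>M borel)"
proof -
  have *: "ker x t = (if 0 < t \<and> t < x then 1 else 0) - (if x < t \<and> t < 0 then 1 else 0)" for x t
    by (simp add: ker_def indicator_def)
  show ?thesis unfolding * by measurable
qed

lemma measurable_ker1 [measurable]: "ker x \<in> borel_measurable borel"
  unfolding ker_def[abs_def] by measurable

lemma abs_ker_le: "\<bar>ker x t\<bar> \<le> 1"
  by (auto simp: ker_def indicator_def)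

lemma ker_eq_0: "\<bar>t\<bar> > \<bar>x\<bar> \<Longrightarrow> ker x t = 0"
  by (auto simp: ker_def indicator_def)

lemma prim_integrable: "loc_int g \<Longrightarrow> integrable lborel (\<lambda>t. ker x t * g t)"
  using loc_int_mult[of g "ker x" 1 "\<bar>x\<bar>"] abs_ker_le ker_eq_0 by (simp add: mult.commute)

lemma measurable_prim [measurable]:
  assumes [measurable]: "g \<in> borel_measurable borel" shows "prim g \<in> borel_measurable borel"
  unfolding prim_def[abs_def] by measurable

lemma abs_prim_le:
  assumes "loc_int g" "\<bar>x\<bar> \<le> R" shows "\<bar>prim g x\<bar> \<le> (LINT t|lborel. \<bar>indicator {-R..R} t * g t\<bar>)"
proof -
  have "\<bar>prim g x\<bar> \<le> (LINT t|lborel. \<bar>ker x t * g t\<bar>)"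
    unfolding prim_def by (rule integral_abs_bound)
  also have "\<dots> \<le> (LINT t|lborel. \<bar>indicator {-R..R} t * g t\<bar>)"
  proof (intro integral_mono integrable_abs prim_integrable[OF assms(1)])
    show "integrable lborel (\<lambda>t. indicator {-R..R} t * g t)" using assms(1) by (simp add: loc_int_def)
    show "\<bar>ker x t * g t\<bar> \<le> \<bar>indicator {-R..R} t * g t\<bar>" for t
      using assms(2) by (auto simp: ker_def indicator_def)
  qed
  finally show ?thesis .
qed

lemma loc_int_prim: assumes "loc_int g" shows "loc_int (prim g)"
  unfolding loc_int_def
proof (intro conjI allI)
  show m: "prim g \<in> borel_measurable borel" using loc_int_measurable[OF assms] by measurable
  fix R
  let ?B = "LINT t|lborel. \<bar>indicator {-R..R} t * g t\<bar>"
  show "integrable lborel (\<lambda>x. indicator {-R..R} x * prim g x)"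
  proof (rule Bochner_Integration.integrable_bound)
    show "integrable lborel (\<lambda>x. ?B * (indicator {-R..R} x * 1))"
      using loc_int_const[of 1] unfolding loc_int_def by (intro integrable_mult_right) blast
    show "AE x in lborel. norm (indicator {-R..R} x * prim g x) \<le> norm (?B * (indicator {-R..R} x * 1))"
      using abs_prim_le[OF assms] by (auto simp: indicator_def intro: order_trans[OF _ abs_ge_self])
  qed (use m in measurable)
qed

text \<open>By Fubini the integral over x comes first: for t > 0 the kernel selects x > t, for t < 0
  it is minus the indicator of x < t, and both give \<open>- \<phi> t\<close>. The point t = 0 is a
  null set.\<close>

lemma weak_deriv_prim: assumes g: "loc_int g" shows "weak_deriv (prim g) g"
  unfolding weak_deriv_def
proof (intro allI impI)
  fix \<phi> assume "test_fun \<phi>"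
  then obtain R where R: "\<And>x. \<bar>x\<bar> > R \<Longrightarrow> \<phi> x = 0" "\<And>x. \<bar>x\<bar> > R \<Longrightarrow> deriv \<phi> x = 0"
    "continuous_on UNIV \<phi>" "continuous_on UNIV (deriv \<phi>)" "\<And>x. (\<phi> has_real_derivative deriv \<phi> x) (at x)"
    by (rule test_fun_props) blast
  have [measurable]: "g \<in> borel_measurable borel" by (rule loc_int_measurable[OF g])
  have [measurable]: "deriv \<phi> \<in> borel_measurable borel" by (rule borel_measurable_continuous_onI[OF R(4)])
  let ?f = "\<lambda>x t. ker x t * g t * deriv \<phi> x"
  have kint: "integrable lborel (\<lambda>t. ?f x t)" for x
    using prim_integrable[OF g, of x] by (rule integrable_mult_left)
  have int: "integrable (lborel \<Otimes>\<^sub>M lborel) (case_prod ?f)"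
  proof (rule lborel_pair.Fubini_integrable)
    show "case_prod ?f \<in> borel_measurable (lborel \<Otimes>\<^sub>M lborel)" by measurable
    show "AE x in lborel. integrable lborel (\<lambda>y. case (x, y) of (x, t) \<Rightarrow> ?f x t)" using kint by simp
    show "integrable lborel (\<lambda>x. LINT y|lborel. norm (case (x, y) of (x, t) \<Rightarrow> ?f x t))"
    proof (rule Bochner_Integration.integrable_bound)
      let ?B = "LINT t|lborel. \<bar>indicator {-R..R} t * g t\<bar>"
      show "integrable lborel (\<lambda>x. ?B * \<bar>1 * deriv \<phi> x\<bar>)"
        by (intro integrable_mult_right integrable_abs loc_int_mult_cont[OF loc_int_const R(4,2)])
      show "AE x in lborel. norm (LINT y|lborel. norm (case (x, y) of (x, t) \<Rightarrow> ?f x t)) \<le> norm (?B * \<bar>1 * deriv \<phi> x\<bar>)"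
      proof (intro AE_I2)
        fix x
        show "norm (LINT y|lborel. norm (case (x, y) of (x, t) \<Rightarrow> ?f x t)) \<le> norm (?B * \<bar>1 * deriv \<phi> x\<bar>)"
        proof (cases "\<bar>x\<bar> > R")
          case False
          have "(LINT t|lborel. \<bar>ker x t * g t\<bar>) \<le> ?B"
          proof (intro integral_mono integrable_abs prim_integrable[OF g])
            show "integrable lborel (\<lambda>t. indicator {-R..R} t * g t)" using g by (simp add: loc_int_def)
            show "\<bar>ker x t * g t\<bar> \<le> \<bar>indicator {-R..R} t * g t\<bar>" for t
              using False by (auto simp: ker_def indicator_def)
          qed
          then have "(LINT t|lborel. \<bar>ker x t * g t\<bar>) * \<bar>deriv \<phi> x\<bar> \<le> ?B * \<bar>deriv \<phi> x\<bar>"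
            by (rule mult_right_mono) simp
          then show ?thesis by (simp add: abs_mult abs_of_nonneg integral_nonneg_AE)
        qed (simp add: R)
      qed
    qed measurable
  qed
  have "(LINT x|lborel. prim g x * deriv \<phi> x) = (LINT x|lborel. LINT t|lborel. ?f x t)"
    by (simp add: prim_def)
  also have "\<dots> = (LINT t|lborel. LINT x|lborel. ?f x t)"
    using lborel_pair.Fubini_integral[OF int] by simp
  also have "\<dots> = (LINT t|lborel. - (g t * \<phi> t))"
  proof (rule integral_cong_AE)
    show "AE t in lborel. (LINT x|lborel. ?f x t) = - (g t * \<phi> t)"
      using AE_lborel_singleton[of 0]
    proof eventually_elim
      fix t :: real assume "t \<noteq> 0"
      then consider "t > 0" | "t < 0" by linarith
      then have "(LINT x|lborel. ker x t * deriv \<phi> x) = - \<phi> t"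
      proof cases
        case 1
        then have "ker x t = indicator {t<..} x" for x by (auto simp: ker_def indicator_def)
        then show ?thesis using integral_deriv_comp_supp(1)[OF R(5,4,1,2)] by simp
      next
        case 2
        then have "ker x t = - indicator {..<t} x" for x by (auto simp: ker_def indicator_def)
        then show ?thesis using integral_deriv_comp_supp(2)[OF R(5,4,1,2)] by simp
      qed
      moreover have "(LINT x|lborel. ?f x t) = g t * (LINT x|lborel. ker x t * deriv \<phi> x)"
        unfolding integral_mult_right_zero[symmetric] by (simp add: mult_ac)
      ultimately show "(LINT x|lborel. ?f x t) = - (g t * \<phi> t)" by simp
    qed
    have [measurable]: "\<phi> \<in> borel_measurable borel" by (rule borel_measurable_continuous_onI[OF R(3)])
    show "(\<lambda>t. - (g t * \<phi> t)) \<in> borel_measurable lborel" by measurable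
  qed measurable
  finally show "(LINT x|lborel. prim g x * deriv \<phi> x) = - (LINT x|lborel. g x * \<phi> x)" by simp
qed

lemma weak_deriv_eq_prim:
  assumes "loc_int w" "loc_int g" "weak_deriv w g"
  obtains c where "AE x in lborel. w x = prim g x + c"
proof -
  have "weak_deriv (\<lambda>x. w x - prim g x) (\<lambda>x. g x - g x)"
    using assms by (intro weak_deriv_diff loc_int_prim weak_deriv_prim)
  then have "\<And>\<phi>. test_fun \<phi> \<Longrightarrow> (LINT x|lborel. (w x - prim g x) * deriv \<phi> x) = 0"
    by (simp add: weak_deriv_def)
  then obtain c where "AE x in lborel. w x - prim g x = c"
    using du_Bois_Reymond[OF loc_int_diff[OF assms(1) loc_int_prim[OF assms(2)]]] by blast
  then have "AE x in lborel. w x = prim g x + c" by eventually_elim (simp add: algebra_simps)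
  then show ?thesis by (rule that)
qed

section \<open>The Poincare inequality and the closure\<close>

lemma V_diff: "V \<kappa> t - V \<kappa> x = - ((x\<^sup>2 - t\<^sup>2) * (x\<^sup>2 + t\<^sup>2 - 2 * \<kappa>) / 4)"
  by (simp add: V_def power2_eq_square power4_eq_xxxx field_simps)

lemma abs_ker_reflect: "\<bar>ker (- x) (- t)\<bar> = \<bar>ker x t\<bar>"
  by (auto simp: ker_def indicator_def)

lemma integrable_abs_ker_div_wt: "integrable lborel (\<lambda>t. \<bar>ker x t\<bar> / wt \<kappa> t)"
proof -
  have "loc_int (\<lambda>t. 1 / wt \<kappa> t)"
    by (intro loc_int_continuous continuous_intros) auto
  from loc_int_mult[OF this, of "\<lambda>t. \<bar>ker x t\<bar>" 1 "\<bar>x\<bar>"] show ?thesis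
    using abs_ker_le[of x] ker_eq_0[of x] by simp
qed

text \<open>For 0 < t < x the factorisation in \<open>V_diff\<close> gives
  \<open>V x - V t \<ge> (x - t) x^3 / 8\<close>, since \<open>x^2 \<ge> 4 |\<kappa>|\<close> leaves
  half of \<open>x^2\<close>. The resulting exponential integral is at most
  \<open>8 / x^3\<close>.\<close>

lemma wt_quotient_integral_far:
  assumes x: "x > 0" "x\<^sup>2 \<ge> 4 * \<bar>\<kappa>\<bar> + 1"
  shows "(LINT t|lborel. \<bar>ker x t\<bar> / wt \<kappa> t) * wt \<kappa> x \<le> 16 / (1 + x\<^sup>2)"
proof -
  define a where "a = x ^ 3 / 8"
  have a: "a > 0" using x by (simp add: a_def)
  define G where "G t = exp (- ((x - t) * a)) / a" for t
  have G: "(G has_real_derivative exp (- ((x - t) * a))) (at t)" for t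
    unfolding G_def[abs_def] using a by (auto intro!: derivative_eq_intros)
  have FTC: "has_bochner_integral lborel (\<lambda>t. indicator {0..x} t *\<^sub>R exp (- ((x - t) * a))) (G x - G 0)"
  proof (rule has_bochner_integral_FTC_Icc)
    show "(G has_vector_derivative exp (- ((x - t) * a))) (at t within {0..x})" for t
      using G[of t] by (simp add: has_real_derivative_iff_has_vector_derivative has_vector_derivative_at_within)
    show "continuous_on {0..x} (\<lambda>t. exp (- ((x - t) * a)))" by (intro continuous_intros)
  qed (use x in simp)
  have pt: "\<bar>ker x t\<bar> / wt \<kappa> t * wt \<kappa> x \<le> indicator {0..x} t *\<^sub>R exp (- ((x - t) * a))" for t
  proof (cases "t \<in> {0<..<x}")
    case True
    have "(x - t) * a \<le> (x\<^sup>2 - t\<^sup>2) * (x\<^sup>2 + t\<^sup>2 - 2 * \<kappa>) / 4"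
    proof -
      have "(x - t) * x \<le> (x - t) * (x + t)" using True by (intro mult_left_mono) auto
      also have "\<dots> = x\<^sup>2 - t\<^sup>2" by (simp add: power2_eq_square algebra_simps)
      finally have 1: "(x - t) * x \<le> x\<^sup>2 - t\<^sup>2" .
      have 2: "x\<^sup>2 / 2 \<le> x\<^sup>2 + t\<^sup>2 - 2 * \<kappa>" using x(2) zero_le_power2[of t] by linarith
      have "((x - t) * x) * (x\<^sup>2 / 2) \<le> (x\<^sup>2 - t\<^sup>2) * (x\<^sup>2 + t\<^sup>2 - 2 * \<kappa>)"
      proof (rule mult_mono[OF 1 2])
        have "0 \<le> (x - t) * x" using True by (intro mult_nonneg_nonneg) auto
        with 1 show "0 \<le> x\<^sup>2 - t\<^sup>2" by linarith
      qed simp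
      moreover have "(x - t) * a = ((x - t) * x) * (x\<^sup>2 / 2) / 4"
        by (simp add: a_def power2_eq_square power3_eq_cube)
      ultimately show ?thesis by linarith
    qed
    then have "V \<kappa> t - V \<kappa> x \<le> - ((x - t) * a)" using V_diff[of \<kappa> t x] by linarith
    then have "exp (V \<kappa> t - V \<kappa> x) \<le> exp (- ((x - t) * a))" by simp
    moreover have "exp (V \<kappa> t - V \<kappa> x) = 1 / wt \<kappa> t * wt \<kappa> x"
      by (simp add: wt_def exp_diff exp_minus inverse_eq_divide)
    ultimately show ?thesis using True by (simp add: ker_def)
  next
    case False
    then have "ker x t = 0" using x by (auto simp: ker_def indicator_def)
    then show ?thesis by simp
  qed
  have "(LINT t|lborel. \<bar>ker x t\<bar> / wt \<kappa> t) * wt \<kappa> x = (LINT t|lborel. \<bar>ker x t\<bar> / wt \<kappa> t * wt \<kappa> x)"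
    by (rule integral_mult_left_zero[symmetric])
  also have "\<dots> \<le> (LINT t|lborel. indicator {0..x} t *\<^sub>R exp (- ((x - t) * a)))"
    using FTC pt by (intro integral_mono integrable_mult_left integrable_abs_ker_div_wt) (auto simp: has_bochner_integral_iff)
  also have "\<dots> = G x - G 0" using FTC by (simp add: has_bochner_integral_iff)
  also have "\<dots> \<le> 1 / a" using a by (simp add: G_def)
  also have "\<dots> \<le> 16 / (1 + x\<^sup>2)"
  proof -
    have "1\<^sup>2 \<le> x\<^sup>2" using x(2) by simp
    then have "x \<ge> 1" using x(1) power2_le_imp_le[of 1 x] by simp
    then have "x\<^sup>2 \<le> x ^ 3" "1 \<le> x ^ 3" by (auto intro: power_increasing)
    then have "8 * (1 + x\<^sup>2) / x ^ 3 \<le> 16" using x(1) by (simp add: pos_divide_le_eq)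
    moreover have "1 / a * (1 + x\<^sup>2) = 8 * (1 + x\<^sup>2) / x ^ 3" by (simp add: a_def)
    moreover have "1 + x\<^sup>2 > 0" by (simp add: add_pos_nonneg)
    ultimately show ?thesis by (simp only: pos_le_divide_eq)
  qed
  finally show ?thesis .
qed

text \<open>Far out the previous lemma applies; for \<open>x^2 < r\<close> each factor is bounded
  crudely on the compact interval, and evenness covers x < 0. The bound matters because
  \<open>1 / (1 + x^2)\<close> is integrable.\<close>

lemma kernel_weight_bound:
  obtains C where "C > 0" "\<And>x. (LINT t|lborel. \<bar>ker x t\<bar> / wt \<kappa> t) * wt \<kappa> x \<le> C / (1 + x\<^sup>2)"
proof -
  define r where "r = 4 * \<bar>\<kappa>\<bar> + 1"
  obtain d where d: "d > 0" "\<And>x. x \<in> {-r..r} \<Longrightarrow> wt \<kappa> x \<ge> d" using wt_lower_bound by blast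
  define C where "C = 16 + 1 / d * (2 * r) * exp ((\<kappa> + 1)\<^sup>2 / 4) * (1 + r)"
  have r: "r \<ge> 1" by (simp add: r_def)
  have C: "C \<ge> 16" using d r by (simp add: C_def)
  have reflect: "(LINT t|lborel. \<bar>ker (- x) t\<bar> / wt \<kappa> t) = (LINT t|lborel. \<bar>ker x t\<bar> / wt \<kappa> t)" for x
    using lborel_integral_real_affine[of "-1" "\<lambda>t. \<bar>ker (- x) t\<bar> / wt \<kappa> t" 0]
    by (simp add: abs_ker_reflect wt_even)
  have bound: "(LINT t|lborel. \<bar>ker x t\<bar> / wt \<kappa> t) * wt \<kappa> x \<le> C / (1 + x\<^sup>2)" if "x \<ge> 0" for x
  proof (cases "x\<^sup>2 \<ge> r")
    case True
    then have "x > 0" using that r by (cases "x = 0") auto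
    then have "(LINT t|lborel. \<bar>ker x t\<bar> / wt \<kappa> t) * wt \<kappa> x \<le> 16 / (1 + x\<^sup>2)"
      using True by (intro wt_quotient_integral_far) (simp_all add: r_def)
    also have "\<dots> \<le> C / (1 + x\<^sup>2)" using C by (intro divide_right_mono) auto
    finally show ?thesis .
  next
    case False
    have "x \<le> r"
    proof (rule ccontr)
      assume "\<not> x \<le> r"
      then have "r * 1 \<le> x * x" using r by (intro mult_mono) auto
      then show False using False by (simp add: power2_eq_square)
    qed
    have "(LINT t|lborel. \<bar>ker x t\<bar> / wt \<kappa> t) \<le> (LINT t|lborel. 1 / d * indicator {-r..r} t)"
    proof (intro integral_mono integrable_abs_ker_div_wt)
      show "integrable lborel (\<lambda>t. 1 / d * indicator {-r..r} t)"
        using loc_int_const[of 1] by (intro integrable_mult_right) (simp add: loc_int_def)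
      show "\<bar>ker x t\<bar> / wt \<kappa> t \<le> 1 / d * indicator {-r..r} t" for t
      proof (cases "t \<in> {-r..r}")
        case True
        then have "\<bar>ker x t\<bar> / wt \<kappa> t \<le> 1 / d" by (intro frac_le abs_ker_le d) simp_all
        then show ?thesis using True by simp
      next
        case False
        then have "ker x t = 0" using \<open>x \<le> r\<close> that by (intro ker_eq_0) auto
        then show ?thesis using d by simp
      qed
    qed
    also have "\<dots> = 1 / d * (2 * r)" using r by simp
    finally have 1: "(LINT t|lborel. \<bar>ker x t\<bar> / wt \<kappa> t) \<le> 1 / d * (2 * r)" .
    have "exp (- x\<^sup>2 / 2) \<le> 1" by simp
    then have "exp ((\<kappa> + 1)\<^sup>2 / 4) * exp (- x\<^sup>2 / 2) \<le> exp ((\<kappa> + 1)\<^sup>2 / 4) * 1" by (intro mult_left_mono) auto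
    then have "wt \<kappa> x \<le> exp ((\<kappa> + 1)\<^sup>2 / 4)" using wt_le_gauss[of \<kappa> x] by linarith
    then have "(LINT t|lborel. \<bar>ker x t\<bar> / wt \<kappa> t) * wt \<kappa> x \<le> 1 / d * (2 * r) * exp ((\<kappa> + 1)\<^sup>2 / 4)"
      using 1 d r by (intro mult_mono) auto
    then have "(LINT t|lborel. \<bar>ker x t\<bar> / wt \<kappa> t) * wt \<kappa> x * (1 + x\<^sup>2) \<le> 1 / d * (2 * r) * exp ((\<kappa> + 1)\<^sup>2 / 4) * (1 + r)"
    proof (rule mult_mono)
      show "0 \<le> 1 / d * (2 * r) * exp ((\<kappa> + 1)\<^sup>2 / 4)" using d r by simp
    qed (use False in simp_all)
    also have "\<dots> \<le> C" by (simp add: C_def)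
    finally show ?thesis by (simp add: pos_le_divide_eq add_pos_nonneg)
  qed
  show ?thesis
  proof (rule that[of C])
    fix x show "(LINT t|lborel. \<bar>ker x t\<bar> / wt \<kappa> t) * wt \<kappa> x \<le> C / (1 + x\<^sup>2)"
      using bound[of x] bound[of "- x"] reflect[of x] by (cases "x \<ge> 0") (auto simp: wt_even)
  qed (use C in simp)
qed

text \<open>Cauchy--Schwarz for the splitting \<open>ker x t * g t = (ker x t / sqrt (wt t)) * (g t * sqrt (wt t))\<close>.\<close>
lemma prim_square_le:
  assumes g: "g \<in> L2 \<kappa>" and M: "M > 0" "(LINT t|lborel. \<bar>ker x t\<bar> / wt \<kappa> t) \<le> M"
  shows "(prim g x)\<^sup>2 \<le> M * (LINT t|lborel. (g t)\<^sup>2 * wt \<kappa> t)"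
proof -
  let ?W = "prim g x" and ?G = "LINT t|lborel. (g t)\<^sup>2 * wt \<kappa> t" and ?J = "LINT t|lborel. \<bar>ker x t\<bar> / wt \<kappa> t"
  \<comment> \<open>The minimiser of the quadratic \<open>G - 2 l W + l^2 M\<close> in l.\<close>
  define l where "l = ?W / M"
  have int: "integrable lborel (\<lambda>t. (g t)\<^sup>2 * wt \<kappa> t)" "integrable lborel (\<lambda>t. ker x t * g t)"
      "integrable lborel (\<lambda>t. \<bar>ker x t\<bar> / wt \<kappa> t)"
    using g by (auto simp: L2_iff intro!: prim_integrable[OF L2_loc_int[OF g]] integrable_abs_ker_div_wt)
  have "0 \<le> (LINT t|lborel. (g t)\<^sup>2 * wt \<kappa> t - 2 * l * (ker x t * g t) + l\<^sup>2 * (\<bar>ker x t\<bar> / wt \<kappa> t))"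
  proof (intro integral_nonneg_AE AE_I2)
    fix t
    have w: "wt \<kappa> t > 0" by (rule wt_pos)
    have k: "\<bar>ker x t\<bar> = (ker x t)\<^sup>2" by (auto simp: ker_def indicator_def)
    have "(g t)\<^sup>2 * wt \<kappa> t - 2 * l * (ker x t * g t) + l\<^sup>2 * (\<bar>ker x t\<bar> / wt \<kappa> t) = (g t * wt \<kappa> t - l * ker x t)\<^sup>2 / wt \<kappa> t"
      unfolding k using w by (simp add: field_simps power2_eq_square)
    then show "0 \<le> (g t)\<^sup>2 * wt \<kappa> t - 2 * l * (ker x t * g t) + l\<^sup>2 * (\<bar>ker x t\<bar> / wt \<kappa> t)" using w by simp
  qed
  also have "\<dots> = (LINT t|lborel. (g t)\<^sup>2 * wt \<kappa> t - 2 * l * (ker x t * g t)) + (LINT t|lborel. l\<^sup>2 * (\<bar>ker x t\<bar> / wt \<kappa> t))"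
    by (intro Bochner_Integration.integral_add Bochner_Integration.integrable_diff integrable_mult_right int)
  also have "(LINT t|lborel. (g t)\<^sup>2 * wt \<kappa> t - 2 * l * (ker x t * g t)) = ?G - (LINT t|lborel. 2 * l * (ker x t * g t))"
    by (intro Bochner_Integration.integral_diff integrable_mult_right int)
  also have "?G - (LINT t|lborel. 2 * l * (ker x t * g t)) + (LINT t|lborel. l\<^sup>2 * (\<bar>ker x t\<bar> / wt \<kappa> t)) = ?G - 2 * l * ?W + l\<^sup>2 * ?J"
    by (simp only: integral_mult_right_zero prim_def)
  also have "\<dots> \<le> ?G - 2 * l * ?W + l\<^sup>2 * M" using M by (intro add_left_mono mult_left_mono) auto
  also have "\<dots> = ?G - ?W\<^sup>2 / M" using M by (simp add: l_def power2_eq_square field_simps)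
  finally show ?thesis using M by (simp add: field_simps)
qed

lemma integrable_inverse_1_plus_square': "integrable lborel (\<lambda>x::real. 1 / (1 + x\<^sup>2))"
proof -
  have "integrable lborel (\<lambda>x::real. indicator UNIV x *\<^sub>R inverse (1 + x\<^sup>2))"
    using integrable_inverse_1_plus_square unfolding set_integrable_def by simp
  then show ?thesis unfolding inverse_eq_divide by simp
qed

lemma prim_L2_bound:
  obtains K where "K > 0" "\<And>g. g \<in> L2 \<kappa> \<Longrightarrow> prim g \<in> L2 \<kappa>"
    "\<And>g. g \<in> L2 \<kappa> \<Longrightarrow> (LINT x|lborel. (prim g x)\<^sup>2 * wt \<kappa> x) \<le> K * (LINT x|lborel. (g x)\<^sup>2 * wt \<kappa> x)"
proof -
  obtain C where C: "C > 0" "\<And>x. (LINT t|lborel. \<bar>ker x t\<bar> / wt \<kappa> t) * wt \<kappa> x \<le> C / (1 + x\<^sup>2)"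
    using kernel_weight_bound by blast
  let ?G = "\<lambda>g. LINT t|lborel. (g t)\<^sup>2 * wt \<kappa> t"
  have pt: "(prim g x)\<^sup>2 * wt \<kappa> x \<le> C * ?G g * (1 / (1 + x\<^sup>2))" if "g \<in> L2 \<kappa>" for g x
  proof -
    have s: "1 + x\<^sup>2 > 0" by (simp add: add_pos_nonneg)
    have "(prim g x)\<^sup>2 \<le> C / (1 + x\<^sup>2) / wt \<kappa> x * ?G g"
    proof (rule prim_square_le[OF that])
      show "C / (1 + x\<^sup>2) / wt \<kappa> x > 0" using C(1) s wt_pos[of \<kappa> x] by simp
      show "(LINT t|lborel. \<bar>ker x t\<bar> / wt \<kappa> t) \<le> C / (1 + x\<^sup>2) / wt \<kappa> x"
        using C(2)[of x] by (simp only: pos_le_divide_eq[OF wt_pos])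
    qed
    then have "(prim g x)\<^sup>2 * wt \<kappa> x \<le> C / (1 + x\<^sup>2) / wt \<kappa> x * ?G g * wt \<kappa> x" by (intro mult_right_mono) auto
    then show ?thesis by simp
  qed
  have m: "prim g \<in> borel_measurable borel" if "g \<in> L2 \<kappa>" for g
    using that by (intro measurable_prim) (simp add: L2_iff)
  have L2: "prim g \<in> L2 \<kappa>" if g: "g \<in> L2 \<kappa>" for g
  proof -
    have "integrable lborel (\<lambda>x. (prim g x)\<^sup>2 * wt \<kappa> x)"
    proof (rule Bochner_Integration.integrable_bound)
      show "integrable lborel (\<lambda>x. C * ?G g * (1 / (1 + x\<^sup>2)))"
        by (intro integrable_mult_right integrable_inverse_1_plus_square')
      have "norm ((prim g x)\<^sup>2 * wt \<kappa> x) \<le> norm (C * ?G g * (1 / (1 + x\<^sup>2)))" for x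
      proof -
        have "norm ((prim g x)\<^sup>2 * wt \<kappa> x) = (prim g x)\<^sup>2 * wt \<kappa> x" by simp
        also note pt[OF g]
        also have "C * ?G g * (1 / (1 + x\<^sup>2)) \<le> norm (C * ?G g * (1 / (1 + x\<^sup>2)))" unfolding real_norm_def by (rule abs_ge_self)
        finally show ?thesis .
      qed
      then show "AE x in lborel. norm ((prim g x)\<^sup>2 * wt \<kappa> x) \<le> norm (C * ?G g * (1 / (1 + x\<^sup>2)))" by (rule AE_I2)
      show "(\<lambda>x. (prim g x)\<^sup>2 * wt \<kappa> x) \<in> borel_measurable lborel" using m[OF g] by measurable
    qed
    then show ?thesis using m[OF g] by (simp add: L2_iff)
  qed
  define K where "K = C * (LINT x|lborel. 1 / (1 + (x::real)\<^sup>2)) + 1"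
  have K: "(LINT x|lborel. (prim g x)\<^sup>2 * wt \<kappa> x) \<le> K * ?G g" if g: "g \<in> L2 \<kappa>" for g
  proof -
    have "(LINT x|lborel. (prim g x)\<^sup>2 * wt \<kappa> x) \<le> (LINT x|lborel. C * ?G g * (1 / (1 + x\<^sup>2)))"
    proof (rule integral_mono)
      show "integrable lborel (\<lambda>x. (prim g x)\<^sup>2 * wt \<kappa> x)" using L2[OF g] by (simp add: L2_iff)
      show "integrable lborel (\<lambda>x. C * ?G g * (1 / (1 + x\<^sup>2)))"
        by (intro integrable_mult_right integrable_inverse_1_plus_square')
    qed (rule pt[OF g])
    also have "\<dots> = C * ?G g * (LINT x|lborel. 1 / (1 + (x::real)\<^sup>2))" by (rule integral_mult_right_zero)
    also have "\<dots> \<le> K * ?G g"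
    proof -
      have "?G g \<ge> 0" by (intro integral_nonneg_AE) simp
      then show ?thesis by (simp add: K_def algebra_simps)
    qed
    finally show ?thesis .
  qed
  have "(LINT x|lborel. 1 / (1 + (x::real)\<^sup>2)) \<ge> 0" by (intro integral_nonneg_AE) (simp add: add_nonneg_nonneg)
  then have "K > 0" using C(1) by (simp add: K_def add_nonneg_pos)
  then show ?thesis using that L2 K by blast
qed

lemma integral_nu_L2: "u \<in> L2 \<kappa> \<Longrightarrow> (LINT x|nu \<kappa>. (u x)\<^sup>2) = (LINT x|lborel. (u x)\<^sup>2 * wt \<kappa> x) / Z \<kappa>"
  by (rule integral_nu) (auto simp: L2_iff)

lemma L2_integrable_nu: assumes "u \<in> L2 \<kappa>"
  shows "integrable (nu \<kappa>) u" "integrable (nu \<kappa>) (\<lambda>x. (u x)\<^sup>2)"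
proof -
  interpret prob_space "nu \<kappa>" by (rule prob_space_nu)
  have m: "u \<in> borel_measurable (nu \<kappa>)"
    using assms measurable_cong_sets[OF sets_nu refl] by (auto simp: L2_iff)
  show s: "integrable (nu \<kappa>) (\<lambda>x. (u x)\<^sup>2)" using assms by (simp add: L2_def)
  show "integrable (nu \<kappa>) u"
    by (rule square_integrable_imp_integrable[OF m s])
qed

lemma AE_nu_iff: "(AE x in nu \<kappa>. P x) \<longleftrightarrow> (AE x in lborel. P x)"
  unfolding nu_eq using Z_pos[of \<kappa>] by (subst AE_density) (auto simp: wt_pos)

text \<open>With \<open>w = prim g + c\<close>, the integral of \<open>(w - c)^2\<close> is the
  variance of w plus \<open>(c - m)^2\<close>, so the unknown constant can only help.\<close>

lemma Poincare:
  obtains K where "K > 0"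
    "\<And>w g. w \<in> L2 \<kappa> \<Longrightarrow> g \<in> L2 \<kappa> \<Longrightarrow> weak_deriv w g \<Longrightarrow>
       (LINT x|nu \<kappa>. (w x)\<^sup>2) \<le> K * (LINT x|nu \<kappa>. (g x)\<^sup>2) + (LINT x|nu \<kappa>. w x)\<^sup>2"
proof -
  obtain K where K: "K > 0" "\<And>g. g \<in> L2 \<kappa> \<Longrightarrow> prim g \<in> L2 \<kappa>"
    "\<And>g. g \<in> L2 \<kappa> \<Longrightarrow> (LINT x|lborel. (prim g x)\<^sup>2 * wt \<kappa> x) \<le> K * (LINT x|lborel. (g x)\<^sup>2 * wt \<kappa> x)"
    by (rule prim_L2_bound[of \<kappa>]) blast
  interpret prob_space "nu \<kappa>" by (rule prob_space_nu)
  show ?thesis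
  proof (rule that[OF K(1)])
    fix w g assume w: "w \<in> L2 \<kappa>" and g: "g \<in> L2 \<kappa>" and wg: "weak_deriv w g"
    obtain c where c: "AE x in lborel. w x = prim g x + c"
      using weak_deriv_eq_prim[OF L2_loc_int[OF w] L2_loc_int[OF g] wg] by blast
    note int = L2_integrable_nu[OF w]
    define m where "m = (LINT x|nu \<kappa>. w x)"
    have "(LINT x|nu \<kappa>. (prim g x)\<^sup>2) = (LINT x|nu \<kappa>. (w x)\<^sup>2 - 2 * c * w x + c\<^sup>2)"
    proof (rule integral_cong_AE)
      show "AE x in nu \<kappa>. (prim g x)\<^sup>2 = (w x)\<^sup>2 - 2 * c * w x + c\<^sup>2"
        unfolding AE_nu_iff using c
      proof eventually_elim
        fix x assume "w x = prim g x + c"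
        then have "prim g x = w x - c" by linarith
        then show "(prim g x)\<^sup>2 = (w x)\<^sup>2 - 2 * c * w x + c\<^sup>2" by (simp add: power2_diff)
      qed
      show "(\<lambda>x. (prim g x)\<^sup>2) \<in> borel_measurable (nu \<kappa>)"
        by (rule borel_measurable_integrable[OF L2_integrable_nu(2)[OF K(2)[OF g]]])
      have [measurable]: "w \<in> borel_measurable (nu \<kappa>)" by (rule borel_measurable_integrable[OF int(1)])
      show "(\<lambda>x. (w x)\<^sup>2 - 2 * c * w x + c\<^sup>2) \<in> borel_measurable (nu \<kappa>)" by measurable
    qed
    also have "\<dots> = (LINT x|nu \<kappa>. (w x)\<^sup>2) - 2 * c * m + c\<^sup>2"
    proof -
      have "(LINT x|nu \<kappa>. (w x)\<^sup>2 - 2 * c * w x + c\<^sup>2) = (LINT x|nu \<kappa>. (w x)\<^sup>2 - 2 * c * w x) + (LINT x|nu \<kappa>. c\<^sup>2)"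
        by (intro Bochner_Integration.integral_add Bochner_Integration.integrable_diff integrable_mult_right int) simp
      also have "(LINT x|nu \<kappa>. (w x)\<^sup>2 - 2 * c * w x) = (LINT x|nu \<kappa>. (w x)\<^sup>2) - (LINT x|nu \<kappa>. 2 * c * w x)"
        by (intro Bochner_Integration.integral_diff integrable_mult_right int)
      also have "(LINT x|nu \<kappa>. 2 * c * w x) = 2 * c * m" unfolding m_def by (rule integral_mult_right_zero)
      also have "(LINT x|nu \<kappa>. c\<^sup>2) = c\<^sup>2" using prob_space by simp
      finally show ?thesis .
    qed
    also have "\<dots> = (LINT x|nu \<kappa>. (w x)\<^sup>2) - m\<^sup>2 + (c - m)\<^sup>2"
      by (simp add: power2_eq_square algebra_simps)
    finally have "(LINT x|nu \<kappa>. (w x)\<^sup>2) - m\<^sup>2 \<le> (LINT x|nu \<kappa>. (prim g x)\<^sup>2)"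
      using zero_le_power2[of "c - m"] by linarith
    also have "\<dots> \<le> K * (LINT x|nu \<kappa>. (g x)\<^sup>2)"
    proof -
      have "(LINT x|lborel. (prim g x)\<^sup>2 * wt \<kappa> x) / Z \<kappa> \<le> K * (LINT x|lborel. (g x)\<^sup>2 * wt \<kappa> x) / Z \<kappa>"
        by (rule divide_right_mono[OF K(3)[OF g]]) (use Z_pos[of \<kappa>] in simp)
      then show ?thesis by (simp only: integral_nu_L2[OF g] integral_nu_L2[OF K(2)[OF g]] times_divide_eq_right)
    qed
    finally show "(LINT x|nu \<kappa>. (w x)\<^sup>2) \<le> K * (LINT x|nu \<kappa>. (g x)\<^sup>2) + (LINT x|nu \<kappa>. w x)\<^sup>2"
      unfolding m_def by linarith
  qed
qed

lemma L2norm_triangle: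
  assumes "u \<in> L2 \<kappa>" "v \<in> L2 \<kappa>" shows "L2norm \<kappa> u \<le> L2norm \<kappa> (\<lambda>x. u x - v x) + L2norm \<kappa> v"
proof -
  define a where "a = (\<lambda>x. u x - v x)"
  have a: "a \<in> L2 \<kappa>" unfolding a_def by (rule L2_diff[OF assms])
  let ?N = "\<lambda>f. LINT x|nu \<kappa>. (f x)\<^sup>2"
  have prod: "integrable (nu \<kappa>) (\<lambda>x. a x * v x)"
  proof (rule Bochner_Integration.integrable_bound)
    show "integrable (nu \<kappa>) (\<lambda>x. (a x)\<^sup>2 + (v x)\<^sup>2)"
      using L2_integrable_nu[OF a] L2_integrable_nu[OF assms(2)] by simp
    have "\<bar>a x * v x\<bar> \<le> (a x)\<^sup>2 + (v x)\<^sup>2" for x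
    proof -
      have "0 \<le> (\<bar>a x\<bar> - \<bar>v x\<bar>)\<^sup>2" by simp
      then have "2 * (\<bar>a x\<bar> * \<bar>v x\<bar>) \<le> (a x)\<^sup>2 + (v x)\<^sup>2" unfolding power2_diff by simp
      moreover have "0 \<le> \<bar>a x\<bar> * \<bar>v x\<bar>" by simp
      ultimately show ?thesis unfolding abs_mult by linarith
    qed
    then show "AE x in nu \<kappa>. norm (a x * v x) \<le> norm ((a x)\<^sup>2 + (v x)\<^sup>2)" by simp
    show "(\<lambda>x. a x * v x) \<in> borel_measurable (nu \<kappa>)"
      using L2_integrable_nu(1)[OF a] L2_integrable_nu(1)[OF assms(2)] by simp
  qed
  have nn: "?N f \<ge> 0" for f :: "real \<Rightarrow> real" by (intro integral_nonneg_AE) simp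
  have quad: "0 \<le> s\<^sup>2 * ?N a - 2 * s * t * (LINT x|nu \<kappa>. a x * v x) + t\<^sup>2 * ?N v" for s t
  proof -
    have "0 \<le> (LINT x|nu \<kappa>. (s * a x - t * v x)\<^sup>2)" by (intro integral_nonneg_AE) simp
    also have "\<dots> = (LINT x|nu \<kappa>. s\<^sup>2 * (a x)\<^sup>2 - 2 * s * t * (a x * v x) + t\<^sup>2 * (v x)\<^sup>2)"
      by (simp add: power2_eq_square algebra_simps)
    finally show ?thesis using prod L2_integrable_nu(2)[OF a] L2_integrable_nu(2)[OF assms(2)] by simp
  qed
  have CS: "(LINT x|nu \<kappa>. a x * v x) \<le> L2norm \<kappa> a * L2norm \<kappa> v"
  proof -
    define A B I where "A = L2norm \<kappa> a" and "B = L2norm \<kappa> v" and "I = (LINT x|nu \<kappa>. a x * v x)"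
    have AB: "A \<ge> 0" "B \<ge> 0" "?N a = A\<^sup>2" "?N v = B\<^sup>2" by (auto simp: A_def B_def L2norm_def nn)
    have "I \<le> A * B"
    proof (cases "A = 0 \<or> B = 0")
      case True
      show ?thesis
      proof (rule ccontr)
        assume "\<not> I \<le> A * B"
        then have I: "I > 0" using True by auto
        show False
        proof (cases "A = 0")
          case True
          \<comment> \<open>With A = 0 the form becomes \<open>- 2 s I + B^2\<close>; this s makes
            it \<open>- B^2 - 2\<close>.\<close>
          then show False using quad[of "(B\<^sup>2 + 1) / I" 1] I AB zero_le_power2[of B] by (simp add: I_def[symmetric])
        next
          case False
          then have "B = 0" using \<open>A = 0 \<or> B = 0\<close> by simp
          then show False using quad[of 1 "(A\<^sup>2 + 1) / I"] I AB zero_le_power2[of A] by (simp add: I_def[symmetric])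
        qed
      qed
    next
      case False
      then have "A * B > 0" using AB by auto
      moreover have "0 \<le> 2 * (A * B) * (A * B - I)"
        using quad[of B A] AB by (simp add: I_def[symmetric] power2_eq_square algebra_simps)
      ultimately show ?thesis by (simp add: zero_le_mult_iff)
    qed
    then show ?thesis by (simp add: A_def B_def I_def)
  qed
  have "?N u = (LINT x|nu \<kappa>. (a x)\<^sup>2 + 2 * (a x * v x) + (v x)\<^sup>2)"
    by (simp add: a_def power2_eq_square algebra_simps)
  also have "\<dots> = ?N a + 2 * (LINT x|nu \<kappa>. a x * v x) + ?N v"
    using prod L2_integrable_nu(2)[OF a] L2_integrable_nu(2)[OF assms(2)] by simp
  also have "\<dots> \<le> (L2norm \<kappa> a + L2norm \<kappa> v)\<^sup>2"
    using CS nn[of a] nn[of v] by (simp add: power2_sum L2norm_def)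
  finally show ?thesis unfolding a_def[symmetric] using nn[of a] nn[of v]
    by (simp add: L2norm_def real_le_lsqrt)
qed

lemma L2norm_AE_cong:
  assumes "u \<in> L2 \<kappa>" "v \<in> L2 \<kappa>" "AE x in lborel. u x = v x" shows "L2norm \<kappa> u = L2norm \<kappa> v"
proof -
  have "(LINT x|nu \<kappa>. (u x)\<^sup>2) = (LINT x|nu \<kappa>. (v x)\<^sup>2)"
    using assms L2_integrable_nu(2)[of _ \<kappa>]
    by (intro integral_cong_AE) (auto simp: AE_nu_iff elim: eventually_mono)
  then show ?thesis by (simp add: L2norm_def)
qed

text \<open>\<open>wderiv\<close> is an arbitrary choice, determined only almost everywhere. The
  choices for u and for u minus a polynomial are therefore comparable only through almost-everywhere
  equality.\<close>

lemma wderiv_props: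
  assumes "u \<in> L2 \<kappa>" "g \<in> L2 \<kappa>" "weak_deriv u g"
  shows "wderiv \<kappa> u \<in> L2 \<kappa>" "weak_deriv u (wderiv \<kappa> u)" "AE x in lborel. wderiv \<kappa> u x = g x"
proof -
  have "wderiv \<kappa> u \<in> L2 \<kappa> \<and> weak_deriv u (wderiv \<kappa> u)"
    unfolding wderiv_def by (rule someI[of _ g]) (use assms in simp)
  then show *: "wderiv \<kappa> u \<in> L2 \<kappa>" "weak_deriv u (wderiv \<kappa> u)" by auto
  show "AE x in lborel. wderiv \<kappa> u x = g x"
    by (rule weak_deriv_unique[OF L2_loc_int L2_loc_int]) (use * assms in auto)
qed

lemma H1norm_eq: "(H1norm \<kappa> u)\<^sup>2 = (L2norm \<kappa> (wderiv \<kappa> u))\<^sup>2 + (LINT x|nu \<kappa>. u x)\<^sup>2"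
  and H1norm_nonneg: "H1norm \<kappa> u \<ge> 0"
proof -
  have "(LINT x|nu \<kappa>. (wderiv \<kappa> u x)\<^sup>2) \<ge> 0" by (intro integral_nonneg_AE) simp
  then show "(H1norm \<kappa> u)\<^sup>2 = (L2norm \<kappa> (wderiv \<kappa> u))\<^sup>2 + (LINT x|nu \<kappa>. u x)\<^sup>2" "H1norm \<kappa> u \<ge> 0"
    by (auto simp: H1norm_def L2norm_def)
qed

lemma L2norm_wderiv_le_H1norm: "L2norm \<kappa> (wderiv \<kappa> u) \<le> H1norm \<kappa> u"
  by (rule power2_le_imp_le) (auto simp: H1norm_eq H1norm_nonneg)

text \<open>The Poincare inequality lets the H1 distance of u to \<open>v k\<close> control the L2
  distance. Its unspecified constant K multiplies only this distance, so it disappears in the limit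
  and the constant of the polynomial gap survives unchanged.\<close>

lemma qclosure_bound:
  assumes good: "freud.seq.good \<kappa> m" and u: "u \<in> qclosure \<kappa> m"
  shows "L2norm \<kappa> u \<le> 12233 / 10000 / real m powr (3/4) * H1norm \<kappa> u"
proof -
  define B where "B = 12233 / 10000 / real m powr (3/4)"
  have B: "B \<ge> 0" by (simp add: B_def)
  obtain K where K: "K > 0" "\<And>w g. w \<in> L2 \<kappa> \<Longrightarrow> g \<in> L2 \<kappa> \<Longrightarrow> weak_deriv w g \<Longrightarrow>
       (LINT x|nu \<kappa>. (w x)\<^sup>2) \<le> K * (LINT x|nu \<kappa>. (g x)\<^sup>2) + (LINT x|nu \<kappa>. w x)\<^sup>2"
    by (rule Poincare[of \<kappa>]) blast
  obtain v where v: "\<And>k. v k \<in> qspan \<kappa> m" "(\<lambda>k. H1norm \<kappa> (\<lambda>x. u x - v k x)) \<longlonglongrightarrow> 0"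
    using u by (auto simp: qclosure_def)
  obtain g where ug: "u \<in> L2 \<kappa>" "g \<in> L2 \<kappa>" "weak_deriv u g"
    using u by (auto simp: qclosure_def H1_def)
  note wu = wderiv_props[OF ug]
  define D where "D = (sqrt (K + 1) + B)"
  have "L2norm \<kappa> u \<le> B * H1norm \<kappa> u + D * H1norm \<kappa> (\<lambda>x. u x - v k x)" for k
  proof -
    obtain Q where Q: "v k = poly Q" "Enu \<kappa> Q = 0" "\<And>k. k < m \<Longrightarrow> Enu \<kappa> (pderiv Q * freud.mon \<kappa> k) = 0"
      by (rule qspan_poly[OF v(1)[of k]]) blast
    define w where "w = (\<lambda>x. u x - v k x)"
    have w: "w \<in> L2 \<kappa>" unfolding w_def Q(1) by (intro L2_diff ug L2_poly)
    have wg: "weak_deriv w (\<lambda>x. wderiv \<kappa> u x - poly (pderiv Q) x)"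
      unfolding w_def Q(1) by (intro weak_deriv_diff L2_loc_int[of _ \<kappa>] L2_poly ug wu weak_deriv_poly)
    have g': "(\<lambda>x. wderiv \<kappa> u x - poly (pderiv Q) x) \<in> L2 \<kappa>" by (intro L2_diff wu L2_poly)
    note ww = wderiv_props[OF w g' wg]
    have "(L2norm \<kappa> w)\<^sup>2 \<le> K * (L2norm \<kappa> (wderiv \<kappa> w))\<^sup>2 + (LINT x|nu \<kappa>. w x)\<^sup>2"
      using K(2)[OF w ww(1,2)] by (simp add: L2norm_def integral_nonneg_AE)
    also have "\<dots> \<le> (K + 1) * (H1norm \<kappa> w)\<^sup>2"
      unfolding H1norm_eq using K(1) by (simp add: algebra_simps)
    also have "\<dots> = (sqrt (K + 1) * H1norm \<kappa> w)\<^sup>2"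
      unfolding power_mult_distrib using K(1) by simp
    finally have "L2norm \<kappa> w \<le> sqrt (K + 1) * H1norm \<kappa> w"
      by (rule power2_le_imp_le) (use K(1) in \<open>intro mult_nonneg_nonneg H1norm_nonneg; simp\<close>)
    moreover have "L2norm \<kappa> (poly Q) \<le> B * L2norm \<kappa> (poly (pderiv Q))"
    proof -
      have "Enu \<kappa> (Q * Q) \<le> B\<^sup>2 * Enu \<kappa> (pderiv Q * pderiv Q)"
        unfolding B_def by (rule freud.poly_gap[OF good Q(2,3)])
      then have "sqrt (Enu \<kappa> (Q * Q)) \<le> sqrt (B\<^sup>2 * Enu \<kappa> (pderiv Q * pderiv Q))" by simp
      then show ?thesis using B by (simp add: L2norm_def Enu_def power2_eq_square[symmetric] real_sqrt_mult)
    qed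
    moreover have "L2norm \<kappa> (poly (pderiv Q)) \<le> H1norm \<kappa> w + H1norm \<kappa> u"
    proof -
      have "L2norm \<kappa> (poly (pderiv Q)) \<le> L2norm \<kappa> (\<lambda>x. poly (pderiv Q) x - wderiv \<kappa> u x) + L2norm \<kappa> (wderiv \<kappa> u)"
        by (intro L2norm_triangle L2_poly wu)
      also have "L2norm \<kappa> (\<lambda>x. poly (pderiv Q) x - wderiv \<kappa> u x) = L2norm \<kappa> (\<lambda>x. wderiv \<kappa> u x - poly (pderiv Q) x)"
        by (simp add: L2norm_def power2_commute)
      also have "\<dots> = L2norm \<kappa> (wderiv \<kappa> w)" by (rule L2norm_AE_cong[OF ww(1) g' ww(3), symmetric])
      finally show ?thesis using L2norm_wderiv_le_H1norm[of \<kappa> w] L2norm_wderiv_le_H1norm[of \<kappa> u] by linarith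
    qed
    then have "B * L2norm \<kappa> (poly (pderiv Q)) \<le> B * (H1norm \<kappa> w + H1norm \<kappa> u)" using B by (rule mult_left_mono)
    moreover have "L2norm \<kappa> u \<le> L2norm \<kappa> w + L2norm \<kappa> (poly Q)"
      unfolding w_def Q(1) by (intro L2norm_triangle ug L2_poly)
    ultimately have "L2norm \<kappa> u \<le> sqrt (K + 1) * H1norm \<kappa> w + B * (H1norm \<kappa> w + H1norm \<kappa> u)" by linarith
    also have "\<dots> = B * H1norm \<kappa> u + D * H1norm \<kappa> w" by (simp add: D_def distrib_left distrib_right)
    finally show ?thesis unfolding w_def .
  qed
  then have ex: "\<exists>N. \<forall>k\<ge>N. L2norm \<kappa> u \<le> B * H1norm \<kappa> u + D * H1norm \<kappa> (\<lambda>x. u x - v k x)" by blast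
  have lim: "(\<lambda>k. B * H1norm \<kappa> u + D * H1norm \<kappa> (\<lambda>x. u x - v k x)) \<longlonglongrightarrow> B * H1norm \<kappa> u + D * 0"
    by (intro tendsto_add tendsto_mult tendsto_const v)
  have "L2norm \<kappa> u \<le> B * H1norm \<kappa> u + D * 0"
    by (rule LIMSEQ_le_const[OF lim ex])
  then show ?thesis unfolding B_def by simp
qed

theorem mainTheorem12:
  fixes \<kappa> :: real
  shows "(\<exists>C>0. \<exists>N::nat. \<forall>m\<ge>N. \<forall>u\<in>qclosure \<kappa> m.
            L2norm \<kappa> u \<le> C / (real m powr (3/4)) * H1norm \<kappa> u)
       \<and> (\<forall>m\<ge>(2187::nat). \<forall>u\<in>qclosure 4 m.
            L2norm 4 u \<le> 1.2233 / (real m powr (3/4)) * H1norm 4 u)"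
proof
  obtain N where "\<forall>m\<ge>N. freud.seq.good \<kappa> m" using freud.seq.eventually_good[of \<kappa>] by blast
  then show "\<exists>C>0. \<exists>N::nat. \<forall>m\<ge>N. \<forall>u\<in>qclosure \<kappa> m.
            L2norm \<kappa> u \<le> C / (real m powr (3/4)) * H1norm \<kappa> u"
    \<comment> \<open>The same C serves every \<kappa>; only N depends on it.\<close>
    using qclosure_bound by (intro exI[of _ "12233 / 10000"] conjI exI[of _ N]) auto
  have eq: "(1.2233 :: real) = 12233 / 10000" by simp
  show "\<forall>m\<ge>(2187::nat). \<forall>u\<in>qclosure 4 m. L2norm 4 u \<le> 1.2233 / (real m powr (3/4)) * H1norm 4 u"
    unfolding eq using freud.seq.good_4[OF refl] qclosure_bound by blast
qed

end
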